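(* Let $n\ge1$, $m\in(1,2)$, and let $W_0$ satisfy (W1) and (W2) with an exponent $k$ such that $k>-n(m-1)$ and $k\geq -n+2$. Then for every $R_0>0$ there exists a radially symmetric potential $\widetilde W\in C^\infty(\mathbb{R}^n\setminus\{0\})$ with $\widetilde W'(r)>0$ for all $r>0$, with $\nabla\widetilde W\in L^\infty(B(0,R_0)^c)$, and with $\widetilde W=W_0$ in $B(0,R_0)$, such that the equation $\partial_t \rho=\Delta\rho^m+\nabla\cdot(\rho\nabla( \widetilde W*\rho))$ on $\mathbb{R}^n$ has infinitely many (distinct) radially decreasing steady states in $\mathcal{P}(\mathbb{R}^n)\cap L^\infty(\mathbb{R}^n)$.
   Context: $\mathcal{P}(\mathbb{R}^n)$ denotes the probability densities on $\mathbb{R}^n$; $r=|x|$. (W1): $W\in C^\infty(\mathbb{R}^n\setminus\{0\})$ is radially symmetric and $W'(r)>0$ for all $r>0$. (W2): there exist $k>-n$ and $C_w>0$ with $W'(r)\le C_w r^{k-1}$ for all $r\in(0,1)$. Steady state for a potential $W$: $\rho_s\in\mathcal{P}(\mathbb{R}^n)\cap L^\infty(\mathbb{R}^n)$ with $\nabla\rho_s^m\in H^1_{loc}$, $\nabla W*\rho_s\in L^1_{loc}$, and $\nabla\rho_s^m=-\rho_s\nabla W*\rho_s$ in distributions on $\mathbb{R}^n$ (plus, if $W$ satisfies (W2) with some $k\in(-n,1-n)$, $\rho_s\in C^{0,\alpha}$ for some $\alpha\in(1-k-n,1)$, and if $W(x)\to\infty$ as $|x|\to\infty$, $\rho_s(x)W(1+|x|)\in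 L^1$). Radially decreasing means radially symmetric and nonincreasing in $|x|$. *)

theory Defs
  imports "HOL-Analysis.Analysis"
begin

fun Ck_on :: "nat \<Rightarrow> ('a::euclidean_space \<Rightarrow> 'b::real_normed_vector) \<Rightarrow> 'a set \<Rightarrow> bool" where
  "Ck_on 0 f S = continuous_on S f"
| "Ck_on (Suc k) f S =
     (f differentiable_on S \<and> (\<forall>b\<in>Basis. Ck_on k (\<lambda>x. frechet_derivative f (at x) b) S))"

definition smooth_on :: "('a::euclidean_space \<Rightarrow> 'b::real_normed_vector) \<Rightarrow> 'a set \<Rightarrow> bool" where
  "smooth_on f S \<longleftrightarrow> (\<forall>k. Ck_on k f S)"

definition test_function :: "('a::euclidean_space \<Rightarrow> real) \<Rightarrow> bool" where
  "test_function \<phi> \<longleftrightarrow> smooth_on \<phi> UNIV \<and> compact (closure {x. \<phi> x \<noteq> 0})"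

definition grad :: "('a::euclidean_space \<Rightarrow> real) \<Rightarrow> 'a \<Rightarrow> 'a" where
  "grad f x = (\<Sum>b\<in>Basis. frechet_derivative f (at x) b *\<^sub>R b)"

definition loc_integrable :: "('a::euclidean_space \<Rightarrow> 'b::{banach,second_countable_topology}) \<Rightarrow> bool" where
  "loc_integrable f \<longleftrightarrow> (\<forall>K. compact K \<longrightarrow> set_integrable lebesgue K f)"

definition L2_loc :: "('a::euclidean_space \<Rightarrow> 'b::euclidean_space) \<Rightarrow> bool" where
  "L2_loc f \<longleftrightarrow> f \<in> borel_measurable lebesgue \<and> loc_integrable (\<lambda>x. (norm (f x))\<^sup>2)"

definition Linf :: "('a::euclidean_space \<Rightarrow> real) \<Rightarrow> bool" where
  "Linf f \<longleftrightarrow> f \<in> borel_measurable lebesgue \<and> (\<exists>C. AE x in lebesgue. \<bar>f x\<bar> \<le> C)"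

definition weak_gradient :: "('a::euclidean_space \<Rightarrow> real) \<Rightarrow> ('a \<Rightarrow> 'a) \<Rightarrow> bool" where
  "weak_gradient f G \<longleftrightarrow> loc_integrable f \<and> loc_integrable G \<and>
     (\<forall>\<phi>. test_function \<phi> \<longrightarrow>
        (\<integral>x. f x *\<^sub>R grad \<phi> x \<partial>lebesgue) = - (\<integral>x. \<phi> x *\<^sub>R G x \<partial>lebesgue))"

definition H1_loc :: "('a::euclidean_space \<Rightarrow> 'a) \<Rightarrow> bool" where
  "H1_loc G \<longleftrightarrow> L2_loc G \<and> (\<forall>b\<in>Basis. \<exists>H. weak_gradient (\<lambda>x. G x \<bullet> b) H \<and> L2_loc H)"

definition holder :: "real \<Rightarrow> ('a::euclidean_space \<Rightarrow> real) \<Rightarrow> bool" where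
  "holder \<alpha> f \<longleftrightarrow> (\<exists>C. \<forall>x y. \<bar>f x - f y\<bar> \<le> C * dist x y powr \<alpha>)"

definition prob_density :: "('a::euclidean_space \<Rightarrow> real) \<Rightarrow> bool" where
  "prob_density \<rho> \<longleftrightarrow> (\<forall>x. 0 \<le> \<rho> x) \<and> integrable lebesgue \<rho> \<and> (\<integral>x. \<rho> x \<partial>lebesgue) = 1"

definition radially_decreasing :: "('a::euclidean_space \<Rightarrow> real) \<Rightarrow> bool" where
  "radially_decreasing \<rho> \<longleftrightarrow> (\<forall>x y. norm x = norm y \<longrightarrow> \<rho> x = \<rho> y) \<and>
                              (\<forall>x y. norm x \<le> norm y \<longrightarrow> \<rho> y \<le> \<rho> x)"

definition radial_pot :: "(real \<Rightarrow> real) \<Rightarrow> 'a::euclidean_space \<Rightarrow> real" where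
  "radial_pot w x = w (norm x)"

definition W1 :: "'a::euclidean_space itself \<Rightarrow> (real \<Rightarrow> real) \<Rightarrow> bool" where
  "W1 t w \<longleftrightarrow> smooth_on (radial_pot w :: 'a \<Rightarrow> real) (- {0}) \<and> (\<forall>r>0. deriv w r > 0)"

definition W2 :: "'a::euclidean_space itself \<Rightarrow> (real \<Rightarrow> real) \<Rightarrow> real \<Rightarrow> bool" where
  "W2 t w k \<longleftrightarrow> k > - real DIM('a) \<and>
     (\<exists>C>0. \<forall>r. 0 < r \<and> r < 1 \<longrightarrow> deriv w r \<le> C * r powr (k - 1))"

definition grad_conv :: "(real \<Rightarrow> real) \<Rightarrow> ('a::euclidean_space \<Rightarrow> real) \<Rightarrow> 'a \<Rightarrow> 'a" where
  "grad_conv w \<rho> x = (\<integral>y. \<rho> y *\<^sub>R grad (radial_pot w) (x - y) \<partial>lebesgue)"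

definition steady_state :: "real \<Rightarrow> (real \<Rightarrow> real) \<Rightarrow> ('a::euclidean_space \<Rightarrow> real) \<Rightarrow> bool" where
  "steady_state m w \<rho> \<longleftrightarrow>
     prob_density \<rho> \<and> Linf \<rho> \<and>
     (\<exists>G. weak_gradient (\<lambda>x. \<rho> x powr m) G \<and> H1_loc G) \<and>
     (AE x in lebesgue. integrable lebesgue (\<lambda>y. \<rho> y *\<^sub>R grad (radial_pot w) (x - y))) \<and>
     loc_integrable (grad_conv w \<rho>) \<and>
     (\<forall>\<phi>. test_function \<phi> \<longrightarrow>
        (\<integral>x. \<rho> x powr m *\<^sub>R grad \<phi> x \<partial>lebesgue) =
        (\<integral>x. (\<rho> x * \<phi> x) *\<^sub>R grad_conv w \<rho> x \<partial>lebesgue)) \<and>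
     (\<forall>k. W2 TYPE('a) w k \<and> k < 1 - real DIM('a) \<longrightarrow>
        (\<exists>\<alpha>. 1 - k - real DIM('a) < \<alpha> \<and> \<alpha> < 1 \<and> holder \<alpha> \<rho>)) \<and>
     (filterlim w at_top at_top \<longrightarrow> integrable lebesgue (\<lambda>x. \<rho> x * w (1 + norm x)))"

end

theory Submission
  imports Defs
begin

text \<open>The potential is \<open>w0\<close> up to \<open>R0\<close> and then alternates between ever longer stretches on which it equals
  \<open>lam i * r\<^sup>2\<close> up to a constant, with \<open>lam i\<close> tending to 0, and short transitions. For a density \<open>\<rho>\<close> of mass 1 that is
  even and spread over the scale of the \<open>i\<close>-th stretch, the interaction potential is \<open>lam i * |x|\<^sup>2\<close> plus a constant plus \<open>V * \<rho>\<close>,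
  where \<open>V\<close> collects the part of the potential below the stretch and does not grow when \<open>lam i\<close> shrinks. To leading order the
  potential therefore does not depend on \<open>\<rho>\<close>, and since \<open>m < 2\<close> the remainder is small compared with
  \<open>\<rho> powr (m - 1)\<close> for flat densities. Hence the Euler-Lagrange map \<open>\<rho> \<mapsto> c * (C - lam i * |x|\<^sup>2 - V * \<rho>)\<^sub>+ powr (1 / (m - 1))\<close>,
  with \<open>C\<close> fixed by the mass, is a contraction. Its fixed point is a steady state supported inside the stretch, so the potential
  beyond is irrelevant to it, and the steady states of different stretches differ because they live on different scales.\<close>

section \<open>Smooth functions and a smooth step\<close>

text \<open>The difficulty is a circle: a steady state on a stretch depends on the potential below
  it, while position and strength of all stretches must be fixed before the potential can be written
  down. It is broken by letting a scale see the inner part only through a bound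
  \<open>D * r powr (1 - n)\<close> on the difference between W' and \<open>2 * lam * r\<close>. The
  amplitude, \<open>lam\<close> and the support radius \<open>R\<close> then work for every
  potential obeying that bound (\<open>steady_state_at_scale\<close>), so the whole sequence of
  scales is chosen by recursion before the potential is glued. The exponent \<open>1 - n\<close> is
  what \<open>k \<ge> 2 - n\<close> gives for W' near 0. It makes both \<open>V\<close> and its
  gradient integrable, so \<open>V * \<rho>\<close> is C1 for merely continuous
  \<open>\<rho>\<close> of bounded support. For a fixed amplitude the support radius grows only like
  \<open>lam powr (-1/2)\<close>, so \<open>lam * R\<close> can be kept below 1; this is the source
  of the bounded gradient. As \<open>p = 1 / (m - 1)\<close> exceeds 1, the densities are C1 across
  the edge of their support, and the weak equation follows from classical derivatives.\<close>

lemma Ck_on_cong: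
  assumes "open S" "\<And>x. x \<in> S \<Longrightarrow> f x = g x"
  shows "Ck_on k f S \<Longrightarrow> Ck_on k g S"
  using assms(2)
proof (induction k arbitrary: f g)
  case 0
  then show ?case using continuous_on_cong by fastforce
next
  case (Suc k)
  have df: "f differentiable at x" if "x \<in> S" for x
    using Suc.prems(1) that \<open>open S\<close> by (auto simp: differentiable_on_eq_differentiable_at)
  have "frechet_derivative f (at x) = frechet_derivative g (at x)" if "x \<in> S" for x
    by (rule frechet_derivative_transform_within_open[OF df[OF that] \<open>open S\<close> that])
       (use Suc.prems in auto)
  moreover have "g differentiable_on S"
    unfolding differentiable_on_eq_differentiable_at[OF \<open>open S\<close>] differentiable_def
  proof
    fix x assume "x \<in> S"
    then obtain D where "(f has_derivative D) (at x)" using df unfolding differentiable_def by blast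
    then have "(g has_derivative D) (at x)"
      by (rule has_derivative_transform_within_open[OF _ \<open>open S\<close> \<open>x \<in> S\<close>]) (use Suc.prems in auto)
    then show "\<exists>D. (g has_derivative D) (at x)" by blast
  qed
  moreover have "Ck_on k (\<lambda>x. frechet_derivative g (at x) b) S" if "b \<in> Basis" for b
    by (rule Suc.IH[of "\<lambda>x. frechet_derivative f (at x) b"])
       (use Suc.prems that calculation in auto)
  ultimately show ?case by simp
qed

lemma Ck_on_imp_continuous_on: "Ck_on k f S \<Longrightarrow> continuous_on S f"
  by (cases k) (auto intro: differentiable_imp_continuous_on)

lemma Ck_on_SucD: "Ck_on (Suc k) f S \<Longrightarrow> Ck_on k f S"
proof (induction k arbitrary: f)
  case 0
  then show ?case using Ck_on_imp_continuous_on by (metis Ck_on.simps(1))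
qed simp

lemma Ck_on_subset: "Ck_on k f S \<Longrightarrow> T \<subseteq> S \<Longrightarrow> Ck_on k f T"
  by (induction k arbitrary: f) (auto intro: continuous_on_subset differentiable_on_subset)

lemma Ck_on_SucI:
  assumes "open S" "\<And>x. x \<in> S \<Longrightarrow> (f has_derivative f' x) (at x)"
    and "\<And>b. b \<in> Basis \<Longrightarrow> Ck_on k (\<lambda>x. f' x b) S"
  shows "Ck_on (Suc k) f S"
proof -
  have "frechet_derivative f (at x) = f' x" if "x \<in> S" for x
    using assms(2)[OF that] frechet_derivative_at by metis
  then have "Ck_on k (\<lambda>x. frechet_derivative f (at x) b) S" if "b \<in> Basis" for b
    by (intro Ck_on_cong[OF assms(1) _ assms(3)[OF that]]) auto
  moreover have "f differentiable_on S"
    using assms(1,2) by (auto simp: differentiable_on_eq_differentiable_at differentiable_def)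
  ultimately show ?thesis by simp
qed

lemma Ck_on_Suc_has_derivative:
  assumes "open S" "Ck_on (Suc k) f S" "x \<in> S"
  shows "(f has_derivative frechet_derivative f (at x)) (at x)"
  using assms by (auto simp: differentiable_on_eq_differentiable_at frechet_derivative_works[symmetric])

lemma Ck_on_const [simp]: "open S \<Longrightarrow> Ck_on k (\<lambda>x. c) S"
proof (induction k arbitrary: c)
  case (Suc k)
  then show ?case by (intro Ck_on_SucI[where f' = "\<lambda>x h. 0"]) auto
qed simp

lemma Ck_on_inner_left: "open S \<Longrightarrow> Ck_on k (\<lambda>x. x \<bullet> a) S"
proof (cases k)
  case (Suc j)
  assume "open S"
  then show ?thesis unfolding Suc
    by (intro Ck_on_SucI[where f' = "\<lambda>x h. h \<bullet> a"]) (auto intro!: derivative_eq_intros)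
qed (auto intro!: continuous_intros)

lemma Ck_on_add:
  assumes "open S"
  shows "Ck_on k f S \<Longrightarrow> Ck_on k g S \<Longrightarrow> Ck_on k (\<lambda>x. f x + g x) S"
proof (induction k arbitrary: f g)
  case (Suc k)
  show ?case
    by (rule Ck_on_SucI[OF assms has_derivative_add[OF Ck_on_Suc_has_derivative[OF assms Suc.prems(1)]
             Ck_on_Suc_has_derivative[OF assms Suc.prems(2)]]])
       (use Suc in auto)
qed (auto intro: continuous_intros)

lemma Ck_on_mult:
  fixes f g :: "'a::euclidean_space \<Rightarrow> real"
  assumes "open S"
  shows "Ck_on k f S \<Longrightarrow> Ck_on k g S \<Longrightarrow> Ck_on k (\<lambda>x. f x * g x) S"
proof (induction k arbitrary: f g)
  case (Suc k)
  \<comment> \<open>The product rule leaves one factor undifferentiated, whose regularity has to be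
    lowered by one order.\<close>
  note prems = Suc.prems[THEN Ck_on_SucD]
  show ?case
    by (rule Ck_on_SucI[OF assms has_derivative_mult[OF Ck_on_Suc_has_derivative[OF assms Suc.prems(1)]
             Ck_on_Suc_has_derivative[OF assms Suc.prems(2)]]])
       (use Suc prems in \<open>auto intro!: Ck_on_add[OF assms] Suc.IH\<close>)
qed (auto intro: continuous_intros)

lemma Ck_on_sum:
  assumes "open S" "\<And>i. i \<in> I \<Longrightarrow> Ck_on k (f i) S"
  shows "Ck_on k (\<lambda>x. \<Sum>i\<in>I. f i x) S"
  using assms(2) by (induction I rule: infinite_finite_induct) (auto intro!: Ck_on_add assms(1) simp: assms(1))

text \<open>Smoothness is a local property; this is how the locally finite sum that defines the
  staircase potential becomes smooth.\<close>

lemma Ck_on_local: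
  assumes "open S" "\<And>x. x \<in> S \<Longrightarrow> \<exists>T. open T \<and> x \<in> T \<and> Ck_on k f T"
  shows "Ck_on k f S"
  using assms(2)
proof (induction k arbitrary: f)
  case 0
  then have "isCont f x" if "x \<in> S" for x
    using that by (metis Ck_on.simps(1) continuous_on_eq_continuous_at)
  then show ?case by (simp add: continuous_at_imp_continuous_on)
next
  case (Suc k)
  have "f differentiable at x" if "x \<in> S" for x
    using Suc.prems[OF that] by (metis Ck_on.simps(2) differentiable_on_eq_differentiable_at)
  then have "f differentiable_on S"
    using assms(1) by (simp add: differentiable_on_eq_differentiable_at)
  moreover have "Ck_on k (\<lambda>x. frechet_derivative f (at x) b) S" if "b \<in> Basis" for b
    by (rule Suc.IH) (use Suc.prems that in force)
  ultimately show ?case by simp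
qed

section \<open>Smooth functions of one variable and their compositions\<close>

lemma Ck_on_Suc_real:
  assumes "Ck_on (Suc k) (g :: real \<Rightarrow> real) UNIV"
  obtains g' where "\<And>t. (g has_real_derivative g' t) (at t)" "Ck_on k g' UNIV"
proof
  show "Ck_on k (\<lambda>x. frechet_derivative g (at x) 1) UNIV" using assms by simp
  show "(g has_real_derivative frechet_derivative g (at t) 1) (at t)" for t
  proof -
    have *: "(g has_derivative frechet_derivative g (at t)) (at t)"
      by (rule Ck_on_Suc_has_derivative[OF open_UNIV assms UNIV_I])
    have "frechet_derivative g (at t) h = frechet_derivative g (at t) 1 * h" for h
      using linear_scale[OF has_derivative_linear[OF *], of h 1] by (simp add: mult.commute)
    then have "frechet_derivative g (at t) = (*) (frechet_derivative g (at t) 1)" by blast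
    then show ?thesis using * by (simp add: has_field_derivative_def)
  qed
qed

lemma Ck_on_antiderivative:
  assumes "\<And>t. (g has_real_derivative g' t) (at t)" "Ck_on k g' UNIV"
  shows "Ck_on (Suc k) (g :: real \<Rightarrow> real) UNIV"
  using assms by (intro Ck_on_SucI[where f' = "\<lambda>t h. g' t * h"]) (auto simp: has_field_derivative_def)

lemma smooth_on_antiderivative:
  assumes "\<And>t. (g has_real_derivative g' t) (at t)" "smooth_on g' UNIV"
  shows "smooth_on (g :: real \<Rightarrow> real) UNIV"
  using assms Ck_on_antiderivative Ck_on_SucD unfolding smooth_on_def by blast

text \<open>Radial functions are written through \<open>x \<bullet> x\<close> instead of the norm:
  it is a polynomial, so the chain rule meets no singularity at the origin.\<close>

lemma Ck_on_inner_self: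
  shows "Ck_on k g UNIV \<Longrightarrow> Ck_on k (\<lambda>x::'a::euclidean_space. g (x \<bullet> x) :: real) UNIV"
proof (induction k arbitrary: g)
  case 0
  then show ?case by (auto intro!: continuous_on_compose2[of UNIV g] continuous_intros)
next
  case (Suc k)
  obtain g' where g': "\<And>t. (g has_real_derivative g' t) (at t)" "Ck_on k g' UNIV"
    using Ck_on_Suc_real[OF Suc.prems] by blast
  have "((\<lambda>x::'a. g (x \<bullet> x)) has_derivative (\<lambda>h. g' (x \<bullet> x) * (2 * (x \<bullet> h)))) (at x)" for x
  proof -
    have "((\<lambda>x::'a. x \<bullet> x) has_derivative (\<lambda>h. 2 * (x \<bullet> h))) (at x)"
      by (auto simp: inner_commute intro!: derivative_eq_intros)
    then show ?thesis
      using has_derivative_compose[of "\<lambda>x. x \<bullet> x" "\<lambda>h. 2 * (x \<bullet> h)" x UNIV g "\<lambda>h. g' (x \<bullet> x) * h"] g'(1)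
      by (simp add: has_field_derivative_def)
  qed
  then show ?case
  proof (rule Ck_on_SucI[OF open_UNIV])
    fix b :: 'a
    have "Ck_on k (\<lambda>x::'a. g' (x \<bullet> x) * (2 * (x \<bullet> b))) UNIV"
      by (intro Ck_on_mult Suc.IH g' Ck_on_inner_left Ck_on_const open_UNIV)
    then show "Ck_on k (\<lambda>x. g' (x \<bullet> x) * (2 * (x \<bullet> b))) UNIV" .
  qed
qed

lemma Ck_on_affine:
  shows "Ck_on k g UNIV \<Longrightarrow> Ck_on k (\<lambda>t. g (\<alpha> * t + \<beta>) :: real) (UNIV :: real set)"
proof (induction k arbitrary: g)
  case 0
  then show ?case by (auto intro!: continuous_on_compose2[of UNIV g] continuous_intros)
next
  case (Suc k)
  obtain g' where g': "\<And>t. (g has_real_derivative g' t) (at t)" "Ck_on k g' UNIV"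
    using Ck_on_Suc_real[OF Suc.prems] by blast
  show ?case
  proof (rule Ck_on_antiderivative)
    show "((\<lambda>t. g (\<alpha> * t + \<beta>)) has_real_derivative (\<alpha> * g' (\<alpha> * t + \<beta>))) (at t)" for t
    proof -
      have "((\<lambda>t. \<alpha> * t + \<beta>) has_real_derivative \<alpha>) (at t)"
        by (auto intro!: derivative_eq_intros)
      from DERIV_chain2[OF g'(1) this] show ?thesis by (simp add: mult.commute)
    qed
    show "Ck_on k (\<lambda>t. \<alpha> * g' (\<alpha> * t + \<beta>)) UNIV"
      by (intro Ck_on_mult Ck_on_const Suc.IH g' open_UNIV)
  qed
qed

text \<open>\<open>flat_poly 1\<close> is the classical function exp(-1/x). The polynomial in 1/x
  makes the family closed under differentiation, so that smoothness is a single induction over all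
  \<open>P\<close> at once.\<close>

definition flat_poly :: "real poly \<Rightarrow> real \<Rightarrow> real" where
  "flat_poly P x = (if x > 0 then poly P (1 / x) * exp (- (1 / x)) else 0)"

lemma poly_times_exp_minus_tendsto_0: "((\<lambda>s. poly P s * exp (- s)) \<longlongrightarrow> (0::real)) at_top"
proof -
  have "((\<lambda>s. \<Sum>i\<le>degree P. coeff P i * (s ^ i / exp s)) \<longlongrightarrow> (\<Sum>i\<le>degree P. coeff P i * (0::real))) at_top"
    by (intro tendsto_intros tendsto_power_div_exp_0)
  then show ?thesis
    by (simp add: poly_altdef sum_distrib_right exp_minus divide_inverse mult.assoc)
qed

lemma flat_poly_has_derivative:
  "(flat_poly P has_real_derivative flat_poly ([:0,0,1:] * (P - pderiv P)) x) (at x)"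
proof -
  consider "x > 0" | "x < 0" | "x = 0" by linarith
  then show ?thesis
  proof cases
    case 1
    have "((\<lambda>x. poly P (1 / x) * exp (- (1 / x))) has_real_derivative
            flat_poly ([:0,0,1:] * (P - pderiv P)) x) (at x)"
      using 1 by (auto simp: flat_poly_def field_simps power2_eq_square
             intro!: derivative_eq_intros DERIV_chain2[OF poly_DERIV])
    then show ?thesis
      by (rule has_field_derivative_transform_within_open[where S = "{0<..}"])
         (use 1 in \<open>auto simp: flat_poly_def\<close>)
  next
    case 2
    have "((\<lambda>x. 0) has_real_derivative flat_poly ([:0,0,1:] * (P - pderiv P)) x) (at x)"
      using 2 by (auto simp: flat_poly_def)
    then show ?thesis
      by (rule has_field_derivative_transform_within_open[where S = "{..<0}"])
         (use 2 in \<open>auto simp: flat_poly_def\<close>)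
  next
    case 3
    have "((\<lambda>h. (flat_poly P h - flat_poly P 0) / h) \<longlongrightarrow> 0) (at_right 0)"
    proof -
      have "((\<lambda>h. poly ([:0,1:] * P) (inverse h) * exp (- inverse h)) \<longlongrightarrow> (0::real)) (at_right 0)"
        by (rule filterlim_compose[OF poly_times_exp_minus_tendsto_0 filterlim_inverse_at_top_right])
      then show ?thesis
      proof (rule Lim_transform_eventually)
        show "\<forall>\<^sub>F h in at_right 0. poly ([:0,1:] * P) (inverse h) * exp (- inverse h)
                 = (flat_poly P h - flat_poly P 0) / h"
          by (auto simp: eventually_at_filter flat_poly_def field_simps)
      qed
    qed
    moreover have "((\<lambda>h. (flat_poly P h - flat_poly P 0) / h) \<longlongrightarrow> 0) (at_left 0)"
      by (rule Lim_transform_eventually[of "\<lambda>h. 0"]) (auto simp: eventually_at_filter flat_poly_def)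
    ultimately have "((\<lambda>h. (flat_poly P h - flat_poly P 0) / h) \<longlongrightarrow> 0) (at 0)"
      using filterlim_split_at by blast
    then show ?thesis using 3 by (simp add: DERIV_def flat_poly_def)
  qed
qed

lemma smooth_on_flat_poly: "smooth_on (flat_poly P) UNIV"
proof -
  have "Ck_on k (flat_poly P) UNIV" for k
  proof (induction k arbitrary: P)
    case 0
    then show ?case
      using flat_poly_has_derivative by (auto intro!: continuous_at_imp_continuous_on DERIV_isCont)
  next
    case (Suc k)
    then show ?case by (intro Ck_on_antiderivative[OF flat_poly_has_derivative])
  qed
  then show ?thesis by (simp add: smooth_on_def)
qed

lemma smooth_on_mult:
  fixes f g :: "'a::euclidean_space \<Rightarrow> real"
  assumes "open S" "smooth_on f S" "smooth_on g S"
  shows "smooth_on (\<lambda>x. f x * g x) S"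
  using assms Ck_on_mult unfolding smooth_on_def by blast

lemma continuous_antiderivative_exists:
  assumes "continuous_on UNIV (f :: real \<Rightarrow> real)"
  obtains F where "\<And>t. (F has_real_derivative f t) (at t)"
proof -
  have "\<exists>F. \<forall>x::real. -\<infinity> < ereal x \<longrightarrow> ereal x < \<infinity> \<longrightarrow> (F has_vector_derivative f x) (at x)"
    by (rule einterval_antiderivative) (use assms in \<open>auto simp: continuous_on_eq_continuous_at\<close>)
  then show ?thesis using that by (auto simp: has_real_derivative_iff_has_vector_derivative)
qed

text \<open>The step is the normalised antiderivative of the bump f(t) f(1 - t) with f(t) =
  exp(-1/t) for t > 0. Its own antiderivative \<open>S1\<close> serves the staircase potential,
  whose slope is built from \<open>S\<close>; its derivative \<open>S'\<close> appears when the
  potentials are glued.\<close>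

lemma smooth_step_exists:
  obtains S S' S1 :: "real \<Rightarrow> real" and c :: real
  where "smooth_on S UNIV" "smooth_on S1 UNIV" "continuous_on UNIV S'"
    "\<And>t. (S has_real_derivative S' t) (at t)" "\<And>t. (S1 has_real_derivative S t) (at t)"
    "\<And>t. 0 \<le> S t" "\<And>t. S t \<le> 1" "\<And>t. 0 \<le> S' t"
    "\<And>t. t \<le> 0 \<Longrightarrow> S t = 0" "\<And>t. 1 \<le> t \<Longrightarrow> S t = 1"
    "\<And>t. t \<le> 0 \<Longrightarrow> S' t = 0" "\<And>t. 1 \<le> t \<Longrightarrow> S' t = 0"
    "\<And>t. t \<le> 0 \<Longrightarrow> S1 t = 0" "\<And>t. 1 \<le> t \<Longrightarrow> S1 t = t - c"
proof -
  define f where "f = flat_poly 1"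
  define \<psi> where "\<psi> = (\<lambda>t. f t * f (-1 * t + 1))"
  have f: "f t \<ge> 0" "t \<le> 0 \<Longrightarrow> f t = 0" "t > 0 \<Longrightarrow> f t > 0" for t
    by (auto simp: f_def flat_poly_def)
  have sm: "smooth_on \<psi> UNIV"
    unfolding \<psi>_def smooth_on_def
    using smooth_on_flat_poly[of 1]
    by (intro allI Ck_on_mult Ck_on_affine open_UNIV) (auto simp: f_def smooth_on_def)
  have cont: "continuous_on UNIV \<psi>" using sm Ck_on_imp_continuous_on unfolding smooth_on_def by blast
  obtain F where F: "\<And>t. (F has_real_derivative \<psi> t) (at t)"
    using continuous_antiderivative_exists[OF cont] by blast
  have \<psi>: "\<psi> t \<ge> 0" "t \<le> 0 \<Longrightarrow> \<psi> t = 0" "t \<ge> 1 \<Longrightarrow> \<psi> t = 0" "0 < t \<Longrightarrow> t < 1 \<Longrightarrow> \<psi> t > 0" for t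
    using f[of t] f[of "-1 * t + 1"] by (auto simp: \<psi>_def)
  have mono: "F s \<le> F t" if "s \<le> t" for s t
    using DERIV_nonneg_imp_nondecreasing[OF that] F \<psi>(1) by blast
  have F1: "F 0 < F 1"
    using \<psi>(4) F by (intro DERIV_pos_imp_increasing_open[of 0 1 F])
      (auto intro!: continuous_at_imp_continuous_on DERIV_isCont[OF F])
  have Flow: "F t = F 0" if "t \<le> 0" for t
  proof (cases "t = 0")
    case False
    then have "t < 0" using that by simp
    then obtain z where "t < z" "z < 0" "F 0 - F t = (0 - t) * \<psi> z"
      using MVT2[of t 0 F \<psi>] F by blast
    then show ?thesis using \<psi>(2)[of z] by simp
  qed simp
  have Fup: "F t = F 1" if "t \<ge> 1" for t
  proof (cases "t = 1")
    case False
    then have "t > 1" using that by simp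
    then obtain z where "1 < z" "z < t" "F t - F 1 = (t - 1) * \<psi> z"
      using MVT2[of 1 t F \<psi>] F by blast
    then show ?thesis using \<psi>(3)[of z] by simp
  qed simp
  define S where "S = (\<lambda>t. (F t - F 0) / (F 1 - F 0))"
  define S' where "S' = (\<lambda>t. \<psi> t * (1 / (F 1 - F 0)))"
  have S: "(S has_real_derivative S' t) (at t)" for t
    unfolding S_def S'_def using F1 by (auto intro!: derivative_eq_intros F)
  have "smooth_on S' UNIV" unfolding S'_def
    by (intro smooth_on_mult sm open_UNIV) (simp add: smooth_on_def)
  then have smS: "smooth_on S UNIV" using smooth_on_antiderivative[OF S] by blast
  have S01: "0 \<le> S t" "S t \<le> 1" "t \<le> 0 \<Longrightarrow> S t = 0" "1 \<le> t \<Longrightarrow> S t = 1" for t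
    using mono[of 0 t] mono[of t 1] F1 Flow[of t] Fup[of t] mono[of 0 1]
    by (cases "t \<le> 0"; cases "t \<le> 1"; auto simp: S_def field_simps)+
  have "continuous_on UNIV S" using smS Ck_on_imp_continuous_on unfolding smooth_on_def by blast
  then obtain G where G: "\<And>t. (G has_real_derivative S t) (at t)"
    using continuous_antiderivative_exists by blast
  define S1 where "S1 = (\<lambda>t. G t - G 0)"
  have S1: "(S1 has_real_derivative S t) (at t)" for t
    unfolding S1_def by (auto intro!: derivative_eq_intros G)
  have S1low: "S1 t = 0" if "t \<le> 0" for t
  proof (cases "t = 0")
    case False
    then have "t < 0" using that by simp
    then obtain z where "t < z" "z < 0" "S1 0 - S1 t = (0 - t) * S z"
      using MVT2[of t 0 S1 S] S1 by blast
    then show ?thesis using S01(3)[of z] by (simp add: S1_def)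
  qed (simp add: S1_def)
  have S1up: "S1 t = t - (1 - S1 1)" if "t \<ge> 1" for t
  proof (cases "t = 1")
    case False
    then have "t > 1" using that by simp
    then obtain z where "1 < z" "z < t" "S1 t - S1 1 = (t - 1) * S z"
      using MVT2[of 1 t S1 S] S1 by blast
    then show ?thesis using S01(4)[of z] by simp
  qed simp
  show ?thesis
  proof (rule that[OF smS smooth_on_antiderivative[OF S1 smS] _ S S1 S01(1,2) _ S01(3,4) _ _ S1low S1up])
    show "continuous_on UNIV S'" unfolding S'_def by (intro continuous_intros cont)
  qed (use \<psi> F1 in \<open>auto simp: S'_def\<close>)
qed

section \<open>Isometries and the kernel of order one\<close>

lemma involutive_isometry_image_ball:
  fixes \<sigma> :: "'a::euclidean_space \<Rightarrow> 'a"
  assumes "\<And>x y. dist (\<sigma> x) (\<sigma> y) = dist x y" "\<And>x. \<sigma> (\<sigma> x) = x"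
  shows "\<sigma> ` ball x r = ball (\<sigma> x) r"
proof -
  have "y \<in> \<sigma> ` ball x r" if "y \<in> ball (\<sigma> x) r" for y
    using that assms by (intro image_eqI[of _ _ "\<sigma> y"]) (metis mem_ball)+
  then show ?thesis using assms(1) by auto
qed

lemma involutive_isometry_emeasure_le:
  fixes \<sigma> :: "'a::euclidean_space \<Rightarrow> 'a"
  assumes iso: "\<And>x y. dist (\<sigma> x) (\<sigma> y) = dist x y" and inv: "\<And>x. \<sigma> (\<sigma> x) = x"
    and U: "open U" "open (\<sigma> ` U)"
  shows "emeasure lborel U \<le> emeasure lborel (\<sigma> ` U)"
proof -
  define K where "K = {(x, r). 0 < r \<and> ball x r \<subseteq> U}"
  have cov: "\<exists>i. i \<in> K \<and> x \<in> ball (fst i) (snd i) \<and> snd i < d" if "x \<in> U" "0 < d" for x d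
  proof -
    obtain e where "e > 0" "ball x e \<subseteq> U" using \<open>x \<in> U\<close> U openE by blast
    then show ?thesis using that
      by (intro exI[of _ "(x, min e (d/2))"]) (auto simp: K_def subset_iff)
  qed
  obtain C where C: "countable C" "C \<subseteq> K"
     "pairwise (\<lambda>i j. disjnt (ball (fst i) (snd i)) (ball (fst j) (snd j))) C"
     "negligible (U - (\<Union>i\<in>C. ball (fst i) (snd i)))"
    by (rule Vitali_covering_theorem_balls[of U K fst snd, OF cov])
  let ?B = "\<lambda>i. ball (fst i) (snd i)" and ?B' = "\<lambda>i. ball (\<sigma> (fst i)) (snd i)"
  have B': "?B' i = \<sigma> ` ?B i" for i
    using involutive_isometry_image_ball[OF iso inv] by simp
  have inj: "inj \<sigma>" by (metis injI inv)
  have d: "disjoint_family_on ?B C"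
    using C(3) by (auto simp: disjoint_family_on_def pairwise_def disjnt_def)
  then have d': "disjoint_family_on ?B' C"
    unfolding disjoint_family_on_def B' using inj by (simp add: image_Int[symmetric])
  have sub: "(\<Union>i\<in>C. ?B i) \<subseteq> U" using C(2) by (fastforce simp: K_def)
  have "open (\<Union>i\<in>C. ?B i)" by blast
  then have mU: "(\<Union>i\<in>C. ?B i) \<in> sets lborel" "U \<in> sets lborel" using U by auto
  have "emeasure lborel (U - (\<Union>i\<in>C. ?B i)) = 0"
    using C(4) mU by (simp add: negligible_iff_null_sets null_sets_def emeasure_completion)
  then have "emeasure lborel U = emeasure lborel (\<Union>i\<in>C. ?B i)"
    using emeasure_Un_null_set[of "\<Union>i\<in>C. ?B i" lborel "U - (\<Union>i\<in>C. ?B i)"] mU sub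
    by (simp add: null_sets_def Un_absorb1 Diff_partition del: UN_simps)
  also have "\<dots> = (\<integral>\<^sup>+i. emeasure lborel (?B i) \<partial>count_space C)"
    by (rule emeasure_UN_countable[OF _ C(1) d]) auto
  also have "\<dots> = (\<integral>\<^sup>+i. emeasure lborel (?B' i) \<partial>count_space C)"
  proof (rule nn_integral_cong)
    fix i assume "i \<in> space (count_space C)"
    then have "0 \<le> snd i" using C(2) by (auto simp: K_def)
    then show "emeasure lborel (?B i) = emeasure lborel (?B' i)" by (simp add: emeasure_ball)
  qed
  also have "\<dots> = emeasure lborel (\<Union>i\<in>C. ?B' i)"
    by (rule emeasure_UN_countable[OF _ C(1) d', symmetric]) auto
  also have "\<dots> \<le> emeasure lborel (\<sigma> ` U)"
    using U sub by (intro emeasure_mono) (auto simp: B')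
  finally show ?thesis .
qed

text \<open>Vitali's theorem exhausts an open set by disjoint balls, and an isometry maps balls to balls
  of the same volume; this avoids linear changes of variables, which are available for
  \<open>real ^ 'n\<close> only.\<close>

lemma distr_lborel_involutive_isometry:
  fixes \<sigma> :: "'a::euclidean_space \<Rightarrow> 'a"
  assumes iso: "\<And>x y. dist (\<sigma> x) (\<sigma> y) = dist x y" and inv: "\<And>x. \<sigma> (\<sigma> x) = x"
  shows "distr lborel borel \<sigma> = lborel"
proof (rule lborel_eqI[symmetric])
  have cont: "continuous_on UNIV \<sigma>"
    unfolding continuous_on_iff using iso by metis
  then have meas: "\<sigma> \<in> borel_measurable borel" by (rule borel_measurable_continuous_onI)
  fix l u :: 'a assume lu: "\<And>b. b \<in> Basis \<Longrightarrow> l \<bullet> b \<le> u \<bullet> b"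
  have vim: "\<sigma> -` A = \<sigma> ` A" for A using inv by (auto intro: image_eqI[of _ \<sigma>]) (metis image_eqI)
  have op: "open (\<sigma> ` box l u)"
    unfolding vim[symmetric] using cont open_box continuous_on_open_vimage[of UNIV \<sigma>] by auto
  \<comment> \<open>The one-sided estimate, applied to the box and to its image, gives equality
    because \<open>\<sigma>\<close> is its own inverse.\<close>
  have "emeasure lborel (\<sigma> ` box l u) \<le> emeasure lborel (\<sigma> ` \<sigma> ` box l u)"
    by (rule involutive_isometry_emeasure_le[OF iso inv op]) (simp add: image_image inv open_box)
  moreover have "emeasure lborel (box l u) \<le> emeasure lborel (\<sigma> ` box l u)"
    by (rule involutive_isometry_emeasure_le[OF iso inv open_box op])
  ultimately have "emeasure lborel (\<sigma> ` box l u) = emeasure lborel (box l u)"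
    by (simp add: image_image inv)
  then show "emeasure (distr lborel borel \<sigma>) (box l u) = (\<Prod>b\<in>Basis. (u - l) \<bullet> b)"
    using lu meas by (simp add: emeasure_distr vim)
qed simp

lemma
  fixes \<sigma> :: "'a::euclidean_space \<Rightarrow> 'a" and f :: "'a \<Rightarrow> 'b::{banach, second_countable_topology}"
  assumes iso: "\<And>x y. dist (\<sigma> x) (\<sigma> y) = dist x y" and inv: "\<And>x. \<sigma> (\<sigma> x) = x"
    and f: "f \<in> borel_measurable borel"
  shows integral_involutive_isometry: "(LBINT x. f (\<sigma> x)) = (LBINT x. f x)"
    and integrable_involutive_isometry: "integrable lborel (\<lambda>x. f (\<sigma> x)) \<longleftrightarrow> integrable lborel f"
proof -
  have "continuous_on UNIV \<sigma>"
    unfolding continuous_on_iff using iso by metis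
  then have [measurable]: "\<sigma> \<in> borel_measurable borel" by (rule borel_measurable_continuous_onI)
  note [measurable] = f
  show "(LBINT x. f (\<sigma> x)) = (LBINT x. f x)"
    by (subst (2) distr_lborel_involutive_isometry[OF iso inv, symmetric]) (simp add: integral_distr)
  show "integrable lborel (\<lambda>x. f (\<sigma> x)) \<longleftrightarrow> integrable lborel f"
    by (subst (2) distr_lborel_involutive_isometry[OF iso inv, symmetric]) (simp add: integrable_distr_eq)
qed

lemma
  fixes f :: "'a::euclidean_space \<Rightarrow> 'b::{banach, second_countable_topology}"
  assumes f: "f \<in> borel_measurable borel"
  shows integral_reflect_shift: "(LBINT x. f (c - x)) = (LBINT x. f x)"
    and integrable_reflect_shift: "integrable lborel (\<lambda>x. f (c - x)) \<longleftrightarrow> integrable lborel f"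
  using integral_involutive_isometry[of "\<lambda>x. c - x" f] integrable_involutive_isometry[of "\<lambda>x. c - x" f] f
  by (simp_all add: dist_norm norm_minus_commute)

text \<open>A translation is not an involution, but it is the composition of the two point
  reflections \<open>\<lambda>x. c - x\<close> and \<open>\<lambda>x. 0 - x\<close>.\<close>

lemma
  fixes f :: "'a::euclidean_space \<Rightarrow> 'b::{banach, second_countable_topology}"
  assumes f: "f \<in> borel_measurable borel"
  shows integral_shift: "(LBINT x. f (x + c)) = (LBINT x. f x)"
    and integrable_shift: "integrable lborel (\<lambda>x. f (x + c)) \<longleftrightarrow> integrable lborel f"
proof -
  note [measurable] = f
  have *: "(\<lambda>x. f (c - x)) \<in> borel_measurable borel" by measurable
  show "(LBINT x. f (x + c)) = (LBINT x. f x)"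
    using integral_reflect_shift[OF f, of c] integral_reflect_shift[OF *, of 0]
    by (simp add: add.commute)
  show "integrable lborel (\<lambda>x. f (x + c)) \<longleftrightarrow> integrable lborel f"
    using integrable_reflect_shift[OF f, of c] integrable_reflect_shift[OF *, of 0]
    by (simp add: add.commute)
qed

text \<open>Common majorant of the truncated interaction kernel and of its gradient. At the origin
  the value is 0 for n > 1 as well, since \<open>0 powr s = 0\<close>.\<close>

definition rkernel :: "real \<Rightarrow> 'a::euclidean_space \<Rightarrow> real" where
  "rkernel a x = indicator (ball 0 a) x * norm x powr (1 - real DIM('a))"

lemma rkernel_measurable [measurable]:
  "(rkernel a :: 'a::euclidean_space \<Rightarrow> real) \<in> borel_measurable borel"
proof -
  have "(\<lambda>x::'a. norm x powr (1 - real DIM('a))) \<in> borel_measurable borel"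
    unfolding powr_def by measurable
  then show ?thesis unfolding rkernel_def
    by (intro borel_measurable_times borel_measurable_indicator) auto
qed

lemma rkernel_nonneg: "0 \<le> rkernel a x"
  by (simp add: rkernel_def)

abbreviation rmass :: "'a::euclidean_space itself \<Rightarrow> real \<Rightarrow> real" where
  "rmass t a \<equiv> LBINT x. rkernel a (x::'a)"

text \<open>Dyadic shells: for |x| between \<open>a / 2 ^ Suc j\<close> and \<open>a / 2 ^ j\<close>
  the kernel is of order 2^(j (n - 1)), while the volume is of order 2^(-j n). The shells thus
  contribute a geometric series of ratio 1/2.\<close>

lemma rkernel_integrable: "integrable lborel (rkernel a :: 'a::euclidean_space \<Rightarrow> real)"
proof (cases "a > 0")
  case a: True
  let ?n = "real DIM('a)"
  define g where "g j x = (a / 2 ^ Suc j) powr (1 - ?n) * indicator (ball 0 (a / 2 ^ j)) x" for j and x :: 'a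
  define s where "s j = (a / 2 ^ Suc j) powr (1 - ?n) * (unit_ball_vol ?n * (a / 2 ^ j) ^ DIM('a))" for j :: nat
  have pt: "ennreal (rkernel a x) \<le> (\<Sum>j. ennreal (g j x))" for x :: 'a
  proof (cases "x \<in> ball 0 a \<and> x \<noteq> 0")
    case True
    then have x: "0 < norm x" "norm x < a" by auto
    have ex: "\<exists>j. a / 2 ^ Suc j \<le> norm x"
    proof -
      obtain j where "(1/2::real) ^ j < norm x / a"
        using real_arch_pow_inv[of "norm x / a" "1/2"] x a by auto
      then have "a / 2 ^ j < norm x" using a by (simp add: field_simps)
      moreover have "a / 2 ^ Suc j \<le> a / 2 ^ j" using a by (simp add: field_simps)
      ultimately show ?thesis by (intro exI[of _ j]) linarith
    qed
    define j where "j = (LEAST j. a / 2 ^ Suc j \<le> norm x)"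
    have j: "a / 2 ^ Suc j \<le> norm x" "\<And>i. i < j \<Longrightarrow> norm x < a / 2 ^ Suc i"
      unfolding j_def using LeastI_ex[OF ex] not_less_Least[of _ "\<lambda>j. a / 2 ^ Suc j \<le> norm x"]
      by (blast, meson not_le)
    have "norm x < a / 2 ^ j" using x j(2)[of "j - 1"] by (cases j) auto
    then have "rkernel a x \<le> g j x"
      using x a j(1) by (auto simp: rkernel_def g_def indicator_def intro!: powr_mono2')
    then have "ennreal (rkernel a x) \<le> ennreal (g j x)" by (rule ennreal_leI)
    also have "\<dots> \<le> (\<Sum>j. ennreal (g j x))"
      using sum_le_suminf[of "\<lambda>j. ennreal (g j x)" "{j}"] by simp
    finally show ?thesis .
  qed (auto simp: rkernel_def indicator_def)
  have seq: "s j = (unit_ball_vol ?n * a * 2 powr (?n - 1)) * (1/2) ^ j" for j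
  proof -
    have "a / 2 ^ Suc j = (a / 2 ^ j) * (1/2)" by simp
    then have "(a / 2 ^ Suc j) powr (1 - ?n) = (a / 2 ^ j) powr (1 - ?n) * 2 powr (?n - 1)"
      using a by (simp only: powr_mult) (simp add: powr_divide powr_minus_divide[symmetric])
    moreover have "(a / 2 ^ j) ^ DIM('a) = (a / 2 ^ j) powr ?n" using a by (simp add: powr_realpow)
    moreover have "(a / 2 ^ j) powr (1 - ?n) * (a / 2 ^ j) powr ?n = a / 2 ^ j"
      using a by (simp add: powr_add[symmetric])
    ultimately show ?thesis by (simp add: s_def field_simps)
  qed
  have "(\<integral>\<^sup>+(x::'a). ennreal (rkernel a x) \<partial>lborel) \<le> (\<integral>\<^sup>+(x::'a). (\<Sum>j. ennreal (g j x)) \<partial>lborel)"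
    by (intro nn_integral_mono pt)
  also have "\<dots> = (\<Sum>j. \<integral>\<^sup>+(x::'a). ennreal (g j x) \<partial>lborel)"
    unfolding g_def
    by (intro nn_integral_suminf measurable_compose[OF _ measurable_ennreal] borel_measurable_times
          borel_measurable_const borel_measurable_indicator) auto
  also have "\<dots> = (\<Sum>j. ennreal (s j))"
  proof (rule suminf_cong)
    fix j
    have "(\<integral>\<^sup>+(x::'a). ennreal (g j x) \<partial>lborel)
        = (\<integral>\<^sup>+(x::'a). ennreal ((a / 2 ^ Suc j) powr (1 - ?n)) * indicator (ball 0 (a / 2 ^ j)) x \<partial>lborel)"
      by (intro nn_integral_cong) (auto simp: g_def indicator_def)
    also have "\<dots> = ennreal ((a / 2 ^ Suc j) powr (1 - ?n)) * emeasure lborel (ball (0::'a) (a / 2 ^ j))"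
      by (rule nn_integral_cmult_indicator) simp
    also have "\<dots> = ennreal (s j)"
      using a by (simp add: emeasure_ball s_def ennreal_mult'')
    finally show "(\<integral>\<^sup>+(x::'a). ennreal (g j x) \<partial>lborel) = ennreal (s j)" .
  qed
  also have "\<dots> < \<infinity>"
  proof -
    have "s = (\<lambda>j. (unit_ball_vol ?n * a * 2 powr (?n - 1)) * (1/2) ^ j)" by (rule ext, rule seq)
    then have "summable s"
      using summable_mult[OF summable_geometric[of "1/2 :: real"]] by simp
    moreover have "s j \<ge> 0" for j
      unfolding seq using a by (intro mult_nonneg_nonneg) auto
    ultimately show ?thesis using ennreal_suminf_neq_top[of s] by (metis infinity_ennreal_def less_top)
  qed
  finally show ?thesis
    by (intro integrableI_nonneg) (auto simp: rkernel_nonneg)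
next
  case False
  then have "rkernel a = (\<lambda>x::'a. 0)"
    by (intro ext) (auto simp: rkernel_def indicator_def dest: le_less_trans[OF norm_ge_zero])
  then show ?thesis by simp
qed

section \<open>Weak gradients and convolutions\<close>

lemma integrable_continuous_bounded_support:
  fixes f :: "'a::euclidean_space \<Rightarrow> 'b::{banach, second_countable_topology}"
  assumes "continuous_on UNIV f" "\<And>x. R \<le> norm x \<Longrightarrow> f x = 0"
  shows "integrable lborel f"
proof -
  have "integrable lborel (\<lambda>x. indicator (cball 0 R) x *\<^sub>R f x)"
    by (intro borel_integrable_compact continuous_on_subset[OF assms(1)]) auto
  also have "(\<lambda>x. indicator (cball 0 R) x *\<^sub>R f x) = f"
    using assms(2) by (auto simp: indicator_def fun_eq_iff)
  finally show ?thesis .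
qed

lemma continuous_bounded_support_bounded:
  fixes f :: "'a::euclidean_space \<Rightarrow> 'b::real_normed_vector"
  assumes "continuous_on UNIV f" "\<And>x. R \<le> norm x \<Longrightarrow> f x = 0"
  obtains M where "0 \<le> M" "\<And>x. norm (f x) \<le> M"
proof -
  have "compact (f ` cball 0 R)"
    by (intro compact_continuous_image continuous_on_subset[OF assms(1)]) auto
  then obtain M where M: "\<And>x. x \<in> cball 0 R \<Longrightarrow> norm (f x) \<le> M"
    using compact_imp_bounded bounded_iff by (metis image_eqI)
  have "norm (f x) \<le> max M 0" for x
    using M[of x] assms(2)[of x] by (cases "norm x \<le> R") auto
  then show ?thesis using that[of "max M 0"] by simp
qed

abbreviation has_grad :: "('a::real_inner \<Rightarrow> real) \<Rightarrow> 'a \<Rightarrow> 'a \<Rightarrow> bool" where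
  "has_grad f v x \<equiv> (f has_derivative (\<lambda>h. v \<bullet> h)) (at x)"

lemma has_grad_imp_continuous_on: "(\<And>x. has_grad f (g x) x) \<Longrightarrow> continuous_on S f"
  by (intro continuous_at_imp_continuous_on) (auto intro: has_derivative_continuous)

lemma gradient_bound_imp_lipschitz:
  fixes u :: "'a::euclidean_space \<Rightarrow> real"
  assumes "\<And>x. has_grad u (g x) x" "\<And>x. norm (g x) \<le> M"
  shows "\<bar>u x - u y\<bar> \<le> M * norm (x - y)"
proof -
  have M: "0 \<le> M" using assms(2) norm_ge_zero order_trans by blast
  have "norm (u x - u y) \<le> M * norm (x - y)"
  proof (rule differentiable_bound[OF convex_UNIV])
    show "onorm (\<lambda>h. g x \<bullet> h) \<le> M" for x
    proof (rule onorm_bound[OF M])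
      show "norm (g x \<bullet> h) \<le> M * norm h" for h
        using Cauchy_Schwarz_ineq2[of "g x" h] mult_right_mono[OF assms(2)[of x], of "norm h"] by simp
    qed
  qed (use assms(1) in auto)
  then show ?thesis by simp
qed

abbreviation shift :: "nat \<Rightarrow> 'a::euclidean_space \<Rightarrow> 'a" where
  "shift j b \<equiv> (1 / real (Suc j)) *\<^sub>R b"

lemma directional_quotient_tendsto:
  fixes u :: "'a::euclidean_space \<Rightarrow> real"
  assumes "(u has_derivative u') (at x)"
  shows "(\<lambda>j. real (Suc j) * (u (x + shift j b) - u x)) \<longlonglongrightarrow> u' b"
proof -
  have "((\<lambda>t. x + t *\<^sub>R b) has_derivative (\<lambda>t. t *\<^sub>R b)) (at 0)"
    by (auto intro!: derivative_eq_intros)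
  then have "((\<lambda>t. u (x + t *\<^sub>R b)) has_derivative (\<lambda>t. u' (t *\<^sub>R b))) (at 0)"
    using has_derivative_compose[of "\<lambda>t. x + t *\<^sub>R b" "\<lambda>t. t *\<^sub>R b" 0 UNIV u u'] assms by simp
  moreover have "u' (t *\<^sub>R b) = u' b * t" for t
    using linear_scale[OF has_derivative_linear[OF assms]] by simp
  ultimately have "((\<lambda>t. u (x + t *\<^sub>R b)) has_real_derivative u' b) (at 0)"
    by (simp add: has_field_derivative_def)
  then have "((\<lambda>t. (u (x + t *\<^sub>R b) - u x) / t) \<longlongrightarrow> u' b) (at 0)"
    by (simp add: DERIV_def)
  moreover have "filterlim (\<lambda>j. 1 / real (Suc j)) (at 0) sequentially"
    using lim_1_over_n[THEN LIMSEQ_Suc] by (auto simp: filterlim_at)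
  ultimately have "(\<lambda>j. (u (x + shift j b) - u x) / (1 / real (Suc j))) \<longlonglongrightarrow> u' b"
    by (rule filterlim_compose)
  then show ?thesis by (simp add: field_simps)
qed

text \<open>Difference quotients of \<open>u\<close> have integral zero by translation invariance.
  They are bounded by the Lipschitz constant of \<open>u\<close> and, the shifts having length at
  most 1, vanish outside the ball of radius \<open>R + 1\<close>; dominated convergence passes to
  the directional derivative.\<close>

lemma integral_gradient_eq_0:
  fixes u :: "'a::euclidean_space \<Rightarrow> real"
  assumes u: "\<And>x. has_grad u (g x) x" and g: "continuous_on UNIV g"
    and supp: "\<And>x. R \<le> norm x \<Longrightarrow> u x = 0" "\<And>x. R \<le> norm x \<Longrightarrow> g x = 0"
  shows "(LBINT x. g x) = 0"
proof (rule euclidean_eqI)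
  fix b :: 'a assume b: "b \<in> Basis"
  obtain M where M: "0 \<le> M" "\<And>x. norm (g x) \<le> M"
    using continuous_bounded_support_bounded[OF g supp(2)] by blast
  have cu: "continuous_on UNIV u"
    by (rule has_grad_imp_continuous_on) (rule u)
  have [measurable]: "u \<in> borel_measurable borel" "g \<in> borel_measurable borel"
    using cu g by (auto intro: borel_measurable_continuous_onI)
  have iu: "integrable lborel u" using integrable_continuous_bounded_support[OF cu supp(1)] .
  define s where "s j x = real (Suc j) * (u (x + shift j b) - u x)" for j x
  have "(\<lambda>j. LBINT x. s j x) \<longlonglongrightarrow> (LBINT x. g x \<bullet> b)"
  proof (rule integral_dominated_convergence[where w = "\<lambda>x. M * indicator (cball 0 (R + 1)) x"])
    show "integrable lborel (\<lambda>x::'a. M * indicator (cball 0 (R + 1)) x)"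
      using emeasure_bounded_finite[of "cball (0::'a) (R + 1)"]
      by (intro integrable_mult_right integrable_real_indicator) auto
    show "AE x in lborel. (\<lambda>j. s j x) \<longlonglongrightarrow> g x \<bullet> b"
      using directional_quotient_tendsto[OF u] by (simp add: s_def)
    fix j
    have "norm (s j x) \<le> M * indicator (cball 0 (R + 1)) x" for x
    proof (cases "norm x \<le> R + 1")
      case True
      have "\<bar>u (x + shift j b) - u x\<bar> \<le> M * norm (shift j b)"
        using gradient_bound_imp_lipschitz[OF u M(2), of "x + shift j b" x] by simp
      then have "real (Suc j) * \<bar>u (x + shift j b) - u x\<bar> \<le> real (Suc j) * (M * (1 / real (Suc j)))"
        using b by (intro mult_left_mono) auto
      then show ?thesis using True by (simp add: s_def abs_mult)
    next
      case False
      have "norm x \<le> norm (x + shift j b) + norm (shift j b)"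
        by (metis add_diff_cancel norm_triangle_ineq4)
      moreover have "norm (shift j b) \<le> 1" using b by simp
      ultimately have "R \<le> norm (x + shift j b)" using False by linarith
      then show ?thesis using supp(1) False by (auto simp: s_def)
    qed
    then show "AE x in lborel. norm (s j x) \<le> M * indicator (cball 0 (R + 1)) x" by simp
  qed (auto simp: s_def)
  moreover have "(LBINT x. s j x) = 0" for j
  proof -
    have i1: "integrable lborel (\<lambda>x. u (x + shift j b))"
      using integrable_shift[of u] iu by simp
    have "(LBINT x. s j x)
      = real (Suc j) * ((\<integral>x. u (x + shift j b) \<partial>lborel) - (LBINT x. u x))"
      unfolding s_def by (subst integral_mult_right_zero) (simp only: Bochner_Integration.integral_diff[OF i1 iu])
    also have "\<dots> = 0" using integral_shift[of u] by simp
    finally show ?thesis .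
  qed
  ultimately have "(LBINT x. g x \<bullet> b) = 0" by (simp add: LIMSEQ_const_iff)
  then show "(LBINT x. g x) \<bullet> b = 0 \<bullet> b"
    using integrable_continuous_bounded_support[OF g supp(2)] by simp
qed

lemma loc_integrable_continuous:
  fixes f :: "'a::euclidean_space \<Rightarrow> 'b::{banach, second_countable_topology}"
  assumes "continuous_on UNIV f"
  shows "loc_integrable f"
  unfolding loc_integrable_def
proof (intro allI impI)
  fix K :: "'a set" assume "compact K"
  then have "integrable lborel (\<lambda>x. indicator K x *\<^sub>R f x)"
    by (intro borel_integrable_compact continuous_on_subset[OF assms]) auto
  then show "set_integrable lebesgue K f"
    unfolding set_integrable_def by (subst integrable_completion) auto
qed

lemma grad_eqI:
  assumes "has_grad f g x"
  shows "grad f x = g"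
proof -
  have "frechet_derivative f (at x) = (\<lambda>h. g \<bullet> h)"
    using frechet_derivative_at[OF assms] by simp
  then show ?thesis by (simp add: grad_def euclidean_representation)
qed

lemma has_derivative_grad:
  fixes f :: "'a::euclidean_space \<Rightarrow> real"
  assumes "f differentiable at x"
  shows "has_grad f (grad f x) x"
proof -
  have *: "(f has_derivative frechet_derivative f (at x)) (at x)"
    using assms by (simp add: frechet_derivative_works)
  then interpret linear "frechet_derivative f (at x)" by (rule has_derivative_linear)
  have "frechet_derivative f (at x) h = grad f x \<bullet> h" for h
  proof -
    have "frechet_derivative f (at x) h = frechet_derivative f (at x) (\<Sum>b\<in>Basis. (h \<bullet> b) *\<^sub>R b)"
      by (simp add: euclidean_representation)
    also have "\<dots> = (\<Sum>b\<in>Basis. (h \<bullet> b) * frechet_derivative f (at x) b)"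
      by (simp add: sum scale)
    also have "\<dots> = grad f x \<bullet> h"
      unfolding grad_def inner_sum_left by (intro sum.cong) (auto simp: inner_commute)
    finally show ?thesis .
  qed
  then show ?thesis using * by presburger
qed

lemma Ck_on_Suc_continuous_grad:
  assumes "Ck_on (Suc k) f S"
  shows "continuous_on S (grad f)"
proof -
  have "continuous_on S (\<lambda>x. frechet_derivative f (at x) b)" if "b \<in> Basis" for b
    using assms that by (intro Ck_on_imp_continuous_on[of k]) simp
  then have "continuous_on S (\<lambda>x. \<Sum>b\<in>Basis. frechet_derivative f (at x) b *\<^sub>R b)"
    by (intro continuous_on_sum continuous_on_scaleR continuous_on_const)
  moreover have "grad f = (\<lambda>x. \<Sum>b\<in>Basis. frechet_derivative f (at x) b *\<^sub>R b)"
    by (rule ext) (rule grad_def)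
  ultimately show ?thesis by metis
qed

lemma test_functionE:
  fixes \<phi> :: "'a::euclidean_space \<Rightarrow> real"
  assumes "test_function \<phi>"
  obtains R where "\<And>x. has_grad \<phi> (grad \<phi> x) x" "continuous_on UNIV (grad \<phi>)"
    "continuous_on UNIV \<phi>"
    "\<And>x. R \<le> norm x \<Longrightarrow> \<phi> x = 0" "\<And>x. R \<le> norm x \<Longrightarrow> grad \<phi> x = 0"
proof -
  have C1: "Ck_on (Suc 0) \<phi> UNIV" using assms unfolding test_function_def smooth_on_def by blast
  then have d: "has_grad \<phi> (grad \<phi> x) x" for x
    by (intro has_derivative_grad) (auto simp: differentiable_on_eq_differentiable_at)
  have "bounded (closure {x. \<phi> x \<noteq> 0})"
    using assms by (intro compact_imp_bounded) (simp add: test_function_def)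
  then obtain R where R: "\<And>x. x \<in> closure {x. \<phi> x \<noteq> 0} \<Longrightarrow> norm x \<le> R"
    by (auto simp: bounded_iff)
  have z: "\<phi> x = 0" if "R < norm x" for x
  proof (rule ccontr)
    assume "\<phi> x \<noteq> 0"
    then have "x \<in> closure {x. \<phi> x \<noteq> 0}" using closure_subset[of "{x. \<phi> x \<noteq> 0}"] by auto
    from R[OF this] that show False by simp
  qed
  \<comment> \<open>The margin 1 places \<open>x\<close> inside the open set
    \<open>norm x > R\<close> on which \<open>\<phi>\<close> vanishes, so that the derivative there
    can be read off.\<close>
  have "grad \<phi> x = 0" if "R + 1 \<le> norm x" for x
  proof (rule grad_eqI)
    have "has_grad (\<lambda>x. 0) 0 x" by simp
    then show "has_grad \<phi> 0 x"
      by (rule has_derivative_transform_within_open[where s = "{x. R < norm x}"])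
         (use that z in \<open>auto intro!: open_Collect_less continuous_intros\<close>)
  qed
  with that[of "R + 1"] d Ck_on_Suc_continuous_grad[OF C1] Ck_on_imp_continuous_on[OF C1] z
  show ?thesis by force
qed

text \<open>The product of \<open>f\<close> and a test function is C1 with bounded support, so its
  gradient integrates to zero.\<close>

lemma weak_gradient_C1:
  fixes f :: "'a::euclidean_space \<Rightarrow> real"
  assumes f: "\<And>x. has_grad f (g x) x" and g: "continuous_on UNIV g"
  shows "weak_gradient f g"
  unfolding weak_gradient_def
proof (intro conjI allI impI)
  have cf: "continuous_on UNIV f"
    by (rule has_grad_imp_continuous_on) (rule f)
  show "loc_integrable f" "loc_integrable g" using cf g by (simp_all add: loc_integrable_continuous)
  fix \<phi> :: "'a \<Rightarrow> real" assume "test_function \<phi>"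
  then obtain R where \<phi>: "\<And>x. has_grad \<phi> (grad \<phi> x) x"
    "continuous_on UNIV (grad \<phi>)" "continuous_on UNIV \<phi>"
    "\<And>x. R \<le> norm x \<Longrightarrow> \<phi> x = 0" "\<And>x. R \<le> norm x \<Longrightarrow> grad \<phi> x = 0"
    by (rule test_functionE) blast
  have c1: "continuous_on UNIV (\<lambda>x. f x *\<^sub>R grad \<phi> x)" and c2: "continuous_on UNIV (\<lambda>x. \<phi> x *\<^sub>R g x)"
    using cf \<phi> g by (auto intro!: continuous_intros)
  have "(LBINT x. f x *\<^sub>R grad \<phi> x + \<phi> x *\<^sub>R g x) = 0"
  proof (rule integral_gradient_eq_0)
    show "has_grad (\<lambda>x. f x * \<phi> x) (f x *\<^sub>R grad \<phi> x + \<phi> x *\<^sub>R g x) x" for x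
      using has_derivative_mult[OF f[of x] \<phi>(1)[of x]]
      by (simp add: inner_add_left mult.commute add.commute)
    show "continuous_on UNIV (\<lambda>x. f x *\<^sub>R grad \<phi> x + \<phi> x *\<^sub>R g x)" by (intro continuous_on_add c1 c2)
  qed (use \<phi> in auto)
  moreover have "integrable lborel (\<lambda>x. f x *\<^sub>R grad \<phi> x)" "integrable lborel (\<lambda>x. \<phi> x *\<^sub>R g x)"
    using \<phi> by (auto intro!: integrable_continuous_bounded_support[OF c1, of R]
         integrable_continuous_bounded_support[OF c2, of R])
  ultimately have "(LBINT x. f x *\<^sub>R grad \<phi> x) = - (LBINT x. \<phi> x *\<^sub>R g x)"
    by (simp add: eq_neg_iff_add_eq_0)
  then show "(\<integral>x. f x *\<^sub>R grad \<phi> x \<partial>lebesgue) = - (\<integral>x. \<phi> x *\<^sub>R g x \<partial>lebesgue)"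
    using c1 c2 by (simp add: integral_completion borel_measurable_continuous_onI)
qed

text \<open>The variable \<open>x\<close> sits in the density and not in the kernel: the density is
  continuous and bounded, the kernel merely integrable, so limits in \<open>x\<close> pass under the
  integral with a multiple of the norm of \<open>k\<close> as majorant.\<close>

definition cnv :: "('a::euclidean_space \<Rightarrow> 'b::{banach, second_countable_topology}) \<Rightarrow> ('a \<Rightarrow> real) \<Rightarrow> 'a \<Rightarrow> 'b"
  where "cnv k \<rho> x = (LBINT z. \<rho> (x - z) *\<^sub>R k z)"

lemma
  fixes k :: "'a::euclidean_space \<Rightarrow> 'b::{banach, second_countable_topology}"
  assumes [measurable]: "k \<in> borel_measurable borel" "\<rho> \<in> borel_measurable borel"
  shows cnv_eq: "cnv k \<rho> x = (LBINT y. \<rho> y *\<^sub>R k (x - y))"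
    and cnv_integrable_iff: "integrable lborel (\<lambda>y. \<rho> y *\<^sub>R k (x - y)) \<longleftrightarrow> integrable lborel (\<lambda>z. \<rho> (x - z) *\<^sub>R k z)"
  using integral_reflect_shift[of "\<lambda>y. \<rho> y *\<^sub>R k (x - y)" x] integrable_reflect_shift[of "\<lambda>y. \<rho> y *\<^sub>R k (x - y)" x]
  by (simp_all add: cnv_def)

lemma cnv_integrable:
  fixes k :: "'a::euclidean_space \<Rightarrow> 'b::{banach, second_countable_topology}"
  assumes k: "integrable lborel k" and [measurable]: "\<rho> \<in> borel_measurable borel" and B: "\<And>y. \<bar>\<rho> y\<bar> \<le> B"
  shows "integrable lborel (\<lambda>z. \<rho> (x - z) *\<^sub>R k z)"
proof (rule Bochner_Integration.integrable_bound)
  show "integrable lborel (\<lambda>z. B * norm (k z))" using k by simp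
  have "k \<in> borel_measurable borel" using borel_measurable_integrable[OF k] by simp
  note [measurable] = this
  show "(\<lambda>z. \<rho> (x - z) *\<^sub>R k z) \<in> borel_measurable lborel" by measurable
  show "AE z in lborel. norm (\<rho> (x - z) *\<^sub>R k z) \<le> norm (B * norm (k z))"
    using B by (auto simp: abs_mult intro!: AE_I2 mult_right_mono order_trans[OF B abs_ge_self])
qed

lemma norm_cnv_le:
  fixes k :: "'a::euclidean_space \<Rightarrow> 'b::{banach, second_countable_topology}"
  assumes k: "integrable lborel k" and \<rho>: "\<rho> \<in> borel_measurable borel" and B: "\<And>y. \<bar>\<rho> y\<bar> \<le> B"
  shows "norm (cnv k \<rho> x) \<le> B * (LBINT z. norm (k z))"
proof -
  have "norm (cnv k \<rho> x) \<le> (LBINT z. norm (\<rho> (x - z) *\<^sub>R k z))"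
    unfolding cnv_def by (rule integral_norm_bound)
  also have "\<dots> \<le> (LBINT z. B * norm (k z))"
    using k B by (intro integral_mono integrable_norm cnv_integrable[OF assms]) (auto intro!: mult_right_mono)
  finally show ?thesis by simp
qed

lemma cnv_diff_right:
  fixes k :: "'a::euclidean_space \<Rightarrow> 'b::{banach, second_countable_topology}"
  assumes k: "integrable lborel k" and "\<rho> \<in> borel_measurable borel" "\<And>y. \<bar>\<rho> y\<bar> \<le> B"
    and "\<rho>' \<in> borel_measurable borel" "\<And>y. \<bar>\<rho>' y\<bar> \<le> B'"
  shows "cnv k \<rho> x - cnv k \<rho>' x = cnv k (\<lambda>y. \<rho> y - \<rho>' y) x"
  using cnv_integrable[OF k assms(2,3), of x] cnv_integrable[OF k assms(4,5), of x]
  by (simp add: cnv_def scaleR_diff_left)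

lemma cnv_diff_left:
  fixes k :: "'a::euclidean_space \<Rightarrow> 'b::{banach, second_countable_topology}"
  assumes "integrable lborel k" "integrable lborel k'" and "\<rho> \<in> borel_measurable borel" "\<And>y. \<bar>\<rho> y\<bar> \<le> B"
  shows "cnv k \<rho> x - cnv k' \<rho> x = cnv (\<lambda>z. k z - k' z) \<rho> x"
  using cnv_integrable[OF assms(1,3,4), of x] cnv_integrable[OF assms(2,3,4), of x]
  by (simp add: cnv_def scaleR_diff_right)

lemma continuous_on_cnv:
  fixes k :: "'a::euclidean_space \<Rightarrow> 'b::{banach, second_countable_topology}"
  assumes k: "integrable lborel k" and \<rho>: "continuous_on UNIV \<rho>" and B: "\<And>y. \<bar>\<rho> y\<bar> \<le> B"
  shows "continuous_on UNIV (cnv k \<rho>)"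
proof (rule continuous_on_sequentiallyI)
  fix u and x :: 'a assume u: "u \<longlonglongrightarrow> x"
  have \<rho>m [measurable]: "\<rho> \<in> borel_measurable borel" using \<rho> by (rule borel_measurable_continuous_onI)
  have km [measurable]: "k \<in> borel_measurable borel" using borel_measurable_integrable[OF k] by simp
  show "(\<lambda>n. cnv k \<rho> (u n)) \<longlonglongrightarrow> cnv k \<rho> x"
    unfolding cnv_def
  proof (rule integral_dominated_convergence[where w = "\<lambda>z. B * norm (k z)"])
    show "AE z in lborel. (\<lambda>n. \<rho> (u n - z) *\<^sub>R k z) \<longlonglongrightarrow> \<rho> (x - z) *\<^sub>R k z"
    proof (rule AE_I2)
      fix z
      have "(\<lambda>n. \<rho> (u n - z)) \<longlonglongrightarrow> \<rho> (x - z)"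
        by (rule continuous_on_tendsto_compose[OF \<rho>]) (auto intro!: tendsto_intros u)
      then show "(\<lambda>n. \<rho> (u n - z) *\<^sub>R k z) \<longlonglongrightarrow> \<rho> (x - z) *\<^sub>R k z" by (intro tendsto_intros)
    qed
    show "AE z in lborel. norm (\<rho> (u n - z) *\<^sub>R k z) \<le> B * norm (k z)" for n
      using B by (auto intro!: AE_I2 mult_right_mono)
    show "integrable lborel (\<lambda>z. B * norm (k z))" using k by simp
  qed measurable
qed

text \<open>Differentiability of the convolution is assumed, only the value is computed: difference
  quotients are moved onto \<open>\<rho>\<close>, where the Lipschitz bound makes them dominated by
  a multiple of \<open>k\<close>.\<close>

lemma cnv_directional_derivative:
  fixes k :: "'a::euclidean_space \<Rightarrow> real"
  assumes k: "integrable lborel k"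
    and \<rho>: "\<And>x. has_grad \<rho> (g x) x" and g: "continuous_on UNIV g"
    and supp: "\<And>x. R \<le> norm x \<Longrightarrow> \<rho> x = 0" "\<And>x. R \<le> norm x \<Longrightarrow> g x = 0"
    and d: "has_grad (cnv k \<rho>) G x"
  shows "G \<bullet> b = cnv k (\<lambda>y. g y \<bullet> b) x"
proof -
  obtain M where M: "0 \<le> M" "\<And>x. norm (g x) \<le> M"
    using continuous_bounded_support_bounded[OF g supp(2)] by blast
  have c\<rho>: "continuous_on UNIV \<rho>"
    by (rule has_grad_imp_continuous_on) (rule \<rho>)
  have \<rho>m [measurable]: "\<rho> \<in> borel_measurable borel" using c\<rho> by (rule borel_measurable_continuous_onI)
  have gm [measurable]: "g \<in> borel_measurable borel" using g by (rule borel_measurable_continuous_onI)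
  have km [measurable]: "k \<in> borel_measurable borel" using borel_measurable_integrable[OF k] by simp
  obtain B where B: "\<And>x. \<bar>\<rho> x\<bar> \<le> B"
    using continuous_bounded_support_bounded[OF c\<rho> supp(1)] by (metis real_norm_def)
  define s where "s j y = real (Suc j) * (\<rho> (y + shift j b) - \<rho> y)" for j y
  have lip: "\<bar>s j y\<bar> \<le> M * norm b" for j y
  proof -
    have "\<bar>\<rho> (y + shift j b) - \<rho> y\<bar> \<le> M * norm (shift j b)"
      using gradient_bound_imp_lipschitz[OF \<rho> M(2), of "y + shift j b" y] by simp
    then have "real (Suc j) * \<bar>\<rho> (y + shift j b) - \<rho> y\<bar>
        \<le> real (Suc j) * (M * ((1 / real (Suc j)) * norm b))"
      by (intro mult_left_mono) auto
    then show ?thesis by (simp add: s_def abs_mult)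
  qed
  have "(\<lambda>j. LBINT z. s j (x - z) * k z) \<longlonglongrightarrow> (LBINT z. (g (x - z) \<bullet> b) * k z)"
  proof (rule integral_dominated_convergence[where w = "\<lambda>z. (M * norm b) * norm (k z)"])
    show "AE z in lborel. (\<lambda>j. s j (x - z) * k z) \<longlonglongrightarrow> (g (x - z) \<bullet> b) * k z"
      using directional_quotient_tendsto[OF \<rho>] by (auto intro!: AE_I2 tendsto_mult simp: s_def)
    show "AE z in lborel. norm (s j (x - z) * k z) \<le> (M * norm b) * norm (k z)" for j
      using lip by (auto intro!: AE_I2 mult_right_mono simp: abs_mult)
  qed (use k in \<open>auto simp: s_def\<close>)
  moreover have "(LBINT z. s j (x - z) * k z)
      = real (Suc j) * (cnv k \<rho> (x + shift j b) - cnv k \<rho> x)" for j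
  proof -
    let ?y = "x + shift j b"
    have "(LBINT z. s j (x - z) * k z)
       = (LBINT z. real (Suc j) * (\<rho> (?y - z) *\<^sub>R k z - \<rho> (x - z) *\<^sub>R k z))"
      by (intro Bochner_Integration.integral_cong) (auto simp: s_def algebra_simps)
    also have "\<dots> = real (Suc j) * (LBINT z. \<rho> (?y - z) *\<^sub>R k z - \<rho> (x - z) *\<^sub>R k z)"
      by (rule integral_mult_right_zero)
    also have "\<dots> = real (Suc j) * (cnv k \<rho> ?y - cnv k \<rho> x)"
      unfolding cnv_def
      by (subst Bochner_Integration.integral_diff[OF cnv_integrable[OF k \<rho>m B] cnv_integrable[OF k \<rho>m B]]) simp
    finally show ?thesis .
  qed
  ultimately have "(\<lambda>j. real (Suc j) * (cnv k \<rho> (x + shift j b) - cnv k \<rho> x))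
      \<longlonglongrightarrow> (LBINT z. (g (x - z) \<bullet> b) * k z)" by simp
  from LIMSEQ_unique[OF directional_quotient_tendsto[OF d] this]
  show ?thesis by (simp add: cnv_def)
qed

section \<open>Convolution with a singular radial kernel\<close>

text \<open>Passage to the gauge integral over a box, the setting of \<open>leibniz_rule\<close>, by
  which convolutions with C1 kernels are differentiated next.\<close>

lemma integral_cbox_eq_lborel:
  fixes f :: "'a::euclidean_space \<Rightarrow> 'b::euclidean_space"
  assumes "continuous_on UNIV f" "\<And>x. x \<notin> cbox l u \<Longrightarrow> f x = 0"
  shows "integral (cbox l u) f = (LBINT x. f x)"
proof -
  have "integrable lborel (\<lambda>x. indicator (cbox l u) x *\<^sub>R f x)"
    by (intro borel_integrable_compact continuous_on_subset[OF assms(1)]) auto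
  also have "(\<lambda>x. indicator (cbox l u) x *\<^sub>R f x) = f"
    using assms(2) by (auto simp: indicator_def fun_eq_iff)
  finally have "integral UNIV f = (LBINT x. f x)" by (rule integral_lborel)
  moreover have "f = (\<lambda>x. if x \<in> cbox l u then f x else 0)" using assms(2) by auto
  ultimately show ?thesis using Henstock_Kurzweil_Integration.integral_restrict_UNIV[of "cbox l u" f] by simp
qed

lemma cnv_C1_kernel_has_derivative:
  fixes k :: "'a::euclidean_space \<Rightarrow> real"
  assumes k: "\<And>x. has_grad k (g x) x" and g: "continuous_on UNIV g"
    and \<rho>: "continuous_on UNIV \<rho>" and supp: "\<And>x. R \<le> norm x \<Longrightarrow> \<rho> x = 0"
  shows "has_grad (cnv k \<rho>) (cnv g \<rho> x) x"
proof -
  obtain c :: 'a where c: "ball 0 R \<subseteq> cbox (- c) c"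
    using bounded_subset_cbox_symmetric[OF bounded_ball] by blast
  let ?S = "cbox (- c) c"
  have z: "\<rho> y = 0" if "y \<notin> ?S" for y
    using supp[of y] c that by (meson linorder_not_less mem_ball_0 subsetD)
  have ck: "continuous_on UNIV k"
    by (rule has_grad_imp_continuous_on) (rule k)
  note [measurable] = borel_measurable_continuous_onI[OF ck] borel_measurable_continuous_onI[OF g]
    borel_measurable_continuous_onI[OF \<rho>]
  have c1: "continuous_on UNIV (\<lambda>y. \<rho> y *\<^sub>R k (x - y))" for x
    by (intro continuous_intros \<rho> continuous_on_compose2[OF ck]) auto
  have c2: "continuous_on UNIV (\<lambda>y. \<rho> y *\<^sub>R g (x - y))" for x
    by (intro continuous_intros \<rho> continuous_on_compose2[OF g]) auto
  have e1: "cnv k \<rho> x = integral ?S (\<lambda>y. \<rho> y *\<^sub>R k (x - y))" for x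
    by (subst integral_cbox_eq_lborel[OF c1]) (auto simp: z cnv_eq)
  have e2: "cnv g \<rho> x = integral ?S (\<lambda>y. \<rho> y *\<^sub>R g (x - y))" for x
    by (subst integral_cbox_eq_lborel[OF c2]) (auto simp: z cnv_eq)
  have int2: "(\<lambda>y. \<rho> y *\<^sub>R g (x - y)) integrable_on ?S" for x
    by (rule integrable_continuous[OF continuous_on_subset[OF c2]]) simp
  have "((\<lambda>x. integral ?S (\<lambda>y. \<rho> y *\<^sub>R k (x - y))) has_derivative
      integral ?S (\<lambda>y. blinfun_inner_right (\<rho> y *\<^sub>R g (x - y)))) (at x within UNIV)"
  proof (rule leibniz_rule)
    fix x t :: 'a
    have "((\<lambda>x. x - t) has_derivative (\<lambda>h. h)) (at x)" by (auto intro!: derivative_eq_intros)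
    then have "has_grad (\<lambda>x. k (x - t)) (g (x - t)) x"
      using has_derivative_compose[of "\<lambda>x. x - t" "\<lambda>h. h" x UNIV k] k[of "x - t"] by blast
    note d = has_derivative_scaleR_right[OF this, of "\<rho> t"]
    have "blinfun_apply (blinfun_inner_right (\<rho> t *\<^sub>R g (x - t))) = (\<lambda>h. \<rho> t *\<^sub>R (g (x - t) \<bullet> h))"
      by (auto simp: fun_eq_iff)
    with d show "((\<lambda>x. \<rho> t *\<^sub>R k (x - t)) has_derivative blinfun_apply (blinfun_inner_right (\<rho> t *\<^sub>R g (x - t)))) (at x within UNIV)"
      by metis
    show "(\<lambda>y. \<rho> y *\<^sub>R k (x - y)) integrable_on ?S"
      by (rule integrable_continuous[OF continuous_on_subset[OF c1]]) simp
  next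
    have "continuous_on (UNIV \<times> ?S) (\<lambda>p. \<rho> (snd p) *\<^sub>R g (fst p - snd p))"
      by (intro continuous_intros continuous_on_compose2[OF \<rho>] continuous_on_compose2[OF g]) auto
    from bounded_linear.continuous_on[OF bounded_linear_blinfun_inner_right this]
    show "continuous_on (UNIV \<times> ?S) (\<lambda>(x, t). blinfun_inner_right (\<rho> t *\<^sub>R g (x - t)))"
      by (simp add: case_prod_beta)
  qed auto
  moreover have "integral ?S (\<lambda>y. blinfun_inner_right (\<rho> y *\<^sub>R g (x - y)))
      = blinfun_inner_right (integral ?S (\<lambda>y. \<rho> y *\<^sub>R g (x - y)))"
    using integral_linear[OF int2 bounded_linear_blinfun_inner_right] by (simp add: o_def)
  moreover have "cnv k \<rho> = (\<lambda>x. integral ?S (\<lambda>y. \<rho> y *\<^sub>R k (x - y)))" using e1 by blast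
  ultimately show ?thesis by (simp add: e2 blinfun_inner_right.rep_eq)
qed

text \<open>\<open>V\<close> is a radial kernel with profile \<open>\<nu>\<close>, and
  \<open>G\<close> its gradient off the origin; the value 0 at the origin is a convention on a null
  set. One bound for \<open>\<nu>\<close> and \<open>\<nu>'\<close> makes both kernels integrable by
  comparison with \<open>rkernel\<close>.\<close>

locale radial_kernel =
  fixes \<nu> \<nu>' :: "real \<Rightarrow> real" and a D :: real and V :: "'a::euclidean_space \<Rightarrow> real" and G :: "'a \<Rightarrow> 'a"
  assumes a: "0 < a" and D: "0 \<le> D"
    and deriv: "\<And>r. 0 < r \<Longrightarrow> (\<nu> has_real_derivative \<nu>' r) (at r)"
    and cont: "continuous_on {0<..} \<nu>'"
    and bound: "\<And>r. 0 < r \<Longrightarrow> \<bar>\<nu> r\<bar> \<le> D * r powr (1 - real DIM('a))"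
    and bound': "\<And>r. 0 < r \<Longrightarrow> \<bar>\<nu>' r\<bar> \<le> D * r powr (1 - real DIM('a))"
    and supp: "\<And>r. a \<le> r \<Longrightarrow> \<nu> r = 0" and supp': "\<And>r. a \<le> r \<Longrightarrow> \<nu>' r = 0"
    and V: "\<And>x. V x = (if x = 0 then 0 else \<nu> (norm x))"
    and G: "\<And>x. G x = (if x = 0 then 0 else (\<nu>' (norm x) / norm x) *\<^sub>R x)"
begin

text \<open>A smooth, strictly positive substitute for the norm. It lies above the norm, and the
  bounds on \<open>\<nu>\<close> and \<open>\<nu>'\<close> do not increase with the radius; hence
  the regularised kernels obey the same majorant as \<open>V\<close> and \<open>G\<close>.\<close>

definition reg :: "nat \<Rightarrow> 'a \<Rightarrow> real" where
  "reg j x = sqrt (x \<bullet> x + (1 / real (Suc j))\<^sup>2)"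

definition Vreg :: "nat \<Rightarrow> 'a \<Rightarrow> real" where
  "Vreg j x = \<nu> (reg j x)"

definition Greg :: "nat \<Rightarrow> 'a \<Rightarrow> 'a" where
  "Greg j x = (\<nu>' (reg j x) / reg j x) *\<^sub>R x"

lemma reg_pos: "0 < reg j x"
  by (simp add: reg_def add_nonneg_pos)

lemma norm_le_reg: "norm x \<le> reg j x"
  unfolding reg_def norm_eq_sqrt_inner by (intro real_sqrt_le_mono) simp

lemma continuous_on_reg: "continuous_on UNIV (reg j)"
  unfolding reg_def[abs_def] by (intro continuous_intros)

lemma reg_tendsto: "(\<lambda>j. reg j x) \<longlonglongrightarrow> norm x"
proof -
  have "(\<lambda>j. sqrt (x \<bullet> x + (1 / real (Suc j))\<^sup>2)) \<longlonglongrightarrow> sqrt (x \<bullet> x + 0\<^sup>2)"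
    by (intro tendsto_intros lim_1_over_n[THEN LIMSEQ_Suc])
  then show ?thesis by (simp add: reg_def norm_eq_sqrt_inner)
qed

lemma isCont_\<nu>: "0 < r \<Longrightarrow> isCont \<nu> r" and isCont_\<nu>': "0 < r \<Longrightarrow> isCont \<nu>' r"
  using deriv DERIV_isCont cont by (auto simp: continuous_on_eq_continuous_at)

lemma continuous_on_\<nu>: "continuous_on {0<..} \<nu>"
  using isCont_\<nu> by (auto intro: continuous_at_imp_continuous_on)

lemma Vreg_has_derivative: "has_grad (Vreg j) (Greg j x) x"
proof -
  have *: "((\<lambda>x. x \<bullet> x + (1 / real (Suc j))\<^sup>2) has_derivative (\<lambda>h. 2 * (x \<bullet> h))) (at x)"
    by (auto intro!: derivative_eq_intros simp: inner_commute)
  have "(sqrt has_real_derivative inverse (reg j x) / 2) (at (x \<bullet> x + (1 / real (Suc j))\<^sup>2))"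
    unfolding reg_def by (rule DERIV_real_sqrt) (simp add: add_nonneg_pos)
  note d = DERIV_compose_FDERIV[OF this *]
  have "(\<lambda>h. 2 * (x \<bullet> h) * (inverse (reg j x) / 2)) = (\<lambda>h. (x \<bullet> h) / reg j x)"
    using reg_pos[of j x] by (auto simp: field_simps)
  moreover have "reg j = (\<lambda>x. sqrt (x \<bullet> x + (1 / real (Suc j))\<^sup>2))"
    by (rule ext) (rule reg_def)
  ultimately have "(reg j has_derivative (\<lambda>h. (x \<bullet> h) / reg j x)) (at x)"
    using d by metis
  from DERIV_compose_FDERIV[OF deriv[OF reg_pos] this]
  show ?thesis unfolding Vreg_def[abs_def] Greg_def by (simp add: mult.commute)
qed

lemma continuous_on_Greg: "continuous_on UNIV (Greg j)"
proof -
  have "continuous_on UNIV (\<lambda>x. \<nu>' (reg j x))"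
    by (rule continuous_on_compose2[OF cont continuous_on_reg]) (auto simp: reg_pos)
  moreover have "reg j x \<noteq> 0" for x using reg_pos[of j x] by simp
  ultimately show ?thesis unfolding Greg_def[abs_def]
    by (intro continuous_intros continuous_on_reg) auto
qed

lemma continuous_on_Vreg: "continuous_on UNIV (Vreg j)"
  by (rule has_grad_imp_continuous_on) (rule Vreg_has_derivative)

lemma profile_le_rkernel:
  assumes "x \<noteq> 0" "norm x \<le> r" and f: "\<And>r. 0 < r \<Longrightarrow> \<bar>f r\<bar> \<le> D * r powr (1 - real DIM('a))"
    and s: "\<And>r. a \<le> r \<Longrightarrow> f r = 0"
  shows "\<bar>f r\<bar> \<le> D * rkernel a (x :: 'a)"
proof (cases "r < a")
  case True
  have "0 < norm x" using assms by simp
  then have "0 < r" using assms(2) by linarith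
  have "\<bar>f r\<bar> \<le> D * r powr (1 - real DIM('a))" using f[OF \<open>0 < r\<close>] .
  also have "\<dots> \<le> D * norm x powr (1 - real DIM('a))"
    using assms \<open>0 < norm x\<close> by (intro mult_left_mono powr_mono2' D) auto
  also have "\<dots> = D * rkernel a x" using True assms by (simp add: rkernel_def)
  finally show ?thesis .
qed (use s in \<open>auto simp: rkernel_nonneg D\<close>)

lemma V_le: "\<bar>V x\<bar> \<le> D * rkernel a x"
  using profile_le_rkernel[OF _ order_refl bound supp, of x] D by (auto simp: V rkernel_nonneg)

lemma G_le: "norm (G x) \<le> D * rkernel a x"
  using profile_le_rkernel[OF _ order_refl bound' supp', of x] D by (auto simp: G rkernel_nonneg)

lemma Vreg_le: "x \<noteq> 0 \<Longrightarrow> \<bar>Vreg j x\<bar> \<le> D * rkernel a x"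
  unfolding Vreg_def by (rule profile_le_rkernel[OF _ norm_le_reg bound supp])

lemma Greg_le: assumes "x \<noteq> 0" shows "norm (Greg j x) \<le> D * rkernel a x"
proof -
  have "norm (Greg j x) = \<bar>\<nu>' (reg j x)\<bar> * (norm x / reg j x)"
    using reg_pos[of j x] by (simp add: Greg_def abs_div)
  also have "\<dots> \<le> \<bar>\<nu>' (reg j x)\<bar> * 1"
    using reg_pos[of j x] norm_le_reg[of x j] by (intro mult_left_mono) (auto simp: divide_le_eq_1)
  also have "\<dots> \<le> D * rkernel a x"
    using profile_le_rkernel[OF assms norm_le_reg bound' supp'] by simp
  finally show ?thesis .
qed

lemma V_measurable [measurable]: "V \<in> borel_measurable borel"
proof -
  have "(\<lambda>x. indicator (- {0}) x *\<^sub>R \<nu> (norm x)) \<in> borel_measurable (borel :: 'a measure)"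
    by (intro borel_measurable_continuous_on_indicator continuous_on_compose2[OF continuous_on_\<nu>] continuous_intros) auto
  moreover have "V = (\<lambda>x. indicator (- {0}) x *\<^sub>R \<nu> (norm x))" by (auto simp: V)
  ultimately show ?thesis by simp
qed

lemma continuous_on_G: "continuous_on (- {0}) G"
proof -
  have "continuous_on (- {0}) (\<lambda>x::'a. (\<nu>' (norm x) / norm x) *\<^sub>R x)"
    by (intro continuous_intros continuous_on_compose2[OF cont]) auto
  then show ?thesis by (rule continuous_on_eq) (simp add: G)
qed

lemma G_measurable [measurable]: "G \<in> borel_measurable borel"
proof -
  have "(\<lambda>x. indicator (- {0}) x *\<^sub>R G x) \<in> borel_measurable (borel :: 'a measure)"
    by (intro borel_measurable_continuous_on_indicator continuous_on_G) auto
  moreover have "G = (\<lambda>x. indicator (- {0}) x *\<^sub>R G x)" by (auto simp: G)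
  ultimately show ?thesis by simp
qed

lemma integrable_dominated:
  fixes f :: "'a \<Rightarrow> 'b::{banach, second_countable_topology}"
  assumes "f \<in> borel_measurable borel" "\<And>x. x \<noteq> 0 \<Longrightarrow> norm (f x) \<le> D * rkernel a x"
  shows "integrable lborel f"
proof (rule Bochner_Integration.integrable_bound)
  show "integrable lborel (\<lambda>x::'a. D * rkernel a x)" by (intro integrable_mult_right rkernel_integrable)
  show "AE x in lborel. norm (f x) \<le> norm (D * rkernel a x)"
    using AE_lborel_singleton[of 0]
  proof eventually_elim
    case (elim x)
    then show ?case using assms(2)[of x] by simp
  qed
qed (use assms in simp)

lemma V_integrable: "integrable lborel V" and G_integrable: "integrable lborel G"
  and Vreg_integrable: "integrable lborel (Vreg j)" and Greg_integrable: "integrable lborel (Greg j)"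
  using V_le G_le Vreg_le Greg_le borel_measurable_continuous_onI[OF continuous_on_Vreg]
    borel_measurable_continuous_onI[OF continuous_on_Greg]
  by (auto intro!: integrable_dominated)

lemma V_norm_le: "(LBINT x. norm (V x)) \<le> D * rmass TYPE('a) a"
proof -
  have "(LBINT x. norm (V x)) \<le> (LBINT x. D * rkernel a (x::'a))"
    using V_le V_integrable rkernel_integrable by (intro integral_mono) auto
  then show ?thesis by simp
qed

lemma L1_norm_tendsto_0:
  fixes f :: "nat \<Rightarrow> 'a \<Rightarrow> 'b::{banach, second_countable_topology}"
  assumes m: "\<And>j. f j \<in> borel_measurable borel" "g \<in> borel_measurable borel"
    and b: "\<And>j x. x \<noteq> 0 \<Longrightarrow> norm (f j x) \<le> D * rkernel a x" "\<And>x. norm (g x) \<le> D * rkernel a x"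
    and lim: "\<And>x. x \<noteq> 0 \<Longrightarrow> (\<lambda>j. f j x) \<longlonglongrightarrow> g x"
  shows "(\<lambda>j. LBINT x. norm (f j x - g x)) \<longlonglongrightarrow> 0"
proof -
  note [measurable] = m
  have "(\<lambda>j. LBINT x. norm (f j x - g x)) \<longlonglongrightarrow> (LBINT (x::'a). 0)"
  proof (rule integral_dominated_convergence[where w = "\<lambda>x. 2 * D * rkernel a x"])
    show "integrable lborel (\<lambda>x::'a. 2 * D * rkernel a x)" by (intro integrable_mult_right rkernel_integrable)
    show "AE x in lborel. (\<lambda>j. norm (f j x - g x)) \<longlonglongrightarrow> 0"
      using AE_lborel_singleton[of 0]
    proof eventually_elim
      case (elim x)
      then show ?case using lim[of x] LIM_zero tendsto_norm_zero by blast
    qed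
    show "AE x in lborel. norm (norm (f j x - g x)) \<le> 2 * D * rkernel a x" for j
      using AE_lborel_singleton[of 0]
    proof eventually_elim
      case (elim x)
      then show ?case using b(1)[of x j] b(2)[of x] norm_triangle_ineq4[of "f j x" "g x"] by simp
    qed
  qed measurable
  then show ?thesis by simp
qed

lemma Vreg_L1: "(\<lambda>j. LBINT x. norm (Vreg j x - V x)) \<longlonglongrightarrow> 0"
proof (rule L1_norm_tendsto_0)
  fix x :: 'a assume "x \<noteq> 0"
  then have "(\<lambda>j. \<nu> (reg j x)) \<longlonglongrightarrow> \<nu> (norm x)"
    by (intro isCont_tendsto_compose[OF isCont_\<nu> reg_tendsto]) simp
  then show "(\<lambda>j. Vreg j x) \<longlonglongrightarrow> V x" using \<open>x \<noteq> 0\<close> by (simp add: Vreg_def V)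
qed (use Vreg_le V_le borel_measurable_continuous_onI[OF continuous_on_Vreg] in auto)

lemma Greg_L1: "(\<lambda>j. LBINT x. norm (Greg j x - G x)) \<longlonglongrightarrow> 0"
proof (rule L1_norm_tendsto_0)
  fix x :: 'a assume "x \<noteq> 0"
  then have "(\<lambda>j. \<nu>' (reg j x)) \<longlonglongrightarrow> \<nu>' (norm x)"
    by (intro isCont_tendsto_compose[OF isCont_\<nu>' reg_tendsto]) simp
  then have "(\<lambda>j. (\<nu>' (reg j x) / reg j x) *\<^sub>R x) \<longlonglongrightarrow> (\<nu>' (norm x) / norm x) *\<^sub>R x"
    using \<open>x \<noteq> 0\<close> by (intro tendsto_intros reg_tendsto) auto
  then show "(\<lambda>j. Greg j x) \<longlonglongrightarrow> G x" using \<open>x \<noteq> 0\<close> by (simp add: Greg_def G)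
qed (use Greg_le G_le borel_measurable_continuous_onI[OF continuous_on_Greg] in auto)

lemma cnv_tendsto:
  fixes f :: "nat \<Rightarrow> 'a \<Rightarrow> 'b::{banach, second_countable_topology}"
  assumes f: "\<And>j. integrable lborel (f j)" "integrable lborel g"
    and lim: "(\<lambda>j. LBINT x. norm (f j x - g x)) \<longlonglongrightarrow> 0"
    and \<rho>: "\<rho> \<in> borel_measurable borel" "\<And>y. \<bar>\<rho> y\<bar> \<le> B" and e: "e > 0"
  shows "\<forall>\<^sub>F j in sequentially. \<forall>x. norm (cnv (f j) \<rho> x - cnv g \<rho> x) \<le> e"
proof -
  have "(\<lambda>j. B * (LBINT x. norm (f j x - g x))) \<longlonglongrightarrow> B * 0"
    by (intro tendsto_intros lim)
  then have "\<forall>\<^sub>F j in sequentially. B * (LBINT x. norm (f j x - g x)) < e"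
    using e by (intro order_tendstoD) auto
  then show ?thesis
  proof eventually_elim
    case (elim j)
    show ?case
    proof
      fix x
      have "norm (cnv (f j) \<rho> x - cnv g \<rho> x) \<le> B * (LBINT x. norm (f j x - g x))"
        unfolding cnv_diff_left[OF f(1) f(2) \<rho>] using f by (intro norm_cnv_le \<rho>) auto
      then show "norm (cnv (f j) \<rho> x - cnv g \<rho> x) \<le> e" using elim by simp
    qed
  qed
qed

text \<open>The regularised kernels are C1 and converge, together with their gradients, in L1.
  Convolution with the bounded \<open>\<rho>\<close> turns this into uniform convergence of
  functions and gradients, which allows differentiation of the limit.\<close>

lemma cnv_has_derivative:
  assumes \<rho>: "continuous_on UNIV \<rho>" and s: "\<And>x. R \<le> norm x \<Longrightarrow> \<rho> x = 0"
  shows "has_grad (cnv V \<rho>) (cnv G \<rho> x) x"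
proof -
  obtain B where B: "\<And>y. \<bar>\<rho> y\<bar> \<le> B"
    using continuous_bounded_support_bounded[OF \<rho> s] by (metis real_norm_def)
  have \<rho>m: "\<rho> \<in> borel_measurable borel" using \<rho> by (rule borel_measurable_continuous_onI)
  have lim: "(\<lambda>j. cnv (Vreg j) \<rho> x) \<longlonglongrightarrow> cnv V \<rho> x" for x
  proof (rule LIMSEQ_I)
    fix e :: real assume e: "0 < e"
    have "\<forall>\<^sub>F j in sequentially. \<forall>x. norm (cnv (Vreg j) \<rho> x - cnv V \<rho> x) \<le> e / 2"
      by (rule cnv_tendsto[OF Vreg_integrable V_integrable Vreg_L1 \<rho>m B]) (use e in simp)
    then obtain N where N: "\<And>j x. j \<ge> N \<Longrightarrow> norm (cnv (Vreg j) \<rho> x - cnv V \<rho> x) \<le> e / 2"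
      by (auto simp: eventually_sequentially)
    have "norm (cnv (Vreg j) \<rho> x - cnv V \<rho> x) < e" if "j \<ge> N" for j
      using N[OF that, of x] e by simp
    then show "\<exists>N. \<forall>j\<ge>N. norm (cnv (Vreg j) \<rho> x - cnv V \<rho> x) < e" by blast
  qed
  have "\<exists>g. \<forall>x\<in>UNIV. (\<lambda>j. cnv (Vreg j) \<rho> x) \<longlonglongrightarrow> g x \<and>
      (g has_derivative (\<lambda>h. cnv G \<rho> x \<bullet> h)) (at x within UNIV)"
  proof (rule has_derivative_sequence[OF convex_UNIV _ _ UNIV_I lim])
    show "(cnv (Vreg j) \<rho> has_derivative (\<lambda>h. cnv (Greg j) \<rho> x \<bullet> h)) (at x within UNIV)" for j x
      by (rule cnv_C1_kernel_has_derivative[OF Vreg_has_derivative continuous_on_Greg \<rho> s])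
    fix e :: real assume "e > 0"
    from cnv_tendsto[OF Greg_integrable G_integrable Greg_L1 \<rho>m B this]
    show "\<forall>\<^sub>F j in sequentially. \<forall>x\<in>UNIV. \<forall>h. norm (cnv (Greg j) \<rho> x \<bullet> h - cnv G \<rho> x \<bullet> h) \<le> e * norm h"
    proof eventually_elim
      case (elim j)
      show ?case
      proof (intro ballI allI)
        fix x h
        have "norm (cnv (Greg j) \<rho> x \<bullet> h - cnv G \<rho> x \<bullet> h) \<le> norm (cnv (Greg j) \<rho> x - cnv G \<rho> x) * norm h"
          unfolding inner_diff_left[symmetric] real_norm_def by (rule Cauchy_Schwarz_ineq2)
        also have "\<dots> \<le> e * norm h" using elim by (intro mult_right_mono) auto
        finally show "norm (cnv (Greg j) \<rho> x \<bullet> h - cnv G \<rho> x \<bullet> h) \<le> e * norm h" .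
      qed
    qed
  qed
  then obtain g where g: "\<And>x. (\<lambda>j. cnv (Vreg j) \<rho> x) \<longlonglongrightarrow> g x"
      "\<And>x. has_grad g (cnv G \<rho> x) x" by auto
  have "g = cnv V \<rho>" using LIMSEQ_unique[OF g(1) lim] by blast
  then show ?thesis using g(2) by simp
qed

end

text \<open>\<open>\<sigma>\<close> is the reflection in the perpendicular bisector of
  \<open>x\<close> and \<open>y\<close>. As \<open>norm x \<le> norm y\<close>, the origin lies on
  the side of \<open>x\<close> (or on the hyperplane), so the comparison of \<open>z\<close> with
  its mirror image has the same outcome when seen from the origin and from \<open>x\<close>.\<close>

lemma reflection_exists:
  fixes x y :: "'a::euclidean_space"
  assumes "x \<noteq> y" "norm x \<le> norm y"
  obtains \<sigma> :: "'a \<Rightarrow> 'a" where "\<And>u v. dist (\<sigma> u) (\<sigma> v) = dist u v" "\<And>u. \<sigma> (\<sigma> u) = u"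
    "\<sigma> x = y" "\<And>z. (norm z \<le> norm (\<sigma> z) \<and> norm (x - z) \<le> norm (y - z))
                 \<or> (norm (\<sigma> z) \<le> norm z \<and> norm (y - z) \<le> norm (x - z))"
proof -
  define c where "c = 2 / ((y - x) \<bullet> (y - x))"
  define s where "s = (\<lambda>z. (z - (1/2) *\<^sub>R (x + y)) \<bullet> (y - x))"
  define \<sigma> where "\<sigma> = (\<lambda>z. z - (c * s z) *\<^sub>R (y - x))"
  have e: "(y - x) \<bullet> (y - x) > 0" using assms by simp
  then have c: "c > 0" "c * ((y - x) \<bullet> (y - x)) = 2" by (auto simp: c_def)
  have sdiff: "s u - s v = (u - v) \<bullet> (y - x)" for u v by (simp add: s_def inner_diff_left)
  have s\<sigma>: "s (\<sigma> z) = - s z" for z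
  proof -
    have "s (\<sigma> z) - s z = - (c * s z * ((y - x) \<bullet> (y - x)))" unfolding sdiff by (simp add: \<sigma>_def)
    also have "\<dots> = - (2 * s z)" using c(2) by (metis mult.assoc mult.commute)
    finally show ?thesis by simp
  qed
  \<comment> \<open>\<open>s\<close> is the signed position relative to the hyperplane, up to a
    factor; the identity says that a point is closer to \<open>v\<close> than to its image exactly
    if both lie on the same side.\<close>
  have key: "(norm (u - \<sigma> v))\<^sup>2 - (norm (u - v))\<^sup>2 = 2 * c * s u * s v" for u v
  proof -
    have "u - \<sigma> v = (u - v) + (c * s v) *\<^sub>R (y - x)" by (simp add: \<sigma>_def)
    moreover have "(norm (p + t *\<^sub>R d))\<^sup>2 = (norm p)\<^sup>2 + 2 * t * (p \<bullet> d) + t\<^sup>2 * (d \<bullet> d)" for p d :: 'a and t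
      unfolding power2_norm_eq_inner
      by (simp add: inner_add_left inner_add_right inner_commute power2_eq_square algebra_simps)
    ultimately have "(norm (u - \<sigma> v))\<^sup>2 = (norm (u - v))\<^sup>2 + 2 * (c * s v) * ((u - v) \<bullet> (y - x))
        + (c * s v)\<^sup>2 * ((y - x) \<bullet> (y - x))"
      by presburger
    moreover have "(c * s v)\<^sup>2 * ((y - x) \<bullet> (y - x)) = (c * ((y - x) \<bullet> (y - x))) * (c * (s v)\<^sup>2)"
      by (simp add: power2_eq_square)
    ultimately show ?thesis unfolding sdiff[of u v, symmetric] c(2) by (simp add: power2_eq_square algebra_simps)
  qed
  have inv: "\<sigma> (\<sigma> z) = z" for z
  proof -
    have "\<sigma> (\<sigma> z) = \<sigma> z - (c * s (\<sigma> z)) *\<^sub>R (y - x)" by (simp add: \<sigma>_def)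
    then show ?thesis unfolding s\<sigma> by (simp add: \<sigma>_def)
  qed
  have iso: "dist (\<sigma> u) (\<sigma> v) = dist u v" for u v
  proof -
    have "(norm (\<sigma> u - \<sigma> v))\<^sup>2 = (norm (\<sigma> u - v))\<^sup>2 + 2 * c * s (\<sigma> u) * s v" using key[of "\<sigma> u" v] by simp
    also have "(norm (\<sigma> u - v))\<^sup>2 = (norm (v - u))\<^sup>2 + 2 * c * s v * s u"
      using key[of v u] by (simp add: norm_minus_commute)
    finally have "(norm (\<sigma> u - \<sigma> v))\<^sup>2 = (norm (v - u))\<^sup>2" by (simp add: s\<sigma>)
    then show ?thesis by (simp add: dist_norm norm_minus_commute power2_eq_iff_nonneg)
  qed
  have sx: "s x = - ((y - x) \<bullet> (y - x)) / 2"
  proof -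
    have "x - (1/2) *\<^sub>R (x + y) = (- 1/2) *\<^sub>R (y - x)"
      by (rule euclidean_eqI) (simp add: inner_diff_left inner_add_left field_simps)
    then show ?thesis by (simp add: s_def)
  qed
  have \<sigma>x: "\<sigma> x = y"
  proof -
    have "c * s x = - 1" using c(2) by (simp add: sx)
    then show ?thesis by (simp add: \<sigma>_def)
  qed
  have s0: "s 0 \<le> 0"
  proof -
    have "s 0 = - ((1/2) * ((x + y) \<bullet> (y - x)))" by (simp add: s_def)
    also have "(x + y) \<bullet> (y - x) = (norm y)\<^sup>2 - (norm x)\<^sup>2"
      unfolding power2_norm_eq_inner by (simp add: inner_add_left inner_diff_right inner_commute[of y x])
    finally have "s 0 = ((norm x)\<^sup>2 - (norm y)\<^sup>2) / 2" by argo
    moreover have "(norm x)\<^sup>2 \<le> (norm y)\<^sup>2" using assms by (simp add: power_mono)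
    ultimately show ?thesis by argo
  qed
  have sx0: "s x \<le> 0" unfolding sx using e by simp
  have cmp: "(s z \<le> 0 \<longrightarrow> norm (u - z) \<le> norm (u - \<sigma> z)) \<and> (s z \<ge> 0 \<longrightarrow> norm (u - \<sigma> z) \<le> norm (u - z))"
    if "s u \<le> 0" for u z
  proof -
    have k: "(norm (u - \<sigma> z))\<^sup>2 - (norm (u - z))\<^sup>2 = (2 * c) * (s u * s z)"
      using key[of u z] by (simp add: mult.assoc)
    have "(norm (u - z))\<^sup>2 \<le> (norm (u - \<sigma> z))\<^sup>2" if "s z \<le> 0"
    proof -
      have "0 \<le> (2 * c) * (s u * s z)"
        using c(1) that \<open>s u \<le> 0\<close> by (intro mult_nonneg_nonneg mult_nonpos_nonpos) auto
      then show ?thesis using k by linarith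
    qed
    moreover have "(norm (u - \<sigma> z))\<^sup>2 \<le> (norm (u - z))\<^sup>2" if "s z \<ge> 0"
    proof -
      have "(2 * c) * (s u * s z) \<le> 0"
        using c(1) that \<open>s u \<le> 0\<close> by (intro mult_nonneg_nonpos mult_nonpos_nonneg) auto
      then show ?thesis using k by linarith
    qed
    ultimately show ?thesis using power2_le_imp_le norm_ge_zero by blast
  qed
  have yz: "norm (x - \<sigma> z) = norm (y - z)" for z
    using iso[of y z] inv[of x] \<sigma>x by (simp add: dist_norm)
  show ?thesis
  proof (rule that[OF iso inv \<sigma>x])
    show "(norm z \<le> norm (\<sigma> z) \<and> norm (x - z) \<le> norm (y - z)) \<or> (norm (\<sigma> z) \<le> norm z \<and> norm (y - z) \<le> norm (x - z))" for z
      using cmp[OF s0, of z] cmp[OF sx0, of z] unfolding yz by (cases "s z \<le> 0") auto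
  qed
qed

text \<open>Folding the integral along the reflection that exchanges \<open>x\<close> and \<open>y\<close> leaves a product of two
  differences of equal sign.\<close>

lemma convolution_radially_increasing:
  fixes \<rho> :: "'a::euclidean_space \<Rightarrow> real"
  assumes \<rho>: "\<And>u v. norm u \<le> norm v \<Longrightarrow> \<rho> v \<le> \<rho> u"
    and k: "\<And>u v. u \<noteq> 0 \<Longrightarrow> norm u \<le> norm v \<Longrightarrow> k u \<le> k v"
    and m: "\<rho> \<in> borel_measurable borel" "k \<in> borel_measurable borel"
    and int: "\<And>x. integrable lborel (\<lambda>z. \<rho> z * k (x - z))"
    and xy: "norm x \<le> norm y"
  shows "(LBINT z. \<rho> z * k (x - z)) \<le> (LBINT z. \<rho> z * k (y - z))"
proof (cases "x = y")
  case False
  obtain \<sigma> where iso: "\<And>u v. dist (\<sigma> u) (\<sigma> v) = dist u v" and inv: "\<And>u. \<sigma> (\<sigma> u) = u"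
    and \<sigma>x: "\<sigma> x = y" and cmp: "\<And>z. (norm z \<le> norm (\<sigma> z) \<and> norm (x - z) \<le> norm (y - z))
                 \<or> (norm (\<sigma> z) \<le> norm z \<and> norm (y - z) \<le> norm (x - z))"
    by (rule reflection_exists[OF False xy]) blast
  note [measurable] = m
  define F where "F = (\<lambda>z. \<rho> z * k (y - z) - \<rho> z * k (x - z))"
  have F: "integrable lborel F" unfolding F_def using int by auto
  have Fm: "F \<in> borel_measurable borel" unfolding F_def by measurable
  have keq: "k u = k v" if "u \<noteq> 0" "norm u = norm v" for u v
  proof -
    have "v \<noteq> 0" using that by auto
    then show ?thesis using k[of u v] k[of v u] that by simp
  qed
  \<comment> \<open>The kernel is monotone only away from the origin, so the points where
    \<open>x - z\<close> or \<open>y - z\<close> vanishes are excluded.\<close>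
  have ae: "AE z in lborel. 0 \<le> F z + F (\<sigma> z)"
    using AE_lborel_singleton[of x] AE_lborel_singleton[of y]
  proof eventually_elim
    case (elim z)
    have "norm (y - \<sigma> z) = norm (x - z)" using iso[of x z] \<sigma>x by (simp add: dist_norm)
    moreover have "norm (x - \<sigma> z) = norm (y - z)" using iso[of y z] inv[of x] \<sigma>x by (simp add: dist_norm)
    ultimately have "k (y - \<sigma> z) = k (x - z)" "k (x - \<sigma> z) = k (y - z)"
      using elim by (metis keq right_minus_eq norm_eq_zero)+
    then have "F z + F (\<sigma> z) = (\<rho> z - \<rho> (\<sigma> z)) * (k (y - z) - k (x - z))"
      by (simp add: F_def algebra_simps)
    moreover have "0 \<le> (\<rho> z - \<rho> (\<sigma> z)) * (k (y - z) - k (x - z))"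
      using cmp[of z]
    proof
      assume "norm z \<le> norm (\<sigma> z) \<and> norm (x - z) \<le> norm (y - z)"
      then show ?thesis using \<rho>[of z "\<sigma> z"] k[of "x - z" "y - z"] elim by (intro mult_nonneg_nonneg) auto
    next
      assume "norm (\<sigma> z) \<le> norm z \<and> norm (y - z) \<le> norm (x - z)"
      then show ?thesis using \<rho>[of "\<sigma> z" z] k[of "y - z" "x - z"] elim by (intro mult_nonpos_nonpos) auto
    qed
    ultimately show ?case by simp
  qed
  have F\<sigma>: "integrable lborel (\<lambda>z. F (\<sigma> z))" using F integrable_involutive_isometry[OF iso inv Fm] by simp
  have "0 \<le> (LBINT z. F z + F (\<sigma> z))" by (rule integral_nonneg_AE[OF ae])
  also have "\<dots> = 2 * (LBINT z. F z)"
    using F F\<sigma> integral_involutive_isometry[OF iso inv Fm] by simp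
  finally have "0 \<le> (LBINT z. F z)" by simp
  then show ?thesis unfolding F_def using int by simp
qed simp

section \<open>The contraction\<close>

definition pospow :: "real \<Rightarrow> real \<Rightarrow> real" where
  "pospow p t = max 0 t powr p"

lemma pospow_nonneg [simp]: "0 \<le> pospow p t" by (simp add: pospow_def)

lemma pospow_eq_0: "t \<le> 0 \<Longrightarrow> pospow p t = 0" by (simp add: pospow_def)

lemma pospow_mono: "0 \<le> p \<Longrightarrow> s \<le> t \<Longrightarrow> pospow p s \<le> pospow p t"
  unfolding pospow_def by (intro powr_mono2) auto

lemma continuous_on_pospow: "0 < p \<Longrightarrow> continuous_on UNIV (pospow p)"
  unfolding pospow_def[abs_def] by (intro continuous_on_powr' continuous_intros) auto

lemma pospow_has_derivative:
  assumes "1 < p"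
  shows "(pospow p has_real_derivative p * pospow (p - 1) t) (at t)"
proof -
  consider "t > 0" | "t < 0" | "t = 0" by linarith
  then show ?thesis
  proof cases
    case 1
    have "((\<lambda>t. t powr p) has_real_derivative p * t powr (p - 1)) (at t)"
      using has_real_derivative_powr[OF 1] by simp
    then have "((\<lambda>t. t powr p) has_real_derivative p * pospow (p - 1) t) (at t)"
      using 1 by (simp add: pospow_def)
    then show ?thesis
      by (rule has_field_derivative_transform_within_open[where S = "{0<..}"]) (use 1 in \<open>auto simp: pospow_def\<close>)
  next
    case 2
    have "((\<lambda>t. 0) has_real_derivative p * pospow (p - 1) t) (at t)"
      using 2 by (simp add: pospow_def)
    then show ?thesis
      by (rule has_field_derivative_transform_within_open[where S = "{..<0}"]) (use 2 in \<open>auto simp: pospow_def\<close>)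
  next
    case 3
    have lim: "((\<lambda>h. pospow (p - 1) h) \<longlongrightarrow> pospow (p - 1) 0) (at 0)"
      using continuous_on_pospow[of "p - 1"] assms by (simp add: continuous_on_def)
    have "pospow (p - 1) h = (pospow p h - pospow p 0) / h" if "h \<noteq> 0" for h
      using that assms powr_diff[of h p 1] by (cases "h > 0") (auto simp: pospow_def)
    then have "\<forall>\<^sub>F h in at 0. pospow (p - 1) h = (pospow p h - pospow p 0) / h"
      by (auto simp: eventually_at_filter)
    from Lim_transform_eventually[OF lim this]
    show ?thesis using 3 assms by (simp add: DERIV_def pospow_def)
  qed
qed

lemma pospow_lipschitz:
  assumes "1 < p" "s \<le> T" "t \<le> T"
  shows "\<bar>pospow p s - pospow p t\<bar> \<le> p * pospow (p - 1) T * \<bar>s - t\<bar>"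
proof -
  have *: "\<bar>pospow p s - pospow p t\<bar> \<le> p * pospow (p - 1) T * \<bar>s - t\<bar>" if st: "s < t" "t \<le> T" for s t
  proof -
    obtain z where z: "s < z" "z < t" "pospow p t - pospow p s = (t - s) * (p * pospow (p - 1) z)"
      using MVT2[OF st(1), of "pospow p" "\<lambda>z. p * pospow (p - 1) z"] pospow_has_derivative[OF assms(1)] by blast
    have "pospow (p - 1) z \<le> pospow (p - 1) T" using assms z st by (intro pospow_mono) auto
    then have "(t - s) * (p * pospow (p - 1) z) \<le> (t - s) * (p * pospow (p - 1) T)"
      using assms st by (intro mult_left_mono) auto
    moreover have "0 \<le> (t - s) * (p * pospow (p - 1) z)" using assms st by simp
    ultimately have "\<bar>pospow p t - pospow p s\<bar> \<le> (t - s) * (p * pospow (p - 1) T)" unfolding z(3) by simp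
    then show ?thesis using st by (simp add: abs_minus_commute mult.commute)
  qed
  show ?thesis using *[of s t] *[of t s] assms
    by (cases s t rule: linorder_cases) (auto simp: abs_minus_commute)
qed

text \<open>In the following locale, \<open>2 * A\<close> bounds \<open>C - lam * |x|\<^sup>2 - V * \<rho>\<close> from above: \<open>large\<close> forces the level \<open>C\<close> of a
  profile of mass 1 below \<open>A\<close> plus the size of \<open>V * \<rho>\<close>, which is at most \<open>A / 2\<close> by \<open>small\<close>; \<open>contr\<close> makes
  the fixed point map a contraction with factor 1/2.\<close>

locale flat_state = radial_kernel \<nu> \<nu>' a D V G
  for \<nu> \<nu>' :: "real \<Rightarrow> real" and a D :: real and V :: "'a::euclidean_space \<Rightarrow> real" and G :: "'a \<Rightarrow> 'a" +
  fixes p c A lam R :: real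
  assumes p: "1 < p" and c: "0 < c" and A: "0 < A" and lam_pos: "0 < lam" and R: "0 < R" "2 * A \<le> lam * R\<^sup>2"
    and small: "2 * (D * rmass TYPE('a) a) * (c * (2 * A) powr p) \<le> A"
    and contr: "4 * c * p * (2 * A) powr (p - 1) * (D * rmass TYPE('a) a) \<le> 1"
    and large: "1 \<le> c * (A / 2) powr p * measure lborel (ball (0::'a) (sqrt (A / (2 * lam))))"
    and mono: "\<And>r s. 0 < r \<Longrightarrow> r \<le> s \<Longrightarrow> lam * r\<^sup>2 + \<nu> r \<le> lam * s\<^sup>2 + \<nu> s"
begin

text \<open>\<open>N\<close> bounds the L1 norm of \<open>V\<close>, \<open>B\<close> is the
  greatest height of the densities considered, and so \<open>\<eta>\<close> bounds
  \<open>V * \<rho>\<close>.\<close>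

definition N where "N = D * rmass TYPE('a) a"
definition B where "B = c * (2 * A) powr p"
definition \<eta> where "\<eta> = N * B"

lemma N_nonneg: "0 \<le> N"
  unfolding N_def by (intro mult_nonneg_nonneg D integral_nonneg) (simp add: rkernel_nonneg)

lemma B_pos: "0 < B" unfolding B_def using c A by simp

lemma \<eta>: "0 \<le> \<eta>" "2 * \<eta> \<le> A"
  using small N_nonneg B_pos unfolding \<eta>_def N_def[symmetric] B_def[symmetric] by auto

section \<open>Densities of unit mass in a nearly quadratic potential\<close>

definition admissible :: "('a \<Rightarrow> real) \<Rightarrow> bool" where
  "admissible f \<longleftrightarrow> continuous_on UNIV f \<and> (\<forall>x. \<bar>f x - lam * (norm x)\<^sup>2\<bar> \<le> \<eta>)"

definition dens :: "('a \<Rightarrow> real) \<Rightarrow> real \<Rightarrow> 'a \<Rightarrow> real" where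
  "dens f C x = c * pospow p (C - f x)"

text \<open>With C at most A + \<eta> and \<open>f\<close> at least
  \<open>lam * (norm x)\<^sup>2 - \<eta>\<close>, the difference \<open>C - f x\<close> is at most
  \<open>2 * A - lam * (norm x)\<^sup>2\<close>, since \<open>2 * \<eta> \<le> A\<close>. This gives
  the height, and the choice of \<open>R\<close> the support.\<close>

lemma dens_props:
  assumes f: "admissible f" and C: "C \<le> A + \<eta>"
  shows "continuous_on UNIV (dens f C)" "0 \<le> dens f C x" "dens f C x \<le> B" "C - f x \<le> 2 * A"
    "R \<le> norm x \<Longrightarrow> dens f C x = 0" "integrable lborel (dens f C)"
proof -
  have cf: "continuous_on UNIV f" using f by (simp add: admissible_def)
  show cd: "continuous_on UNIV (dens f C)"
    unfolding dens_def[abs_def] using p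
    by (intro continuous_intros continuous_on_compose2[OF continuous_on_pospow] cf) auto
  show "0 \<le> dens f C x" using c by (simp add: dens_def)
  have le: "C - f x \<le> 2 * A - lam * (norm x)\<^sup>2" for x
    using f C \<eta> unfolding admissible_def by (smt (verit))
  show *: "C - f x \<le> 2 * A" using le[of x] lam_pos by (smt (verit) mult_nonneg_nonneg zero_le_power2)
  have "pospow p (C - f x) \<le> pospow p (2 * A)" using * p by (intro pospow_mono) auto
  then show "dens f C x \<le> B" using c A by (simp add: dens_def B_def pospow_def)
  show **: "dens f C x = 0" if "R \<le> norm x" for x
  proof -
    have "lam * R\<^sup>2 \<le> lam * (norm x)\<^sup>2" using lam_pos that R by (intro mult_left_mono power_mono) auto
    then have "C - f x \<le> 0" using le[of x] R by linarith
    then show ?thesis by (simp add: dens_def pospow_eq_0)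
  qed
  show "integrable lborel (dens f C)" by (rule integrable_continuous_bounded_support[OF cd **])
qed

lemma integrable_bound_cball: "integrable lborel (\<lambda>x::'a. K * indicator (cball 0 R) x :: real)"
  using emeasure_bounded_finite[of "cball (0::'a) R"]
  by (intro integrable_mult_right integrable_real_indicator) auto

text \<open>Intermediate value theorem in the level: at \<open>- \<eta>\<close> the density
  vanishes, while at \<open>A + \<eta>\<close> it is at least \<open>c * (A / 2) powr p\<close> on
  the ball where \<open>lam * (norm x)\<^sup>2 < A / 2\<close>, which \<open>large\<close> makes
  heavy enough.\<close>

lemma level_exists:
  assumes f: "admissible f"
  shows "\<exists>C. C \<le> A + \<eta> \<and> (LBINT x. dens f C x) = 1"
proof -
  define M where "M = (\<lambda>C. LBINT x. dens f C x)"
  have "continuous_on {- \<eta>..A + \<eta>} M"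
  proof (rule continuous_on_sequentiallyI)
    fix u C assume u: "\<forall>n::nat. u n \<in> {- \<eta>..A + \<eta>}" "C \<in> {- \<eta>..A + \<eta>}" "u \<longlonglongrightarrow> C"
    show "(\<lambda>n. M (u n)) \<longlonglongrightarrow> M C"
      unfolding M_def
    proof (rule integral_dominated_convergence[where w = "\<lambda>x. B * indicator (cball 0 R) x"])
      show "dens f C \<in> borel_measurable lborel" "\<And>i. dens f (u i) \<in> borel_measurable lborel"
        using dens_props(1)[OF f] u by (auto intro!: borel_measurable_continuous_onI)
      show "integrable lborel (\<lambda>x::'a. B * indicator (cball 0 R) x)" by (rule integrable_bound_cball)
      show "AE x in lborel. (\<lambda>i. dens f (u i) x) \<longlonglongrightarrow> dens f C x"
        unfolding dens_def using p
        by (intro AE_I2 tendsto_intros continuous_on_tendsto_compose[OF continuous_on_pospow] u(3)) auto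
      have "norm (dens f (u i) x) \<le> B * indicator (cball 0 R) x" for i x
        using dens_props(2,3,5)[OF f, of "u i" x] u(1) by (auto simp: indicator_def)
      then show "AE x in lborel. norm (dens f (u i) x) \<le> B * indicator (cball 0 R) x" for i by simp
    qed
  qed
  moreover have "M (- \<eta>) = 0"
  proof -
    have "- \<eta> - f x \<le> 0" for x
    proof -
      have "0 \<le> lam * (norm x)\<^sup>2" using lam_pos by simp
      moreover have "\<bar>f x - lam * (norm x)\<^sup>2\<bar> \<le> \<eta>" using f by (simp add: admissible_def)
      ultimately show ?thesis by linarith
    qed
    then have "dens f (- \<eta>) = (\<lambda>x. 0)" by (simp add: dens_def fun_eq_iff pospow_eq_0)
    then show ?thesis by (simp add: M_def)
  qed
  moreover have "1 \<le> M (A + \<eta>)"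
  proof -
    let ?b = "ball (0::'a) (sqrt (A / (2 * lam)))"
    have "1 \<le> (LBINT x. c * (A / 2) powr p * indicator ?b x)" using large by simp
    also have "\<dots> \<le> (LBINT x. dens f (A + \<eta>) x)"
    proof (rule integral_mono)
      show "integrable lborel (\<lambda>x. c * (A / 2) powr p * indicator ?b x)"
        using emeasure_bounded_finite[of ?b]
        by (intro integrable_mult_right integrable_real_indicator) auto
      show "integrable lborel (dens f (A + \<eta>))" by (rule dens_props[OF f order_refl])
      show "c * (A / 2) powr p * indicator ?b x \<le> dens f (A + \<eta>) x" for x
      proof (cases "x \<in> ?b")
        case True
        then have "norm x < sqrt (A / (2 * lam))" by simp
        then have "(norm x)\<^sup>2 < (sqrt (A / (2 * lam)))\<^sup>2" by (intro power_strict_mono) auto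
        also have "\<dots> = A / (2 * lam)" using A lam_pos by simp
        finally have "lam * (norm x)\<^sup>2 < A / 2" using lam_pos by (simp add: field_simps)
        moreover have "\<bar>f x - lam * (norm x)\<^sup>2\<bar> \<le> \<eta>" using f by (simp add: admissible_def)
        ultimately have "A / 2 \<le> A + \<eta> - f x" by linarith
        then have "pospow p (A / 2) \<le> pospow p (A + \<eta> - f x)" using p by (intro pospow_mono) auto
        then show ?thesis using c A True by (simp add: dens_def pospow_def)
      qed (use dens_props(2)[OF f order_refl] in simp)
    qed
    finally show ?thesis by (simp add: M_def)
  qed
  ultimately obtain C where "- \<eta> \<le> C" "C \<le> A + \<eta>" "M C = 1"
    using IVT'[of M "- \<eta>" 1 "A + \<eta>"] \<eta>(1) A by fastforce
  then show ?thesis unfolding M_def by blast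
qed

text \<open>If C' were larger, the second density would dominate the first, strictly wherever the
  first is positive. Equal masses then force the first to vanish almost everywhere, against its mass
  1.\<close>

lemma level_le:
  assumes f: "admissible f" and g: "admissible g" and fg: "\<And>x. \<bar>f x - g x\<bar> \<le> \<delta>"
    and C: "C \<le> A + \<eta>" "(LBINT x. dens f C x) = 1" and C': "C' \<le> A + \<eta>" "(LBINT x. dens g C' x) = 1"
  shows "C' \<le> C + \<delta>"
proof (rule ccontr)
  assume *: "\<not> C' \<le> C + \<delta>"
  have lt: "C - f x < C' - g x" for x using fg[of x] * by linarith
  have le: "dens f C x \<le> dens g C' x" for x
    unfolding dens_def using c p lt[of x] by (intro mult_left_mono pospow_mono) auto
  have int: "integrable lborel (\<lambda>x. dens g C' x - dens f C x)"
    using dens_props(6)[OF f C(1)] dens_props(6)[OF g C'(1)] by simp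
  have "(LBINT x. dens g C' x - dens f C x) = 0"
    using dens_props(6)[OF f C(1)] dens_props(6)[OF g C'(1)] C C' by simp
  then have "AE x in lborel. dens g C' x - dens f C x = 0"
    by (subst (asm) integral_nonneg_eq_0_iff_AE[OF int]) (use le in auto)
  then have "AE x in lborel. dens f C x = 0"
  proof eventually_elim
    case (elim x)
    show ?case
    proof (cases "C - f x \<le> 0")
      case False
      then have "(C - f x) powr p < (C' - g x) powr p" using lt[of x] p by (intro powr_less_mono2) auto
      then have "dens f C x < dens g C' x" using False lt[of x] c by (simp add: dens_def pospow_def)
      then show ?thesis using elim by simp
    qed (simp add: dens_def pospow_eq_0)
  qed
  then have "(LBINT x. dens f C x) = 0" using integral_eq_zero_AE by blast
  then show False using C by simp
qed

definition level :: "('a \<Rightarrow> real) \<Rightarrow> real" where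
  "level f = (SOME C. C \<le> A + \<eta> \<and> (LBINT x. dens f C x) = 1)"

lemma level:
  assumes "admissible f"
  shows "level f \<le> A + \<eta>" "(LBINT x. dens f (level f) x) = 1"
  using someI_ex[OF level_exists[OF assms]] unfolding level_def by auto

text \<open>A change of the potential by \<open>\<delta>\<close> moves the level by at most
  \<open>\<delta>\<close>, hence their difference by at most \<open>2 * \<delta>\<close>. Below
  \<open>2 * A\<close> the truncated power has slope at most
  \<open>p * (2 * A) powr (p - 1)\<close>.\<close>

lemma dens_level_lipschitz:
  assumes f: "admissible f" and g: "admissible g" and fg: "\<And>x. \<bar>f x - g x\<bar> \<le> \<delta>"
  shows "\<bar>dens f (level f) x - dens g (level g) x\<bar> \<le> c * (p * (2 * A) powr (p - 1)) * (2 * \<delta>)"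
proof -
  have gf: "\<bar>g x - f x\<bar> \<le> \<delta>" for x using fg[of x] by linarith
  have "\<bar>level f - level g\<bar> \<le> \<delta>"
    using level_le[OF f g fg level[OF f] level[OF g]] level_le[OF g f gf level[OF g] level[OF f]] by linarith
  then have d: "\<bar>(level f - f x) - (level g - g x)\<bar> \<le> 2 * \<delta>" using fg[of x] by linarith
  have "\<bar>pospow p (level f - f x) - pospow p (level g - g x)\<bar>
      \<le> p * pospow (p - 1) (2 * A) * \<bar>(level f - f x) - (level g - g x)\<bar>"
    using dens_props(4)[OF f level(1)[OF f], of x] dens_props(4)[OF g level(1)[OF g], of x]
    by (intro pospow_lipschitz p)
  also have "\<dots> \<le> p * pospow (p - 1) (2 * A) * (2 * \<delta>)"
    using d p by (intro mult_left_mono) auto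
  finally have "c * \<bar>pospow p (level f - f x) - pospow p (level g - g x)\<bar>
     \<le> c * (p * pospow (p - 1) (2 * A) * (2 * \<delta>))" using c by (intro mult_left_mono) auto
  moreover have "\<bar>dens f (level f) x - dens g (level g) x\<bar> = c * \<bar>pospow p (level f - f x) - pospow p (level g - g x)\<bar>"
    using c unfolding dens_def by (simp add: abs_mult right_diff_distrib[symmetric])
  ultimately show ?thesis using A by (simp add: pospow_def mult.assoc)
qed

text \<open>The invariant set of the fixed point map. Monotonicity in the norm contains radial
  symmetry; kept as part of the set, it yields both the vanishing first moment and the radial
  monotonicity of the fixed point.\<close>

definition profiles :: "('a \<Rightarrow> real) set" where
  "profiles = {\<rho>. continuous_on UNIV \<rho> \<and> (\<forall>x. 0 \<le> \<rho> x \<and> \<rho> x \<le> B) \<and> (\<forall>x y. norm x \<le> norm y \<longrightarrow> \<rho> y \<le> \<rho> x)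
     \<and> (\<forall>x. R \<le> norm x \<longrightarrow> \<rho> x = 0) \<and> (LBINT x. \<rho> x) = 1}"

lemma profilesD:
  assumes "\<rho> \<in> profiles"
  shows "continuous_on UNIV \<rho>" "\<rho> \<in> borel_measurable borel" "0 \<le> \<rho> x" "\<rho> x \<le> B" "\<bar>\<rho> x\<bar> \<le> B"
    "norm x \<le> norm y \<Longrightarrow> \<rho> y \<le> \<rho> x" "R \<le> norm x \<Longrightarrow> \<rho> x = 0" "(LBINT x. \<rho> x) = 1" "\<rho> (- x) = \<rho> x"
proof -
  show "\<rho> (- x) = \<rho> x" using assms unfolding profiles_def by (simp add: order_antisym)
qed (use assms in \<open>auto simp: profiles_def intro: borel_measurable_continuous_onI\<close>)

lemma profiles_first_moment:
  assumes \<rho>: "\<rho> \<in> profiles"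
  shows "integrable lborel (\<lambda>z. \<rho> z *\<^sub>R z)" "(LBINT z. \<rho> z *\<^sub>R z) = 0"
proof -
  have cont: "continuous_on UNIV (\<lambda>z. \<rho> z *\<^sub>R z)"
    by (intro continuous_intros profilesD[OF \<rho>])
  show "integrable lborel (\<lambda>z. \<rho> z *\<^sub>R z)"
    by (rule integrable_continuous_bounded_support[OF cont, of R]) (simp add: profilesD[OF \<rho>])
  have "(LBINT z. \<rho> (0 - z) *\<^sub>R (0 - z)) = (LBINT z. \<rho> z *\<^sub>R z)"
    by (rule integral_reflect_shift[OF borel_measurable_continuous_onI[OF cont]])
  then have "- (LBINT z. \<rho> z *\<^sub>R z) = (LBINT z. \<rho> z *\<^sub>R z)"
    by (simp add: profilesD(9)[OF \<rho>])
  then have "(LBINT z. \<rho> z *\<^sub>R z) + (LBINT z. \<rho> z *\<^sub>R z) = 0"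
    by (metis add.left_inverse)
  then show "(LBINT z. \<rho> z *\<^sub>R z) = 0" by (simp add: scaleR_2[symmetric])
qed

lemma profiles_integrable: "\<rho> \<in> profiles \<Longrightarrow> integrable lborel \<rho>"
  by (rule integrable_continuous_bounded_support[OF profilesD(1) profilesD(7)])

definition pot :: "('a \<Rightarrow> real) \<Rightarrow> 'a \<Rightarrow> real" where
  "pot \<rho> x = lam * (norm x)\<^sup>2 + cnv V \<rho> x"

lemma profiles_cnv_integrable:
  fixes k :: "'a \<Rightarrow> 'b::{banach, second_countable_topology}"
  assumes \<rho>: "\<rho> \<in> profiles" and k: "integrable lborel k" and km: "k \<in> borel_measurable borel"
  shows "integrable lborel (\<lambda>z. \<rho> z *\<^sub>R k (x - z))"
  using cnv_integrable[OF k profilesD(2)[OF \<rho>] profilesD(5)[OF \<rho>], of x]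
    cnv_integrable_iff[OF km profilesD(2)[OF \<rho>], of x] by blast

text \<open>In the expanded square the mass 1 leaves \<open>lam * (norm x)\<^sup>2\<close>, the
  mixed term vanishes with the first moment, and the second moment is constant in \<open>x\<close>.
  So \<open>pot\<close> differs from the true interaction potential by a constant, which the level
  absorbs.\<close>

lemma quadratic_convolution:
  assumes \<rho>: "\<rho> \<in> profiles"
  shows "integrable lborel (\<lambda>z. \<rho> z * (lam * (norm (x - z))\<^sup>2 + V (x - z)))"
    and "(\<integral>z. \<rho> z * (lam * (norm (x - z))\<^sup>2 + V (x - z)) \<partial>lborel)
         = pot \<rho> x + lam * (LBINT z. \<rho> z * (norm z)\<^sup>2)"
proof -
  have c2: "continuous_on UNIV (\<lambda>z. \<rho> z * (norm z)\<^sup>2)"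
    by (intro continuous_intros profilesD[OF \<rho>])
  have i2: "integrable lborel (\<lambda>z. \<rho> z * (norm z)\<^sup>2)"
    by (rule integrable_continuous_bounded_support[OF c2, of R]) (simp add: profilesD[OF \<rho>])
  have i1: "integrable lborel (\<lambda>z. x \<bullet> (\<rho> z *\<^sub>R z))"
    by (intro integrable_inner_right profiles_first_moment(1)[OF \<rho>])
  have iV: "integrable lborel (\<lambda>z. \<rho> z * V (x - z))"
    using profiles_cnv_integrable[OF \<rho> V_integrable V_measurable, of x] by simp
  have V': "(LBINT z. \<rho> z * V (x - z)) = cnv V \<rho> x"
    using cnv_eq[OF V_measurable profilesD(2)[OF \<rho>], of x] by simp
  have eq: "\<rho> z * (lam * (norm (x - z))\<^sup>2 + V (x - z)) = lam * (norm x)\<^sup>2 * \<rho> z - 2 * lam * (x \<bullet> (\<rho> z *\<^sub>R z))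
     + lam * (\<rho> z * (norm z)\<^sup>2) + \<rho> z * V (x - z)" for z
    unfolding power2_norm_eq_inner
    by (simp add: inner_diff_left inner_diff_right inner_commute[of z x] algebra_simps)
  note i0 = profiles_integrable[OF \<rho>]
  show "integrable lborel (\<lambda>z. \<rho> z * (lam * (norm (x - z))\<^sup>2 + V (x - z)))"
    unfolding eq using i0 i1 i2 iV by (intro Bochner_Integration.integrable_add Bochner_Integration.integrable_diff) auto
  have "(LBINT z. x \<bullet> (\<rho> z *\<^sub>R z)) = x \<bullet> (LBINT z. \<rho> z *\<^sub>R z)"
    by (rule integral_inner_right) (use profiles_first_moment[OF \<rho>] in simp)
  then have m1: "(LBINT z. x \<bullet> (\<rho> z *\<^sub>R z)) = 0" using profiles_first_moment[OF \<rho>] by simp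
  have j0: "integrable lborel (\<lambda>z. lam * (norm x)\<^sup>2 * \<rho> z)" using i0 by simp
  have j1: "integrable lborel (\<lambda>z. 2 * lam * (x \<bullet> (\<rho> z *\<^sub>R z)))" using i1 by (intro integrable_mult_right)
  have j2: "integrable lborel (\<lambda>z. lam * (\<rho> z * (norm z)\<^sup>2))" using i2 by (intro integrable_mult_right)
  have "(LBINT z. lam * (norm x)\<^sup>2 * \<rho> z - 2 * lam * (x \<bullet> (\<rho> z *\<^sub>R z)) + lam * (\<rho> z * (norm z)\<^sup>2) + \<rho> z * V (x - z))
     = (LBINT z. lam * (norm x)\<^sup>2 * \<rho> z) - (LBINT z. 2 * lam * (x \<bullet> (\<rho> z *\<^sub>R z)))
       + (LBINT z. lam * (\<rho> z * (norm z)\<^sup>2)) + (LBINT z. \<rho> z * V (x - z))"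
    using j0 j1 j2 iV
    by (simp only: Bochner_Integration.integral_add Bochner_Integration.integral_diff
        Bochner_Integration.integrable_add Bochner_Integration.integrable_diff)
  also have "\<dots> = pot \<rho> x + lam * (LBINT z. \<rho> z * (norm z)\<^sup>2)"
    unfolding integral_mult_right_zero m1 V' profilesD(8)[OF \<rho>] pot_def by simp
  finally show "(\<integral>z. \<rho> z * (lam * (norm (x - z))\<^sup>2 + V (x - z)) \<partial>lborel)
         = pot \<rho> x + lam * (LBINT z. \<rho> z * (norm z)\<^sup>2)" unfolding eq .
qed

text \<open>\<open>V\<close> alone need not be monotone, only its sum with the quadratic part is;
  hence the detour through the full convolution.\<close>

lemma pot_radially_increasing:
  assumes \<rho>: "\<rho> \<in> profiles" and xy: "norm x \<le> norm y"
  shows "pot \<rho> x \<le> pot \<rho> y"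
proof -
  have "(\<integral>z. \<rho> z * (lam * (norm (x - z))\<^sup>2 + V (x - z)) \<partial>lborel)
      \<le> (\<integral>z. \<rho> z * (lam * (norm (y - z))\<^sup>2 + V (y - z)) \<partial>lborel)"
  proof (rule convolution_radially_increasing[where k = "\<lambda>z. lam * (norm z)\<^sup>2 + V z"])
    show "lam * (norm u)\<^sup>2 + V u \<le> lam * (norm v)\<^sup>2 + V v" if "u \<noteq> 0" "norm u \<le> norm v" for u v
    proof -
      have "v \<noteq> 0" using that by auto
      then show ?thesis using mono[of "norm u" "norm v"] that by (simp add: V)
    qed
    show "(\<lambda>z. lam * (norm z)\<^sup>2 + V z) \<in> borel_measurable borel" by measurable
  qed (use profilesD[OF \<rho>] quadratic_convolution(1)[OF \<rho>] xy in auto)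
  then show ?thesis unfolding quadratic_convolution(2)[OF \<rho>] by simp
qed

lemma cnv_V_le:
  assumes "\<rho> \<in> borel_measurable borel" "\<And>y. \<bar>\<rho> y\<bar> \<le> K"
  shows "\<bar>cnv V \<rho> x\<bar> \<le> N * K"
proof -
  have K: "0 \<le> K" using assms(2)[of 0] by linarith
  have "\<bar>cnv V \<rho> x\<bar> \<le> K * (LBINT x. norm (V x))"
    using norm_cnv_le[OF V_integrable assms] by simp
  also have "\<dots> \<le> K * N" using V_norm_le K unfolding N_def by (intro mult_left_mono)
  finally show ?thesis by (simp add: mult.commute)
qed

lemma pot_admissible:
  assumes \<rho>: "\<rho> \<in> profiles" shows "admissible (pot \<rho>)"
proof -
  have "continuous_on UNIV (cnv V \<rho>)"
    by (rule continuous_on_cnv[OF V_integrable profilesD(1,5)[OF \<rho>]])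
  then have "continuous_on UNIV (pot \<rho>)" unfolding pot_def[abs_def] by (intro continuous_intros)
  moreover have "\<bar>pot \<rho> x - lam * (norm x)\<^sup>2\<bar> \<le> \<eta>" for x
    using cnv_V_le[OF profilesD(2,5)[OF \<rho>], of x] by (simp add: pot_def \<eta>_def)
  ultimately show ?thesis by (simp add: admissible_def)
qed

lemma dens_level_in_profiles:
  assumes f: "admissible f" and m: "\<And>x y. norm x \<le> norm y \<Longrightarrow> f x \<le> f y"
  shows "dens f (level f) \<in> profiles"
proof -
  have "dens f (level f) y \<le> dens f (level f) x" if "norm x \<le> norm y" for x y
    unfolding dens_def using c p m[OF that] by (intro mult_left_mono pospow_mono) auto
  then show ?thesis
    using dens_props[OF f level(1)[OF f]] level(2)[OF f] by (simp add: profiles_def)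
qed

text \<open>Formulated on bounded continuous functions to have the complete supremum metric for
  Banach's theorem.\<close>

definition step :: "('a \<Rightarrow>\<^sub>C real) \<Rightarrow> ('a \<Rightarrow>\<^sub>C real)" where
  "step \<rho> = Bcontfun (dens (pot \<rho>) (level (pot \<rho>)))"

lemma apply_Bcontfun_profile: "\<rho> \<in> profiles \<Longrightarrow> apply_bcontfun (Bcontfun \<rho>) = \<rho>"
  by (intro Bcontfun_inverse bcontfun_normI[of _ B]) (auto dest: profilesD)

lemma apply_step:
  assumes "apply_bcontfun \<rho> \<in> profiles"
  shows "apply_bcontfun (step \<rho>) = dens (pot \<rho>) (level (pot \<rho>))" "apply_bcontfun (step \<rho>) \<in> profiles"
  using dens_level_in_profiles[OF pot_admissible[OF assms] pot_radially_increasing[OF assms]]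
  by (simp_all add: step_def apply_Bcontfun_profile)

lemma closed_profiles: "closed {\<rho>. apply_bcontfun \<rho> \<in> profiles}"
  unfolding closed_sequential_limits
proof (intro allI impI, elim conjE)
  fix \<rho> :: "nat \<Rightarrow> 'a \<Rightarrow>\<^sub>C real" and l
  assume \<rho>: "\<forall>n. \<rho> n \<in> {\<rho>. apply_bcontfun \<rho> \<in> profiles}" and lim: "\<rho> \<longlonglongrightarrow> l"
  then have \<rho>: "\<And>n. apply_bcontfun (\<rho> n) \<in> profiles" by simp
  have pt: "(\<lambda>n. \<rho> n x) \<longlonglongrightarrow> l x" for x
  proof (rule metric_tendsto_imp_tendsto[OF lim])
    show "\<forall>\<^sub>F n in sequentially. dist (\<rho> n x) (l x) \<le> dist (\<rho> n) l" by (simp add: dist_bounded)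
  qed
  have "0 \<le> l x" for x by (rule LIMSEQ_le_const[OF pt]) (use profilesD[OF \<rho>] in auto)
  moreover have "l x \<le> B" for x by (rule LIMSEQ_le_const2[OF pt]) (use profilesD[OF \<rho>] in auto)
  moreover have "l y \<le> l x" if "norm x \<le> norm y" for x y
    by (rule LIMSEQ_le[OF pt pt]) (use profilesD(6)[OF \<rho> that] in auto)
  moreover have "l x = 0" if "R \<le> norm x" for x
  proof -
    have "(\<lambda>n. \<rho> n x) = (\<lambda>n. 0)" using profilesD(7)[OF \<rho> that] by auto
    then show ?thesis using pt[of x] LIMSEQ_unique tendsto_const by metis
  qed
  moreover have "(LBINT x. l x) = 1"
  proof -
    have "(\<lambda>n. LBINT x. \<rho> n x) \<longlonglongrightarrow> (LBINT x. l x)"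
    proof (rule integral_dominated_convergence[where w = "\<lambda>x. B * indicator (cball 0 R) x"])
      have "norm (\<rho> n x) \<le> B * indicator (cball 0 R) x" for n x
        using profilesD(5)[OF \<rho>, of n x] profilesD(7)[OF \<rho>, of x n] by (auto simp: indicator_def)
      then show "AE x in lborel. norm (\<rho> n x) \<le> B * indicator (cball 0 R) x" for n by simp
    qed (use pt integrable_bound_cball in \<open>auto intro!: borel_measurable_continuous_onI\<close>)
    then show ?thesis using profilesD(8)[OF \<rho>] by (simp add: LIMSEQ_const_iff)
  qed
  ultimately show "l \<in> {\<rho>. apply_bcontfun \<rho> \<in> profiles}" by (simp add: profiles_def)
qed

lemma step_contraction:
  assumes \<rho>: "apply_bcontfun \<rho> \<in> profiles" and \<rho>': "apply_bcontfun \<rho>' \<in> profiles"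
  shows "dist (step \<rho>) (step \<rho>') \<le> 1 / 2 * dist \<rho> \<rho>'"
proof (rule dist_bound)
  fix x
  have le: "\<bar>pot \<rho> x - pot \<rho>' x\<bar> \<le> N * dist \<rho> \<rho>'" for x
  proof -
    have "pot \<rho> x - pot \<rho>' x = cnv V (\<lambda>y. \<rho> y - \<rho>' y) x"
      using cnv_diff_right[OF V_integrable profilesD(2,5)[OF \<rho>] profilesD(2,5)[OF \<rho>']] by (simp add: pot_def)
    moreover have "\<bar>\<rho> y - \<rho>' y\<bar> \<le> dist \<rho> \<rho>'" for y using dist_bounded[of \<rho> y \<rho>'] by (simp add: dist_real_def)
    ultimately show ?thesis
      using cnv_V_le[of "\<lambda>y. \<rho> y - \<rho>' y" "dist \<rho> \<rho>'" x] profilesD(2)[OF \<rho>] profilesD(2)[OF \<rho>'] by simp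
  qed
  have "dist (step \<rho> x) (step \<rho>' x) \<le> c * (p * (2 * A) powr (p - 1)) * (2 * (N * dist \<rho> \<rho>'))"
    using dens_level_lipschitz[OF pot_admissible[OF \<rho>] pot_admissible[OF \<rho>'] le]
    by (simp add: apply_step(1)[OF \<rho>] apply_step(1)[OF \<rho>'] dist_real_def)
  \<comment> \<open>Of the factor 4, one 2 comes from the simultaneous shift of potential and level,
    the other pays for the contraction factor 1/2.\<close>
  also have "\<dots> = (4 * c * p * (2 * A) powr (p - 1) * N) * (1 / 2 * dist \<rho> \<rho>')" by simp
  also have "\<dots> \<le> 1 * (1 / 2 * dist \<rho> \<rho>')"
    using contr unfolding N_def[symmetric] by (intro mult_right_mono) auto
  finally show "dist (step \<rho> x) (step \<rho>' x) \<le> 1 / 2 * dist \<rho> \<rho>'" by simp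
qed

lemma fixed_point_exists:
  obtains \<rho> C where "\<rho> \<in> profiles" "\<And>x. \<rho> x = c * pospow p (C - (lam * (norm x)\<^sup>2 + cnv V \<rho> x))"
proof -
  have ad0: "admissible (\<lambda>x. lam * (norm x)\<^sup>2)"
    unfolding admissible_def using \<eta> by (auto intro!: continuous_intros)
  \<comment> \<open>The Barenblatt-type profile of the pure quadratic potential shows that the
    invariant set is nonempty.\<close>
  have "dens (\<lambda>x. lam * (norm x)\<^sup>2) (level (\<lambda>x. lam * (norm x)\<^sup>2)) \<in> profiles"
    by (rule dens_level_in_profiles[OF ad0]) (use lam_pos in \<open>auto intro!: mult_left_mono power_mono\<close>)
  then have ne: "{\<rho>. apply_bcontfun \<rho> \<in> profiles} \<noteq> {}"
    by (metis (mono_tags) apply_Bcontfun_profile mem_Collect_eq empty_iff)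
  have "\<exists>!\<rho>\<in>{\<rho>. apply_bcontfun \<rho> \<in> profiles}. step \<rho> = \<rho>"
    by (rule Banach_fix[where c = "1/2"])
       (use ne closed_profiles apply_step step_contraction in \<open>auto simp: complete_eq_closed\<close>)
  then obtain \<rho> where \<rho>: "apply_bcontfun \<rho> \<in> profiles" "step \<rho> = \<rho>" by blast
  have "\<rho> x = c * pospow p (level (pot \<rho>) - (lam * (norm x)\<^sup>2 + cnv V \<rho> x))" for x
    using apply_step(1)[OF \<rho>(1)] unfolding \<rho>(2) dens_def pot_def by metis
  then show ?thesis using that \<rho>(1) by blast
qed

end

section \<open>From the fixed point to a steady state\<close>

lemma grad_radial_pot:
  fixes z :: "'a::euclidean_space"
  assumes "(w has_real_derivative d) (at (norm z))" "z \<noteq> 0"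
  shows "grad (radial_pot w) z = (d / norm z) *\<^sub>R z"
proof (rule grad_eqI)
  have "(norm has_derivative (\<lambda>h. h \<bullet> sgn z)) (at z)"
    using has_derivative_norm[OF assms(2)] by (simp add: inner_commute)
  from DERIV_compose_FDERIV[OF assms(1) this]
  have "((\<lambda>x. w (norm x)) has_derivative (\<lambda>h. (h \<bullet> sgn z) * d)) (at z)" .
  moreover have "(\<lambda>h. (h \<bullet> sgn z) * d) = (\<lambda>h. ((d / norm z) *\<^sub>R z) \<bullet> h)"
    by (auto simp: sgn_div_norm inner_commute field_simps)
  moreover have "radial_pot w = (\<lambda>x::'a. w (norm x))" by (auto simp: radial_pot_def)
  ultimately show "(radial_pot w has_derivative (\<lambda>h. ((d / norm z) *\<^sub>R z) \<bullet> h)) (at z)" by metis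
qed

lemma L2_loc_continuous:
  fixes f :: "'a::euclidean_space \<Rightarrow> 'b::euclidean_space"
  assumes "continuous_on UNIV f"
  shows "L2_loc f"
  unfolding L2_loc_def
proof
  show "f \<in> borel_measurable lebesgue"
    using borel_measurable_continuous_onI[OF assms] by (simp add: measurable_completion)
  show "loc_integrable (\<lambda>x. (norm (f x))\<^sup>2)"
    by (intro loc_integrable_continuous continuous_intros assms)
qed

text \<open>The Lipschitz bound serves distances up to 1, boundedness the larger ones.\<close>

lemma holder_of_lipschitz_bounded:
  fixes f :: "'a::euclidean_space \<Rightarrow> real"
  assumes lip: "\<And>x y. \<bar>f x - f y\<bar> \<le> M * norm (x - y)" and bd: "\<And>x y. \<bar>f x - f y\<bar> \<le> B"
    and \<alpha>: "0 < \<alpha>" "\<alpha> < 1" and M: "0 \<le> M"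
  shows "holder \<alpha> f"
  unfolding holder_def
proof (intro exI allI)
  fix x y :: 'a
  have B: "0 \<le> B" using bd[of x y] by linarith
  consider "x = y" | "x \<noteq> y" "dist x y \<le> 1" | "dist x y \<ge> 1" by fastforce
  then show "\<bar>f x - f y\<bar> \<le> (M + B) * dist x y powr \<alpha>"
  proof cases
    case 2
    have "dist x y powr 1 \<le> dist x y powr \<alpha>" using 2 \<alpha> by (intro powr_mono') auto
    then have "M * dist x y \<le> M * dist x y powr \<alpha>" using 2 M by (intro mult_left_mono) auto
    moreover have "0 \<le> B * dist x y powr \<alpha>" using B by simp
    ultimately show ?thesis using lip[of x y] by (simp add: dist_norm algebra_simps)
  next
    case 3
    have "1 \<le> dist x y powr \<alpha>" using 3 \<alpha> ge_one_powr_ge_zero by simp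
    then have "B * 1 \<le> B * dist x y powr \<alpha>" using B by (intro mult_left_mono) auto
    moreover have "0 \<le> M * dist x y powr \<alpha>" using M by simp
    ultimately show ?thesis using bd[of x y] by (simp add: algebra_simps)
  qed simp
qed

text \<open>The values of \<open>p\<close> and \<open>c\<close> turn the fixed point equation into
  the Euler-Lagrange relation
  \<open>(m / (m - 1)) * \<rho> powr (m - 1) = max 0 (C - pot \<rho>)\<close>. Distances within the
  ball of radius \<open>R\<close> stay below \<open>2 * R\<close>, whence the range of
  \<open>near\<close>; \<open>far\<close> controls the gradient convolution at all other
  points.\<close>

locale flat_steady = flat_state \<nu> \<nu>' a D V G p c A lam R
  for \<nu> \<nu>' :: "real \<Rightarrow> real" and a D :: real and V :: "'a::euclidean_space \<Rightarrow> real" and G :: "'a \<Rightarrow> 'a"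
    and p c A lam R :: real +
  fixes m K C :: real and w w' :: "real \<Rightarrow> real" and \<rho> :: "'a \<Rightarrow> real"
  assumes m: "1 < m" "m < 2" and pm: "p = 1 / (m - 1)" and cm: "c = ((m - 1) / m) powr p"
    and w: "\<And>r. 0 < r \<Longrightarrow> (w has_real_derivative w' r) (at r)" and w'_cont: "continuous_on {0<..} w'"
    and near: "\<And>r. 0 < r \<Longrightarrow> r < 2 * R \<Longrightarrow> w' r = 2 * lam * r + \<nu>' r" and aR: "a \<le> 2 * R"
    and far: "\<And>r. a \<le> r \<Longrightarrow> \<bar>w' r\<bar> \<le> K"
    and \<rho>: "\<rho> \<in> profiles"
    and fixpt: "\<And>x. \<rho> x = c * pospow p (C - (lam * (norm x)\<^sup>2 + cnv V \<rho> x))"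
begin

definition u where "u x = C - (lam * (norm x)\<^sup>2 + cnv V \<rho> x)"
definition gu where "gu x = - ((2 * lam) *\<^sub>R x + cnv G \<rho> x)"
definition g\<rho> where "g\<rho> x = (c * (p * pospow (p - 1) (u x))) *\<^sub>R gu x"

lemma \<rho>_eq: "\<rho> x = c * pospow p (u x)"
  unfolding u_def by (rule fixpt)

lemma u_has_derivative: "has_grad u (gu x) x"
proof -
  have "has_grad (cnv V \<rho>) (cnv G \<rho> x) x"
    by (rule cnv_has_derivative[OF profilesD(1)[OF \<rho>] profilesD(7)[OF \<rho>]])
  moreover have "((\<lambda>x::'a. lam * (x \<bullet> x)) has_derivative (\<lambda>h. lam * (2 * (x \<bullet> h)))) (at x)"
    by (auto intro!: derivative_eq_intros simp: inner_commute)
  ultimately have "((\<lambda>x. C - (lam * (x \<bullet> x) + cnv V \<rho> x)) has_derivative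
      (\<lambda>h. 0 - (lam * (2 * (x \<bullet> h)) + cnv G \<rho> x \<bullet> h))) (at x)"
    by (intro has_derivative_diff has_derivative_add has_derivative_const)
  moreover have "u = (\<lambda>x. C - (lam * (x \<bullet> x) + cnv V \<rho> x))"
    by (auto simp: u_def power2_norm_eq_inner)
  moreover have "(\<lambda>h. 0 - (lam * (2 * (x \<bullet> h)) + cnv G \<rho> x \<bullet> h)) = (\<lambda>h. gu x \<bullet> h)"
    by (auto simp: gu_def inner_diff_left inner_add_left)
  ultimately show ?thesis by metis
qed

lemma continuous_on_u: "continuous_on UNIV u"
  by (rule has_grad_imp_continuous_on) (rule u_has_derivative)

lemma continuous_on_gu: "continuous_on UNIV gu"
  unfolding gu_def[abs_def]
  by (intro continuous_intros continuous_on_cnv[OF G_integrable profilesD(1)[OF \<rho>] profilesD(5)[OF \<rho>]])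

lemma pospow_u_has_derivative:
  assumes "1 < q"
  shows "((\<lambda>x. b * pospow q (u x)) has_derivative (\<lambda>h. ((b * (q * pospow (q - 1) (u x))) *\<^sub>R gu x) \<bullet> h)) (at x)"
proof -
  have "((\<lambda>x. pospow q (u x)) has_derivative (\<lambda>h. (gu x \<bullet> h) * (q * pospow (q - 1) (u x)))) (at x)"
    by (rule DERIV_compose_FDERIV[OF pospow_has_derivative[OF assms] u_has_derivative])
  from has_derivative_mult_right[OF this, of b] show ?thesis by (simp add: mult_ac)
qed

lemma \<rho>_has_derivative: "has_grad \<rho> (g\<rho> x) x"
proof -
  have "\<rho> = (\<lambda>x. c * pospow p (u x))" using \<rho>_eq by blast
  then show ?thesis using pospow_u_has_derivative[OF p, of c x] unfolding g\<rho>_def by metis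
qed

lemma continuous_on_g\<rho>: "continuous_on UNIV g\<rho>"
  unfolding g\<rho>_def[abs_def] using p
  by (intro continuous_intros continuous_on_gu continuous_on_compose2[OF continuous_on_pospow continuous_on_u]) auto

lemma g\<rho>_eq_0: "R \<le> norm x \<Longrightarrow> g\<rho> x = 0"
proof -
  assume "R \<le> norm x"
  then have "pospow p (u x) = 0" using profilesD(7)[OF \<rho>] \<rho>_eq[of x] c by simp
  then have "u x \<le> 0" by (simp add: pospow_def max_def split: if_splits)
  then show ?thesis by (simp add: g\<rho>_def pospow_eq_0)
qed

lemma \<rho>_powr_m: "\<rho> x powr m = c powr m * pospow (p + 1) (u x)"
proof -
  have "p * m = p + 1" using m by (simp add: pm field_simps)
  then show ?thesis unfolding \<rho>_eq[of x] using c by (simp add: powr_mult pospow_def powr_powr)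
qed

text \<open>The normalisation behind the value of \<open>c\<close>: by the chain rule the gradient
  of \<open>\<rho> powr m\<close> is \<open>c powr m * (p + 1)\<close> times
  \<open>pospow p (u x)\<close> times the gradient of \<open>u\<close>, and this has to be
  \<open>\<rho>\<close> times the gradient of \<open>u\<close>.\<close>

lemma c_powr_m: "c powr m * (p + 1) = c"
proof -
  have "c powr m = c powr 1 * c powr (m - 1)" unfolding powr_add[symmetric] by simp
  moreover have "c powr (m - 1) = (m - 1) / m" using m by (simp add: cm pm powr_powr)
  moreover have "p + 1 = m / (m - 1)" using m by (simp add: pm field_simps)
  ultimately show ?thesis using m c by simp
qed

lemma \<rho>_powr_has_derivative: "has_grad (\<lambda>x. \<rho> x powr m) (\<rho> x *\<^sub>R gu x) x"
proof -
  have "(c powr m * ((p + 1) * pospow (p + 1 - 1) (u x))) = \<rho> x"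
    unfolding mult.assoc[symmetric] c_powr_m \<rho>_eq[of x] by simp
  moreover have "(\<lambda>x. \<rho> x powr m) = (\<lambda>x. c powr m * pospow (p + 1) (u x))" using \<rho>_powr_m by blast
  ultimately show ?thesis using pospow_u_has_derivative[of "p + 1" "c powr m" x] p by (metis less_add_same_cancel2 less_trans zero_less_one)
qed

lemma continuous_on_flux: "continuous_on UNIV (\<lambda>x. \<rho> x *\<^sub>R gu x)"
  by (intro continuous_intros profilesD(1)[OF \<rho>] continuous_on_gu)

lemma weak_gradient_\<rho>_powr: "weak_gradient (\<lambda>x. \<rho> x powr m) (\<lambda>x. \<rho> x *\<^sub>R gu x)"
  by (rule weak_gradient_C1[OF \<rho>_powr_has_derivative continuous_on_flux])

text \<open>The kernel \<open>V\<close> need not be twice weakly differentiable, so the second derivative of \<open>V * \<rho>\<close> is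
  obtained by letting one derivative fall on \<open>\<rho>\<close>.\<close>

lemma H1_loc_flux: "H1_loc (\<lambda>x. \<rho> x *\<^sub>R gu x)"
  unfolding H1_loc_def
proof (intro conjI ballI L2_loc_continuous continuous_on_flux)
  fix b :: 'a
  define q where "q = (\<lambda>y. g\<rho> y \<bullet> b)"
  have q: "continuous_on UNIV q" unfolding q_def by (intro continuous_intros continuous_on_g\<rho>)
  have q0: "R \<le> norm x \<Longrightarrow> q x = 0" for x by (simp add: q_def g\<rho>_eq_0)
  obtain Mq where Mq: "\<And>x. \<bar>q x\<bar> \<le> Mq"
    using continuous_bounded_support_bounded[OF q q0] by (metis real_norm_def)
  \<comment> \<open>The component of the convolution is again a convolution of \<open>V\<close>, now
    with the continuous, compactly supported \<open>q\<close>, so it can be differentiated once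
    more.\<close>
  have gub: "gu x \<bullet> b = - (2 * lam * (x \<bullet> b) + cnv V q x)" for x
    using cnv_directional_derivative[OF V_integrable \<rho>_has_derivative continuous_on_g\<rho> profilesD(7)[OF \<rho>] g\<rho>_eq_0
        cnv_has_derivative[OF profilesD(1)[OF \<rho>] profilesD(7)[OF \<rho>], where x = x], where b = b]
    by (simp add: gu_def q_def inner_diff_left inner_add_left)
  define H where "H x = \<rho> x *\<^sub>R (- ((2 * lam) *\<^sub>R b + cnv G q x)) + (gu x \<bullet> b) *\<^sub>R g\<rho> x" for x
  have "has_grad (\<lambda>x. (\<rho> x *\<^sub>R gu x) \<bullet> b) (H x) x" for x
  proof -
    have "((\<lambda>x. - (2 * lam * (x \<bullet> b) + cnv V q x)) has_derivative
        (\<lambda>h. - (2 * lam * (h \<bullet> b) + cnv G q x \<bullet> h))) (at x)"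
      by (intro has_derivative_minus has_derivative_add has_derivative_mult_right
            has_derivative_inner_left has_derivative_ident cnv_has_derivative[OF q q0])
    from has_derivative_mult[OF \<rho>_has_derivative[of x] this]
    have "((\<lambda>x. \<rho> x * (gu x \<bullet> b)) has_derivative
        (\<lambda>h. \<rho> x * (- (2 * lam * (h \<bullet> b) + cnv G q x \<bullet> h)) + (g\<rho> x \<bullet> h) * (gu x \<bullet> b))) (at x)"
      unfolding gub .
    moreover have "(\<lambda>h. \<rho> x * (- (2 * lam * (h \<bullet> b) + cnv G q x \<bullet> h)) + (g\<rho> x \<bullet> h) * (gu x \<bullet> b)) = (\<lambda>h. H x \<bullet> h)"
      by (auto simp: H_def inner_add_left inner_diff_left inner_commute[of _ b] algebra_simps)
    ultimately show ?thesis by simp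
  qed
  moreover have cH: "continuous_on UNIV H" unfolding H_def[abs_def]
    by (intro continuous_intros profilesD(1)[OF \<rho>] continuous_on_gu continuous_on_g\<rho>
         continuous_on_cnv[OF G_integrable q Mq])
  ultimately show "\<exists>H. weak_gradient (\<lambda>x. (\<rho> x *\<^sub>R gu x) \<bullet> b) H \<and> L2_loc H"
    using weak_gradient_C1 L2_loc_continuous by blast
qed

section \<open>Convolution with the gradient of the full potential\<close>

definition gk :: "'a \<Rightarrow> 'a" where "gk = grad (radial_pot w)"

lemma gk_eq: "z \<noteq> 0 \<Longrightarrow> gk z = (w' (norm z) / norm z) *\<^sub>R z"
  unfolding gk_def by (rule grad_radial_pot[OF w]) auto

lemma gk_measurable [measurable]: "gk \<in> borel_measurable borel"
proof -
  have "continuous_on (- {0}) (\<lambda>z::'a. (w' (norm z) / norm z) *\<^sub>R z)"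
    by (intro continuous_intros continuous_on_compose2[OF w'_cont]) auto
  then have [measurable]: "(\<lambda>z::'a. indicator (- {0}) z *\<^sub>R ((w' (norm z) / norm z) *\<^sub>R z)) \<in> borel_measurable borel"
    by (intro borel_measurable_continuous_on_indicator) auto
  \<comment> \<open>At the origin \<open>grad\<close> takes whatever value
    \<open>frechet_derivative\<close> yields there; it is kept as an unknown constant.\<close>
  have "gk = (\<lambda>z. if z = 0 then gk 0 else indicator (- {0}) z *\<^sub>R ((w' (norm z) / norm z) *\<^sub>R z))"
    by (auto simp: gk_eq)
  also have "\<dots> \<in> borel_measurable borel" by measurable
  finally show ?thesis .
qed

lemma gk_le: "z \<noteq> 0 \<Longrightarrow> norm (gk z) \<le> (\<bar>K\<bar> + 2 * lam * a) + D * rkernel a z"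
proof -
  assume z: "z \<noteq> 0"
  have n: "norm (gk z) = \<bar>w' (norm z)\<bar>" using z by (simp add: gk_eq)
  show ?thesis
  proof (cases "norm z < a")
    case True
    then have "w' (norm z) = 2 * lam * norm z + \<nu>' (norm z)" using near[of "norm z"] z aR by auto
    moreover have "lam * norm z \<le> lam * a" using True lam_pos by simp
    moreover have "0 \<le> lam * norm z" using lam_pos by simp
    moreover have "\<bar>\<nu>' (norm z)\<bar> \<le> D * rkernel a z" by (rule profile_le_rkernel[OF z order_refl bound' supp'])
    ultimately show ?thesis unfolding n by linarith
  next
    case False
    then have "\<bar>w' (norm z)\<bar> \<le> K" using far by simp
    moreover have "0 \<le> 2 * lam * a" using lam_pos a by simp
    moreover have "0 \<le> D * rkernel a z" by (rule mult_nonneg_nonneg[OF D rkernel_nonneg])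
    ultimately show ?thesis unfolding n by linarith
  qed
qed

lemma ae_shift: "AE y in lborel. P y" if "\<And>y. y \<noteq> x \<Longrightarrow> P y" for P and x :: 'a
  using AE_lborel_singleton[of x] by eventually_elim (rule that)

text \<open>Integrate \<open>gk_le\<close> against \<open>\<rho>\<close>: the constant part meets
  mass 1, the singular part a density below \<open>B\<close>. The resulting bound is uniform in
  \<open>x\<close>, whence the local integrability of \<open>grad_conv\<close>.\<close>

lemma integrable_gk: "integrable lborel (\<lambda>y. \<rho> y *\<^sub>R gk (x - y))"
  and norm_integral_gk_le: "norm (LBINT y. \<rho> y *\<^sub>R gk (x - y))
      \<le> (\<bar>K\<bar> + 2 * lam * a) + D * (B * rmass TYPE('a) a)"
proof -
  let ?K = "\<bar>K\<bar> + 2 * lam * a"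
  define h where "h y = ?K * \<rho> y + D * (\<rho> y *\<^sub>R rkernel a (x - y))" for y
  note [measurable] = profilesD(2)[OF \<rho>]
  have i1: "integrable lborel (\<lambda>y. ?K * \<rho> y)" using profiles_integrable[OF \<rho>] by simp
  have i2: "integrable lborel (\<lambda>y. D * (\<rho> y *\<^sub>R rkernel a (x - y)))"
    using profiles_cnv_integrable[OF \<rho> rkernel_integrable rkernel_measurable, of a x]
    by (intro integrable_mult_right)
  have ih: "integrable lborel h" unfolding h_def using i1 i2 by (rule Bochner_Integration.integrable_add)
  have le: "AE y in lborel. norm (\<rho> y *\<^sub>R gk (x - y)) \<le> h y"
  proof (rule ae_shift[of x])
    fix y assume "y \<noteq> x"
    then have "norm (gk (x - y)) \<le> ?K + D * rkernel a (x - y)" by (intro gk_le) auto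
    then have "\<rho> y * norm (gk (x - y)) \<le> \<rho> y * (?K + D * rkernel a (x - y))"
      using profilesD(3)[OF \<rho>] by (intro mult_left_mono)
    then show "norm (\<rho> y *\<^sub>R gk (x - y)) \<le> h y"
      using profilesD(3)[OF \<rho>, of y] by (simp add: h_def algebra_simps)
  qed
  show int: "integrable lborel (\<lambda>y. \<rho> y *\<^sub>R gk (x - y))"
  proof (rule Bochner_Integration.integrable_bound[OF ih])
    show "AE y in lborel. norm (\<rho> y *\<^sub>R gk (x - y)) \<le> norm (h y)"
      using le by eventually_elim simp
  qed measurable
  have "norm (LBINT y. \<rho> y *\<^sub>R gk (x - y)) \<le> (LBINT y. norm (\<rho> y *\<^sub>R gk (x - y)))"
    by (rule integral_norm_bound)
  also have "\<dots> \<le> (LBINT y. h y)"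
    by (rule integral_mono_AE[OF integrable_norm[OF int] ih le])
  also have "\<dots> = ?K * (LBINT y. \<rho> y) + D * (LBINT y. \<rho> y *\<^sub>R rkernel a (x - y))"
    unfolding h_def Bochner_Integration.integral_add[OF i1 i2] integral_mult_right_zero ..
  also have "\<dots> = ?K + D * cnv (rkernel a) \<rho> x"
    unfolding cnv_eq[OF rkernel_measurable profilesD(2)[OF \<rho>]] profilesD(8)[OF \<rho>] by simp
  also have "\<dots> \<le> ?K + D * (B * rmass TYPE('a) a)"
    using norm_cnv_le[OF rkernel_integrable profilesD(2)[OF \<rho>] profilesD(5)[OF \<rho>], of a x] D
    by (intro add_left_mono mult_left_mono) (auto simp: rkernel_nonneg)
  finally show "norm (LBINT y. \<rho> y *\<^sub>R gk (x - y)) \<le> ?K + D * (B * rmass TYPE('a) a)" .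
qed

lemma grad_conv_eq: "grad_conv w \<rho> x = (LBINT y. \<rho> y *\<^sub>R gk (x - y))"
proof -
  note [measurable] = profilesD(2)[OF \<rho>]
  show ?thesis unfolding grad_conv_def gk_def[symmetric] by (rule integral_completion) measurable
qed

text \<open>Only distances below \<open>2 * R\<close> occur, where the gradient of the potential is
  a linear field plus \<open>G\<close>. The linear field convolves to its value at \<open>x\<close>,
  because the mass is 1 and the first moment vanishes.\<close>

lemma grad_conv_inside:
  assumes x: "norm x < R"
  shows "grad_conv w \<rho> x = - gu x"
proof -
  note [measurable] = profilesD(2)[OF \<rho>]
  have "grad_conv w \<rho> x = (LBINT y. \<rho> y *\<^sub>R ((2 * lam) *\<^sub>R (x - y) + G (x - y)))"
    unfolding grad_conv_eq
  proof (rule integral_cong_AE)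
    show "AE y in lborel. \<rho> y *\<^sub>R gk (x - y) = \<rho> y *\<^sub>R ((2 * lam) *\<^sub>R (x - y) + G (x - y))"
    proof (rule ae_shift[of x])
      fix y assume y: "y \<noteq> x"
      show "\<rho> y *\<^sub>R gk (x - y) = \<rho> y *\<^sub>R ((2 * lam) *\<^sub>R (x - y) + G (x - y))"
      proof (cases "norm y < R")
        case True
        then have "norm (x - y) < 2 * R" using x norm_triangle_ineq4[of x y] by linarith
        then have "w' (norm (x - y)) = 2 * lam * norm (x - y) + \<nu>' (norm (x - y))"
          using near[of "norm (x - y)"] y by simp
        then have "gk (x - y) = (2 * lam) *\<^sub>R (x - y) + G (x - y)"
          using y by (simp add: gk_eq G add_divide_distrib scaleR_add_left)
        then show ?thesis by simp
      qed (use profilesD(7)[OF \<rho>, of y] in simp)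
    qed
  qed measurable
  also have "\<dots> = (LBINT y. \<rho> y *\<^sub>R ((2 * lam) *\<^sub>R x) - (2 * lam) *\<^sub>R (\<rho> y *\<^sub>R y) + \<rho> y *\<^sub>R G (x - y))"
    by (intro Bochner_Integration.integral_cong) (auto simp: scaleR_diff_right scaleR_add_right mult.commute)
  also have "\<dots> = (LBINT y. \<rho> y *\<^sub>R ((2 * lam) *\<^sub>R x)) - (LBINT y. (2 * lam) *\<^sub>R (\<rho> y *\<^sub>R y))
      + (LBINT y. \<rho> y *\<^sub>R G (x - y))"
  proof -
    have j1: "integrable lborel (\<lambda>y. \<rho> y *\<^sub>R ((2 * lam) *\<^sub>R x))"
      by (intro integrable_scaleR_left profiles_integrable[OF \<rho>])
    have j2: "integrable lborel (\<lambda>y. (2 * lam) *\<^sub>R (\<rho> y *\<^sub>R y))"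
      by (intro integrable_scaleR_right profiles_first_moment(1)[OF \<rho>])
    have j3: "integrable lborel (\<lambda>y. \<rho> y *\<^sub>R G (x - y))"
      by (rule profiles_cnv_integrable[OF \<rho> G_integrable G_measurable])
    show ?thesis
      by (subst Bochner_Integration.integral_add[OF Bochner_Integration.integrable_diff[OF j1 j2] j3])
         (subst Bochner_Integration.integral_diff[OF j1 j2], rule refl)
  qed
  also have "(LBINT y. \<rho> y *\<^sub>R ((2 * lam) *\<^sub>R x)) = (2 * lam) *\<^sub>R x"
    using profiles_integrable[OF \<rho>] profilesD(8)[OF \<rho>] by (subst integral_scaleR_left) auto
  also have "(LBINT y. (2 * lam) *\<^sub>R (\<rho> y *\<^sub>R y)) = 0"
    using profiles_first_moment[OF \<rho>] by (subst integral_scaleR_right) auto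
  also have "(LBINT y. \<rho> y *\<^sub>R G (x - y)) = cnv G \<rho> x"
    by (rule cnv_eq[OF G_measurable profilesD(2)[OF \<rho>], symmetric])
  finally show ?thesis by (simp add: gu_def)
qed

lemma loc_integrable_grad_conv: "loc_integrable (grad_conv w \<rho>)"
  unfolding loc_integrable_def
proof (intro allI impI)
  fix S :: "'a set" assume S: "compact S"
  note [measurable] = profilesD(2)[OF \<rho>]
  let ?M = "(\<bar>K\<bar> + 2 * lam * a) + D * (B * rmass TYPE('a) a)"
  have "(\<lambda>x. LBINT y. \<rho> y *\<^sub>R gk (x - y)) \<in> borel_measurable borel"
    by (rule lborel.borel_measurable_lebesgue_integral) measurable
  then have gm: "grad_conv w \<rho> \<in> borel_measurable borel" by (simp add: grad_conv_eq[abs_def])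
  have Sm: "S \<in> sets borel" using S by (simp add: borel_compact)
  have "integrable lborel (\<lambda>x. indicator S x *\<^sub>R grad_conv w \<rho> x)"
  proof (rule Bochner_Integration.integrable_bound)
    show "integrable lborel (\<lambda>x. ?M * indicator S x)"
      using Sm emeasure_bounded_finite[OF compact_imp_bounded[OF S]]
      by (intro integrable_mult_right integrable_real_indicator) auto
    show "AE x in lborel. norm (indicator S x *\<^sub>R grad_conv w \<rho> x) \<le> norm (?M * indicator S x)"
    proof (rule AE_I2)
      fix x
      have "norm (grad_conv w \<rho> x) \<le> ?M" unfolding grad_conv_eq by (rule norm_integral_gk_le)
      then have "norm (grad_conv w \<rho> x) \<le> \<bar>?M\<bar>" by linarith
      then show "norm (indicator S x *\<^sub>R grad_conv w \<rho> x) \<le> norm (?M * indicator S x)"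
        by (cases "x \<in> S") auto
    qed
    show "(\<lambda>x. indicator S x *\<^sub>R grad_conv w \<rho> x) \<in> borel_measurable lborel"
      using gm Sm by (intro borel_measurable_scaleR borel_measurable_indicator) auto
  qed
  then show "set_integrable lebesgue S (grad_conv w \<rho>)"
    unfolding set_integrable_def by (subst integrable_completion) auto
qed

lemma steady_state_\<rho>: "steady_state m w \<rho>"
  unfolding steady_state_def
proof (intro conjI allI impI)
  have \<rho>m: "\<rho> \<in> borel_measurable lborel" using profilesD(2)[OF \<rho>] by simp
  show "prob_density \<rho>"
    unfolding prob_density_def using profilesD(3,8)[OF \<rho>] profiles_integrable[OF \<rho>]
      integrable_completion[OF \<rho>m] integral_completion[OF \<rho>m] by auto
  show "Linf \<rho>" unfolding Linf_def
    using measurable_completion[OF \<rho>m] profilesD(5)[OF \<rho>] by (auto intro!: exI[of _ B])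
  show "\<exists>G. weak_gradient (\<lambda>x. \<rho> x powr m) G \<and> H1_loc G"
    using weak_gradient_\<rho>_powr H1_loc_flux by blast
  show "AE x in lebesgue. integrable lebesgue (\<lambda>y. \<rho> y *\<^sub>R grad (radial_pot w) (x - y))"
  proof (rule AE_I2)
    fix x
    note [measurable] = profilesD(2)[OF \<rho>]
    show "integrable lebesgue (\<lambda>y. \<rho> y *\<^sub>R grad (radial_pot w) (x - y))"
      unfolding gk_def[symmetric] using integrable_gk by (subst integrable_completion) auto
  qed
  show "loc_integrable (grad_conv w \<rho>)" by (rule loc_integrable_grad_conv)
next
  fix \<phi> :: "'a \<Rightarrow> real" assume \<phi>: "test_function \<phi>"
  have "(\<integral>x. \<rho> x powr m *\<^sub>R grad \<phi> x \<partial>lebesgue) = - (\<integral>x. \<phi> x *\<^sub>R (\<rho> x *\<^sub>R gu x) \<partial>lebesgue)"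
    using weak_gradient_\<rho>_powr \<phi> unfolding weak_gradient_def by blast
  also have "\<dots> = (\<integral>x. - (\<phi> x *\<^sub>R (\<rho> x *\<^sub>R gu x)) \<partial>lebesgue)" by simp
  \<comment> \<open>Off the ball of radius \<open>R\<close> both integrands vanish with
    \<open>\<rho>\<close>, so the formula for \<open>grad_conv\<close> inside the ball
    suffices.\<close>
  also have "\<dots> = (\<integral>x. (\<rho> x * \<phi> x) *\<^sub>R grad_conv w \<rho> x \<partial>lebesgue)"
  proof (rule Bochner_Integration.integral_cong[OF refl])
    fix x
    show "- (\<phi> x *\<^sub>R (\<rho> x *\<^sub>R gu x)) = (\<rho> x * \<phi> x) *\<^sub>R grad_conv w \<rho> x"
      using grad_conv_inside[of x] profilesD(7)[OF \<rho>, of x] by (cases "norm x < R") (auto simp: mult.commute)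
  qed
  finally show "(\<integral>x. \<rho> x powr m *\<^sub>R grad \<phi> x \<partial>lebesgue) = (\<integral>x. (\<rho> x * \<phi> x) *\<^sub>R grad_conv w \<rho> x \<partial>lebesgue)" .
next
  fix k assume k: "W2 TYPE('a) w k \<and> k < 1 - real DIM('a)"
  \<comment> \<open>The midpoint of the admissible interval, which is nonempty as k > -n and has a
    positive left end as k < 1 - n.\<close>
  define \<alpha> where "\<alpha> = ((1 - k - real DIM('a)) + 1) / 2"
  have k': "- real DIM('a) < k" using k by (simp add: W2_def)
  have \<alpha>: "1 - k - real DIM('a) < \<alpha>" "\<alpha> < 1" "0 < \<alpha>" using k k' unfolding \<alpha>_def by auto
  obtain M where M: "0 \<le> M" "\<And>x. norm (g\<rho> x) \<le> M"
    using continuous_bounded_support_bounded[OF continuous_on_g\<rho> g\<rho>_eq_0] by blast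
  have "holder \<alpha> \<rho>"
  proof (rule holder_of_lipschitz_bounded[OF gradient_bound_imp_lipschitz[OF \<rho>_has_derivative M(2)]])
    show "\<bar>\<rho> x - \<rho> y\<bar> \<le> B" for x y
      using profilesD(3,4)[OF \<rho>, of x] profilesD(3,4)[OF \<rho>, of y] by linarith
  qed (use \<alpha> M in auto)
  then show "\<exists>\<alpha>>1 - k - real DIM('a). \<alpha> < 1 \<and> holder \<alpha> \<rho>" using \<alpha> by blast
next
  have "continuous_on {0<..} w" using w by (meson DERIV_isCont continuous_at_imp_continuous_on greaterThan_iff)
  then have "continuous_on UNIV (\<lambda>x::'a. w (1 + norm x))"
    by (rule continuous_on_compose2) (auto intro!: continuous_intros add_pos_nonneg)
  then have cont: "continuous_on UNIV (\<lambda>x. \<rho> x * w (1 + norm x))"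
    by (intro continuous_intros profilesD(1)[OF \<rho>])
  have "integrable lborel (\<lambda>x. \<rho> x * w (1 + norm x))"
    by (rule integrable_continuous_bounded_support[OF cont, of R]) (simp add: profilesD(7)[OF \<rho>])
  then show "integrable lebesgue (\<lambda>x. \<rho> x * w (1 + norm x))"
    using borel_measurable_continuous_onI[OF cont] by (subst integrable_completion) auto
qed

lemma radially_decreasing_\<rho>: "radially_decreasing \<rho>"
  unfolding radially_decreasing_def using profilesD(6)[OF \<rho>] by (metis order_antisym order_refl)

end

section \<open>Choice of the scale\<close>

text \<open>The perturbation is of order \<open>A powr p\<close>, to be beaten by \<open>A\<close>.
  As p > 1, that is m < 2, \<open>(2 * A) powr (p - 1)\<close> can be pushed below any positive
  \<open>y\<close>, and every demand reduces to such a bound together with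
  \<open>2 * A \<le> 1\<close>.\<close>

lemma amplitude_exists:
  fixes N c p \<delta> :: real
  assumes "0 \<le> N" "0 < c" "1 < p" "0 < \<delta>"
  obtains A where "0 < A" "c * (2 * A) powr p \<le> \<delta>" "2 * N * (c * (2 * A) powr p) \<le> A"
    "4 * c * p * (2 * A) powr (p - 1) * N \<le> 1"
proof -
  \<comment> \<open>The first entry limits the height by \<open>\<delta>\<close>, the second serves
    the other two demands; its summand 1 keeps the denominator positive when N = 0.\<close>
  define y where "y = min (\<delta> / c) (1 / (4 * c * p * N + 1))"
  have cpN: "0 \<le> 4 * c * p * N" using assms by simp
  have y: "0 < y" "c * y \<le> \<delta>" "4 * c * p * N * y \<le> 1"
  proof -
    show "0 < y" using assms cpN by (simp add: y_def add_nonneg_pos)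
    have "y \<le> \<delta> / c" by (simp add: y_def)
    then show "c * y \<le> \<delta>" using assms by (simp add: field_simps)
    have "4 * c * p * N * y \<le> 4 * c * p * N * (1 / (4 * c * p * N + 1))"
      using cpN by (intro mult_left_mono) (simp add: y_def)
    also have "\<dots> \<le> 1" using cpN by (simp add: divide_le_eq_1 add_nonneg_pos)
    finally show "4 * c * p * N * y \<le> 1" .
  qed
  define A where "A = min 1 (y powr (1 / (p - 1))) / 2"
  have A: "0 < A" "2 * A \<le> 1" "2 * A \<le> y powr (1 / (p - 1))" using y by (auto simp: A_def)
  have "(2 * A) powr (p - 1) \<le> (y powr (1 / (p - 1))) powr (p - 1)"
    using A assms by (intro powr_mono2) auto
  also have "\<dots> = y" using assms y by (simp add: powr_powr)
  finally have z: "(2 * A) powr (p - 1) \<le> y" .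
  have p1: "(2 * A) powr p = 2 * A * (2 * A) powr (p - 1)"
    using A by (simp add: powr_diff)
  have 1: "(2 * A) powr p \<le> 2 * A * y" unfolding p1 using z A by (intro mult_left_mono) auto
  have "2 * A * y \<le> 1 * y" using A y by (intro mult_right_mono) auto
  then have "c * (2 * A) powr p \<le> c * y" using 1 assms by (intro mult_left_mono) auto
  then have c1: "c * (2 * A) powr p \<le> \<delta>" using y by linarith
  have cN: "4 * c * N * y \<le> 1"
  proof -
    have "(4 * c * N * y) * 1 \<le> (4 * c * N * y) * p" using assms y by (intro mult_left_mono) auto
    then show ?thesis using y(3) by (simp add: mult_ac)
  qed
  have "2 * N * (c * (2 * A) powr p) \<le> 2 * N * (c * (2 * A * y))"
    using 1 assms by (intro mult_left_mono) auto
  also have "\<dots> = A * (4 * c * N * y)" by simp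
  also have "\<dots> \<le> A * 1" using cN A by (intro mult_left_mono) auto
  finally have c2: "2 * N * (c * (2 * A) powr p) \<le> A" by simp
  have "4 * c * p * (2 * A) powr (p - 1) * N \<le> 4 * c * p * y * N"
    using z assms by (intro mult_right_mono mult_left_mono) auto
  also have "\<dots> \<le> 1" using y(3) by (simp add: mult_ac)
  finally show ?thesis using that A c1 c2 by blast
qed

text \<open>With \<open>lam = A / (2 * r\<^sup>2)\<close> the ball in the mass condition has radius
  exactly \<open>r\<close>, and \<open>lam * R\<close> is of order A / r; hence every condition
  holds once \<open>r\<close> is large.\<close>

lemma scale_exists:
  fixes A K a l :: real
  assumes "0 < A" "0 < K" "0 < a" "0 < l"
  obtains lam R where "0 < lam" "lam < l" "a < R" "lam * R \<le> 1" "2 * A \<le> lam * R\<^sup>2"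
    "1 \<le> K * measure lborel (ball (0::'a::euclidean_space) (sqrt (A / (2 * lam))))"
proof -
  define \<omega> where "\<omega> = unit_ball_vol (real DIM('a))"
  have \<omega>: "0 < \<omega>" by (simp add: \<omega>_def)
  \<comment> \<open>One summand per demand: \<open>1 / (K * \<omega>)\<close> for the mass,
    \<open>2 * A\<close> and \<open>A * (a + 1)\<close> for the two halves of
    \<open>lam * R \<le> 1\<close>, \<open>A / l\<close> for \<open>lam < l\<close>; the 1 allows
    powers of \<open>r\<close> to be bounded below by \<open>r\<close>.\<close>
  define r where "r = 1 + 1 / (K * \<omega>) + 2 * A + A * (a + 1) + A / l"
  define lam where "lam = A / (2 * r\<^sup>2)"
  define R where "R = a + 1 + 2 * r"
  have pos: "0 < 1 / (K * \<omega>)" "0 < A * (a + 1)" "0 < A / l" using assms \<omega> by auto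
  have r: "1 \<le> r" "1 / (K * \<omega>) \<le> r" "2 * A \<le> r" "A * (a + 1) \<le> r" "A / l < r"
    using assms(1) pos unfolding r_def by linarith+
  then have r0: "0 < r" by linarith
  have rr: "r \<le> r\<^sup>2" using r by (simp add: power2_eq_square)
  have lam: "0 < lam" using assms r0 by (simp add: lam_def)
  have "lam \<le> A / (2 * r)" unfolding lam_def using rr r0 assms by (intro divide_left_mono) auto
  also have "\<dots> < l" using r(5) r0 assms by (simp add: field_simps)
  finally have "lam < l" .
  moreover have "a < R" using r0 by (simp add: R_def)
  moreover have "lam * R \<le> 1"
  proof -
    have "lam * R = A * (a + 1) / (2 * r\<^sup>2) + A / r"
      using r0 by (simp add: lam_def R_def field_simps power2_eq_square)
    moreover have "A * (a + 1) / (2 * r\<^sup>2) \<le> 1 / 2" using r(4) rr r0 by (simp add: field_simps)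
    moreover have "A / r \<le> 1 / 2" using r(3) r0 by (simp add: field_simps)
    ultimately show ?thesis by linarith
  qed
  moreover have "2 * A \<le> lam * R\<^sup>2"
  proof -
    have "lam * (2 * r)\<^sup>2 \<le> lam * R\<^sup>2"
      using lam r0 assms by (intro mult_left_mono power_mono) (auto simp: R_def)
    moreover have "lam * (2 * r)\<^sup>2 = 2 * A" using r0 by (simp add: lam_def field_simps power2_eq_square)
    ultimately show ?thesis by simp
  qed
  moreover have "1 \<le> K * measure lborel (ball (0::'a) (sqrt (A / (2 * lam))))"
  proof -
    have "A / (2 * lam) = r\<^sup>2" using assms r0 by (simp add: lam_def)
    then have s: "sqrt (A / (2 * lam)) = r" using r0 by simp
    have "1 = K * (\<omega> * (1 / (K * \<omega>)))" using assms \<omega> by simp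
    also have "\<dots> \<le> K * (\<omega> * r)" using r(2) assms \<omega> by (intro mult_left_mono) auto
    also have "\<dots> \<le> K * (\<omega> * r ^ DIM('a))"
      using r(1) assms \<omega> self_le_power[of r "DIM('a)"] by (intro mult_left_mono) auto
    also have "\<dots> = K * measure lborel (ball (0::'a) (sqrt (A / (2 * lam))))"
      unfolding s using r0 by (simp add: content_ball \<omega>_def)
    finally show ?thesis .
  qed
  ultimately show ?thesis using that lam by blast
qed

text \<open>Between \<open>a\<close> and \<open>b\<close> the function
  \<open>w - lam * r\<^sup>2\<close> is constant. After subtraction of this constant the cut at
  \<open>a\<close> keeps the profile C1, and the behaviour of \<open>w\<close> beyond
  \<open>b\<close> drops out.\<close>

lemma radial_kernel_truncation:
  fixes w w' :: "real \<Rightarrow> real"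
  assumes a: "0 < a" "a < b" and D: "0 \<le> D"
    and w: "\<And>r. 0 < r \<Longrightarrow> (w has_real_derivative w' r) (at r)" and w'_cont: "continuous_on {0<..} w'"
    and in_bd: "\<And>r. 0 < r \<Longrightarrow> r < a \<Longrightarrow> \<bar>w' r - 2 * lam * r\<bar> \<le> D * r powr (1 - real DIM('a))"
    and quad: "\<And>r. a \<le> r \<Longrightarrow> r < b \<Longrightarrow> w' r = 2 * lam * r"
  shows "radial_kernel (\<lambda>r. if r < a then w r - lam * r\<^sup>2 - (w a - lam * a\<^sup>2) else 0)
     (\<lambda>r. if r < a then w' r - 2 * lam * r else 0) a (D * (1 + a))
     (\<lambda>x::'a::euclidean_space. if x = 0 then 0 else (\<lambda>r. if r < a then w r - lam * r\<^sup>2 - (w a - lam * a\<^sup>2) else 0) (norm x))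
     (\<lambda>x. if x = 0 then 0 else ((\<lambda>r. if r < a then w' r - 2 * lam * r else 0) (norm x) / norm x) *\<^sub>R x)"
    (is "radial_kernel ?\<nu> ?\<nu>' _ _ _ _")
proof
  let ?n = "real DIM('a)"
  define g where "g r = w r - lam * r\<^sup>2 - (w a - lam * a\<^sup>2)" for r
  have g: "(g has_real_derivative w' r - 2 * lam * r) (at r)" if "0 < r" for r
    unfolding g_def by (auto intro!: derivative_eq_intros w that)
  have g0: "g r = 0" if r: "a \<le> r" "r < b" for r
  proof (cases "r = a")
    case False
    then have "a < r" using r by simp
    then obtain z where "a < z" "z < r" "g r - g a = (r - a) * (w' z - 2 * lam * z)"
      using MVT2[of a r g "\<lambda>z. w' z - 2 * lam * z"] g a by force
    then show ?thesis using quad[of z] r by (simp add: g_def)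
  qed (simp add: g_def)
  have \<nu>g: "?\<nu> r = g r" if "r < b" for r using g0[of r] that by (auto simp: g_def)
  have \<nu>g': "?\<nu>' r = w' r - 2 * lam * r" if "r < b" for r using quad[of r] that by auto
  show "(?\<nu> has_real_derivative ?\<nu>' r) (at r)" if "0 < r" for r
  proof (cases "r < b")
    case True
    have "(g has_real_derivative ?\<nu>' r) (at r)" using g[OF that] \<nu>g'[OF True] by metis
    then show ?thesis
      by (rule has_field_derivative_transform_within_open[where S = "{..<b}"]) (use True \<nu>g in auto)
  next
    case False
    then have "((\<lambda>r. 0) has_real_derivative ?\<nu>' r) (at r)" using a by simp
    then show ?thesis
      by (rule has_field_derivative_transform_within_open[where S = "{a<..}"]) (use False a in auto)
  qed
  have "continuous_on ({0<..<b} \<union> {a<..}) ?\<nu>'"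
  proof (rule continuous_on_open_Un)
    have "continuous_on {0<..<b} (\<lambda>r. w' r - 2 * lam * r)"
      by (intro continuous_intros continuous_on_subset[OF w'_cont]) auto
    then show "continuous_on {0<..<b} ?\<nu>'"
      by (rule continuous_on_eq) (use \<nu>g' in auto)
    show "continuous_on {a<..} ?\<nu>'"
      by (rule continuous_on_eq[of _ "\<lambda>_. 0"]) auto
  qed auto
  moreover have "{0<..<b} \<union> {a<..} = {0<..}" using a by auto
  ultimately show "continuous_on {0<..} ?\<nu>'" by simp
  have D': "D * r powr (1 - ?n) \<le> D * (1 + a) * r powr (1 - ?n)" for r
    using D a mult_right_mono[of D "D * (1 + a)" "r powr (1 - ?n)"] by (simp add: algebra_simps)
  have nn: "0 \<le> D * (1 + a) * r powr (1 - ?n)" for r using D a by simp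
  show "\<bar>?\<nu>' r\<bar> \<le> D * (1 + a) * r powr (1 - ?n)" if "0 < r" for r
    using in_bd[OF that] D'[of r] nn[of r] by auto
  show "\<bar>?\<nu> r\<bar> \<le> D * (1 + a) * r powr (1 - ?n)" if r: "0 < r" for r
  proof (cases "r < a")
    case True
    \<comment> \<open>Mean value theorem between \<open>r\<close> and \<open>a\<close>, where
      \<open>g\<close> vanishes. The distance is at most \<open>1 + a\<close>, the origin of the
      constant in the statement, and the bound on the slope at \<open>z\<close> is at most that at
      \<open>r\<close>.\<close>
    obtain z where z: "r < z" "z < a" "g a - g r = (a - r) * (w' z - 2 * lam * z)"
      using MVT2[of r a g "\<lambda>z. w' z - 2 * lam * z"] g True r by force
    have "\<bar>g a - g r\<bar> = (a - r) * \<bar>w' z - 2 * lam * z\<bar>" unfolding z(3) using True by (simp add: abs_mult)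
    moreover have "g a = 0" by (simp add: g_def)
    ultimately have "\<bar>g r\<bar> = (a - r) * \<bar>w' z - 2 * lam * z\<bar>" by simp
    also have "\<dots> \<le> (1 + a) * (D * r powr (1 - ?n))"
    proof (rule mult_mono)
      have "\<bar>w' z - 2 * lam * z\<bar> \<le> D * z powr (1 - ?n)" using in_bd[of z] z r by simp
      also have "\<dots> \<le> D * r powr (1 - ?n)"
        using D z r by (intro mult_left_mono powr_mono2') auto
      finally show "\<bar>w' z - 2 * lam * z\<bar> \<le> D * r powr (1 - ?n)" .
    qed (use r a in auto)
    finally show ?thesis using \<nu>g[of r] True a by (simp add: mult_ac)
  qed (use nn in simp)
qed (use a D in auto)

text \<open>All that a scale has to know of a potential. The part below \<open>a\<close> enters
  through \<open>D\<close> alone and the slopes beyond the stretch through an unspecified bound, so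
  the parameters can be chosen while the potential is still unknown.\<close>

definition steady_potential :: "'a::euclidean_space itself \<Rightarrow> real \<Rightarrow> real \<Rightarrow> real \<Rightarrow> real \<Rightarrow> (real \<Rightarrow> real) \<Rightarrow> (real \<Rightarrow> real) \<Rightarrow> bool"
  where "steady_potential t a D lam R w w' \<longleftrightarrow>
    (\<forall>r>0. (w has_real_derivative w' r) (at r)) \<and> continuous_on {0<..} w' \<and> (\<forall>r>0. 0 \<le> w' r) \<and>
    (\<forall>r. 0 < r \<and> r < a \<longrightarrow> \<bar>w' r - 2 * lam * r\<bar> \<le> D * r powr (1 - real DIM('a))) \<and>
    (\<forall>r. a \<le> r \<and> r < 2 * R + 1 \<longrightarrow> w' r = 2 * lam * r) \<and> (\<exists>K. \<forall>r\<ge>a. w' r \<le> K)"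

text \<open>Height, support, continuity and mass are carried along to tell the states of different
  scales apart.\<close>

abbreviation steady_bump where
  "steady_bump m w R \<delta> \<rho> \<equiv> steady_state m w \<rho> \<and> radially_decreasing \<rho> \<and> (\<forall>x. 0 \<le> \<rho> x \<and> \<rho> x \<le> \<delta>) \<and>
     (\<forall>x. R \<le> norm x \<longrightarrow> \<rho> x = 0) \<and> continuous_on UNIV \<rho> \<and> (LBINT x. \<rho> x) = 1"

text \<open>The order of quantifiers is the point: \<open>lam\<close> and \<open>R\<close> come
  before \<open>w\<close>. The amplitude is chosen first, from the bound \<open>D * (1 + a)\<close>
  on the truncated kernel, which does not involve \<open>lam\<close>; then \<open>lam\<close> is
  lowered at fixed amplitude until the flat profile has room for mass 1.\<close>

lemma steady_state_at_scale:
  fixes m a D \<delta> l :: real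
  assumes m: "1 < m" "m < 2" and a: "0 < a" and D: "0 \<le> D" and \<delta>: "0 < \<delta>" and l: "0 < l"
  obtains lam R where "0 < lam" "lam < l" "a < R" "lam * R \<le> 1"
    "\<And>w w'. steady_potential TYPE('a::euclidean_space) a D lam R w w' \<Longrightarrow>
      \<exists>\<rho>::'a \<Rightarrow> real. steady_bump m w R \<delta> \<rho>"
proof -
  define p where "p = 1 / (m - 1)"
  define c where "c = ((m - 1) / m) powr p"
  have p: "1 < p" using m by (simp add: p_def)
  have c: "0 < c" using m by (simp add: c_def)
  have a1: "0 \<le> D * (1 + a)" using a D by simp
  moreover have "0 \<le> rmass TYPE('a) a"
    by (rule Bochner_Integration.integral_nonneg) (rule rkernel_nonneg)
  ultimately have "0 \<le> D * (1 + a) * rmass TYPE('a) a"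
    by (rule mult_nonneg_nonneg)
  then obtain A where amp: "0 < A" "c * (2 * A) powr p \<le> \<delta>"
    "2 * (D * (1 + a) * rmass TYPE('a) a) * (c * (2 * A) powr p) \<le> A"
    "4 * c * p * (2 * A) powr (p - 1) * (D * (1 + a) * rmass TYPE('a) a) \<le> 1"
    using amplitude_exists[OF _ c p \<delta>] by blast
  have "0 < c * (A / 2) powr p" using c amp by simp
  then obtain lam R where L: "0 < lam" "lam < l" "a < R" "lam * R \<le> 1" "2 * A \<le> lam * R\<^sup>2"
    "1 \<le> c * (A / 2) powr p * measure lborel (ball (0::'a) (sqrt (A / (2 * lam))))"
    by (rule scale_exists[OF amp(1) _ a l])
  show ?thesis
  proof (rule that[OF L(1-4)])
    fix w w' assume S: "steady_potential TYPE('a) a D lam R w w'"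
    then have w: "\<And>r. 0 < r \<Longrightarrow> (w has_real_derivative w' r) (at r)" and w'_cont: "continuous_on {0<..} w'"
      and w'_nonneg: "\<And>r. 0 < r \<Longrightarrow> 0 \<le> w' r"
      and in_bd: "\<And>r. 0 < r \<Longrightarrow> r < a \<Longrightarrow> \<bar>w' r - 2 * lam * r\<bar> \<le> D * r powr (1 - real DIM('a))"
      and quad: "\<And>r. a \<le> r \<Longrightarrow> r < 2 * R + 1 \<Longrightarrow> w' r = 2 * lam * r"
      unfolding steady_potential_def by auto
    obtain K where K: "\<And>r. a \<le> r \<Longrightarrow> w' r \<le> K" using S unfolding steady_potential_def by auto
    define \<nu> where "\<nu> = (\<lambda>r. if r < a then w r - lam * r\<^sup>2 - (w a - lam * a\<^sup>2) else 0)"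
    define \<nu>' where "\<nu>' = (\<lambda>r. if r < a then w' r - 2 * lam * r else 0)"
    define V where "V = (\<lambda>x::'a. if x = 0 then 0 else \<nu> (norm x))"
    define G where "G = (\<lambda>x::'a. if x = 0 then 0 else (\<nu>' (norm x) / norm x) *\<^sub>R x)"
    have aR: "a < 2 * R + 1" using L a by simp
    have rk: "radial_kernel \<nu> \<nu>' a (D * (1 + a)) V G"
      unfolding V_def G_def unfolding \<nu>_def \<nu>'_def
      by (rule radial_kernel_truncation[OF a aR D w w'_cont in_bd quad])
    interpret radial_kernel \<nu> \<nu>' a "D * (1 + a)" V G by (rule rk)
    \<comment> \<open>Below \<open>a\<close> the sum is \<open>w\<close> up to a constant, above
      \<open>a\<close> it is the quadratic; neither decreases.\<close>
    have mono: "lam * r\<^sup>2 + \<nu> r \<le> lam * s\<^sup>2 + \<nu> s" if rs: "0 < r" "r \<le> s" for r s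
    proof (rule DERIV_nonneg_imp_nondecreasing[OF rs(2)])
      fix x assume x: "r \<le> x" "x \<le> s"
      have "((\<lambda>r. lam * r\<^sup>2 + \<nu> r) has_real_derivative 2 * lam * x + \<nu>' x) (at x)"
        using x rs by (auto intro!: derivative_eq_intros deriv)
      moreover have "0 \<le> 2 * lam * x + \<nu>' x"
        using w'_nonneg[of x] x rs L(1) by (auto simp: \<nu>'_def)
      ultimately show "\<exists>y. ((\<lambda>r. lam * r\<^sup>2 + \<nu> r) has_real_derivative y) (at x) \<and> 0 \<le> y" by blast
    qed
    interpret flat_state \<nu> \<nu>' a "D * (1 + a)" V G p c A lam R
      by unfold_locales (use p c amp L a mono in auto)
    obtain \<rho> C where \<rho>: "\<rho> \<in> profiles" "\<And>x. \<rho> x = c * pospow p (C - (lam * (norm x)\<^sup>2 + cnv V \<rho> x))"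
      using fixed_point_exists by blast
    interpret flat_steady \<nu> \<nu>' a "D * (1 + a)" V G p c A lam R m K C w w' \<rho>
    proof
      show "p = 1 / (m - 1)" by (rule p_def)
      show "c = ((m - 1) / m) powr p" by (rule c_def)
      show "w' r = 2 * lam * r + \<nu>' r" if "0 < r" "r < 2 * R" for r
        using quad[of r] that by (auto simp: \<nu>'_def)
      show "\<bar>w' r\<bar> \<le> K" if "a \<le> r" for r using K[OF that] w'_nonneg[of r] that a by simp
    qed (use m w w'_cont L a \<rho> in auto)
    have "\<rho> x \<le> \<delta>" for x using profilesD(4)[OF \<rho>(1), of x] amp(2) unfolding B_def by linarith
    then show "\<exists>\<rho>::'a \<Rightarrow> real. steady_bump m w R \<delta> \<rho>"
      using steady_state_\<rho> radially_decreasing_\<rho> profilesD(1,3,7,8)[OF \<rho>(1)] by blast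
  qed
qed

section \<open>Gluing the potential\<close>

text \<open>Restriction to the ray through a basis vector turns the gradient of the radial function
  into a derivative in one variable.\<close>

lemma radial_profile_C1:
  assumes "smooth_on (radial_pot w :: 'a::euclidean_space \<Rightarrow> real) (- {0})"
  obtains w' where "\<And>r. 0 < r \<Longrightarrow> (w has_real_derivative w' r) (at r)" "continuous_on {0<..} w'"
proof -
  obtain b :: 'a where b: "b \<in> Basis" using nonempty_Basis by blast
  let ?f = "radial_pot w :: 'a \<Rightarrow> real"
  have C1: "Ck_on (Suc 0) ?f (- {0})" using assms unfolding smooth_on_def by blast
  have op: "open (- {0 :: 'a})" by auto
  define w' where "w' r = grad ?f (r *\<^sub>R b) \<bullet> b" for r
  have "(w has_real_derivative w' r) (at r)" if r: "0 < r" for r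
  proof -
    have rb: "r *\<^sub>R b \<in> - {0}" using b r by auto
    have "?f differentiable at (r *\<^sub>R b)"
      using Ck_on_Suc_has_derivative[OF op C1 rb] by (rule differentiableI)
    then have d: "(?f has_derivative (\<lambda>h. grad ?f (r *\<^sub>R b) \<bullet> h)) (at (r *\<^sub>R b))"
      by (rule has_derivative_grad)
    have "((\<lambda>t. t *\<^sub>R b) has_derivative (\<lambda>t. t *\<^sub>R b)) (at r)"
      by (auto intro!: derivative_eq_intros)
    from has_derivative_compose[OF this, of ?f] d
    have "((\<lambda>t. ?f (t *\<^sub>R b)) has_derivative (\<lambda>h. grad ?f (r *\<^sub>R b) \<bullet> (h *\<^sub>R b))) (at r)" by blast
    moreover have "(\<lambda>h. grad ?f (r *\<^sub>R b) \<bullet> (h *\<^sub>R b)) = (*) (w' r)"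
      by (auto simp: w'_def fun_eq_iff)
    ultimately have "((\<lambda>t. ?f (t *\<^sub>R b)) has_real_derivative w' r) (at r)"
      by (simp add: has_field_derivative_def)
    then show ?thesis
      by (rule has_field_derivative_transform_within_open[where S = "{0<..}"])
         (use r b in \<open>auto simp: radial_pot_def\<close>)
  qed
  moreover have "continuous_on {0<..} w'"
  proof -
    have "continuous_on {0<..} (\<lambda>r. grad ?f (r *\<^sub>R b))"
      by (rule continuous_on_compose2[OF Ck_on_Suc_continuous_grad[OF C1]])
         (use b in \<open>auto intro!: continuous_intros\<close>)
    then show ?thesis unfolding w'_def[abs_def] by (intro continuous_intros)
  qed
  ultimately show ?thesis using that by blast
qed

text \<open>The variable t stands for r^2, in which a quadratic stretch is affine. On the unit
  interval after \<open>\<beta> i\<close> a smooth step lowers the slope from \<open>lam i\<close>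
  to \<open>lam (Suc i)\<close>. As \<open>\<beta> i > i\<close>, finitely many steps act near each
  t, and the telescoping drops keep \<open>h t\<close> at or above \<open>lam n\<close> whenever
  \<open>t < \<beta> n\<close>.\<close>

lemma smooth_staircase_exists:
  fixes \<beta> lam :: "nat \<Rightarrow> real"
  assumes \<beta>0: "0 < \<beta> 0" and \<beta>: "\<And>i. \<beta> i + 1 \<le> \<beta> (Suc i)"
    and lam: "\<And>i. 0 < lam i" "\<And>i. lam (Suc i) \<le> lam i"
  obtains q h where "smooth_on q UNIV" "\<And>t. (q has_real_derivative h t) (at t)" "continuous_on UNIV h"
    "q 0 = 0" "\<And>t. 0 < h t" "\<And>i t. (\<And>j. j < i \<Longrightarrow> \<beta> j + 1 \<le> t) \<Longrightarrow> h t \<le> lam i"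
    "\<And>i t. (\<And>j. j < i \<Longrightarrow> \<beta> j + 1 \<le> t) \<Longrightarrow> t < \<beta> i \<Longrightarrow> h t = lam i"
proof -
  obtain S S' S1 c where S: "smooth_on S1 UNIV" "\<And>t. (S1 has_real_derivative S t) (at t)"
    "\<And>t. 0 \<le> S t" "\<And>t. S t \<le> 1" "\<And>t. t \<le> 0 \<Longrightarrow> S t = 0" "\<And>t. 1 \<le> t \<Longrightarrow> S t = 1"
    "\<And>t. t \<le> 0 \<Longrightarrow> S1 t = (0::real)"
    by (rule smooth_step_exists) blast
  define \<eta> where "\<eta> i = lam i - lam (Suc i)" for i
  have \<eta>: "0 \<le> \<eta> i" for i using lam by (simp add: \<eta>_def)
  have \<beta>mono: "\<beta> i \<le> \<beta> j" if "i \<le> j" for i j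
    using that lift_Suc_mono_le[of \<beta> i j] \<beta> by (smt (verit))
  have \<beta>ge: "real i < \<beta> i" for i
  proof (induction i)
    case (Suc i) then show ?case using \<beta>[of i] by simp
  qed (use \<beta>0 in simp)
  have ex: "\<exists>n. t < \<beta> n" for t using \<beta>ge reals_Archimedean2[of t] less_trans by blast
  define q where "q t = lam 0 * t - (\<Sum>i. \<eta> i * S1 (t - \<beta> i))" for t
  define h where "h t = lam 0 - (\<Sum>i. \<eta> i * S (t - \<beta> i))" for t
  have fin: "(\<Sum>i. \<eta> i * f (t - \<beta> i)) = (\<Sum>i<n. \<eta> i * f (t - \<beta> i))"
    if "t < \<beta> n" "\<And>s. s \<le> 0 \<Longrightarrow> f s = 0" for f t n
  proof (rule suminf_finite)
    show "\<eta> i * f (t - \<beta> i) = 0" if "i \<notin> {..<n}" for i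
      using that \<open>t < \<beta> n\<close> \<beta>mono[of n i] \<open>\<And>s. s \<le> 0 \<Longrightarrow> f s = 0\<close>[of "t - \<beta> i"] by simp
  qed simp
  have qn: "q t = lam 0 * t - (\<Sum>i<n. \<eta> i * S1 (t - \<beta> i))" if "t < \<beta> n" for t n
  proof -
    have "(\<Sum>i. \<eta> i * S1 (t - \<beta> i)) = (\<Sum>i<n. \<eta> i * S1 (t - \<beta> i))"
      by (rule fin[OF that]) (rule S(7))
    then show ?thesis unfolding q_def by (rule arg_cong)
  qed
  have hn: "h t = lam 0 - (\<Sum>i<n. \<eta> i * S (t - \<beta> i))" if "t < \<beta> n" for t n
  proof -
    have "(\<Sum>i. \<eta> i * S (t - \<beta> i)) = (\<Sum>i<n. \<eta> i * S (t - \<beta> i))"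
      by (rule fin[OF that]) (rule S(5))
    then show ?thesis unfolding h_def by (rule arg_cong)
  qed
  have tele: "(\<Sum>i<n. \<eta> i) = lam 0 - lam n" for n
    unfolding \<eta>_def by (rule sum_lessThan_telescope')
  have smq: "smooth_on q UNIV"
    unfolding smooth_on_def
  proof (intro allI Ck_on_local open_UNIV)
    fix k and x :: real
    obtain n where n: "x < \<beta> n" using ex by blast
    have "Ck_on k (\<lambda>t. lam 0 * (t \<bullet> 1) + (\<Sum>i<n. (- \<eta> i) * S1 (1 * t + (- \<beta> i)))) (UNIV :: real set)"
      using S(1) unfolding smooth_on_def
      by (intro Ck_on_add Ck_on_mult Ck_on_sum Ck_on_const Ck_on_inner_left Ck_on_affine open_UNIV) auto
    then have "Ck_on k (\<lambda>t. lam 0 * (t \<bullet> 1) + (\<Sum>i<n. (- \<eta> i) * S1 (1 * t + (- \<beta> i)))) {..<\<beta> n}"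
      by (rule Ck_on_subset) simp
    then have "Ck_on k q {..<\<beta> n}"
      by (rule Ck_on_cong[OF open_lessThan, rotated]) (simp add: qn sum_negf)
    then show "\<exists>T. open T \<and> x \<in> T \<and> Ck_on k q T" using n by (intro exI[of _ "{..<\<beta> n}"]) auto
  qed
  have dq: "(q has_real_derivative h t) (at t)" for t
  proof -
    obtain n where n: "t < \<beta> n" using ex by blast
    have "((\<lambda>s. S1 (s - \<beta> i)) has_real_derivative S (t - \<beta> i)) (at t)" for i
    proof -
      have "((\<lambda>s. s - \<beta> i) has_real_derivative 1) (at t)" by (auto intro!: derivative_eq_intros)
      from DERIV_chain2[OF S(2) this] show ?thesis by simp
    qed
    then have "((\<lambda>s. lam 0 * s - (\<Sum>i<n. \<eta> i * S1 (s - \<beta> i))) has_real_derivative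
        lam 0 * 1 - (\<Sum>i<n. \<eta> i * S (t - \<beta> i))) (at t)"
      by (intro DERIV_diff DERIV_cmult DERIV_ident DERIV_sum)
    then have "((\<lambda>s. lam 0 * s - (\<Sum>i<n. \<eta> i * S1 (s - \<beta> i))) has_real_derivative h t) (at t)"
      by (simp add: hn[OF n])
    then show ?thesis
      by (rule has_field_derivative_transform_within_open[where S = "{..<\<beta> n}"]) (use n qn in auto)
  qed
  have ch: "continuous_on UNIV h"
  proof -
    have "Ck_on (Suc 0) q UNIV" using smq unfolding smooth_on_def by blast
    then obtain g where g: "\<And>t. (q has_real_derivative g t) (at t)" "Ck_on 0 g UNIV"
      using Ck_on_Suc_real by blast
    have "g = h" using DERIV_unique[OF g(1) dq] by blast
    then show ?thesis using g(2) by simp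
  qed
  have q0: "q 0 = 0" using qn[of 0 0] \<beta>0 by simp
  have hpos: "0 < h t" for t
  proof -
    obtain n where n: "t < \<beta> n" using ex by blast
    have "(\<Sum>i<n. \<eta> i * S (t - \<beta> i)) \<le> (\<Sum>i<n. \<eta> i)"
      using \<eta> S(4) by (intro sum_mono mult_left_le) auto
    then show ?thesis using hn[OF n] tele[of n] lam(1)[of n] by linarith
  qed
  have sum1: "(\<Sum>j<i. \<eta> j * S (t - \<beta> j)) = lam 0 - lam i" if "\<And>j. j < i \<Longrightarrow> \<beta> j + 1 \<le> t" for i t
  proof -
    have "S (t - \<beta> j) = 1" if "j < i" for j using \<open>\<And>j. j < i \<Longrightarrow> \<beta> j + 1 \<le> t\<close>[OF that] by (intro S(6)) simp
    then have "(\<Sum>j<i. \<eta> j * S (t - \<beta> j)) = (\<Sum>j<i. \<eta> j)" by simp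
    then show ?thesis unfolding tele .
  qed
  have hle: "h t \<le> lam i" if "\<And>j. j < i \<Longrightarrow> \<beta> j + 1 \<le> t" for i t
  proof -
    obtain n where n: "t < \<beta> n" using ex by blast
    have n': "t < \<beta> (max n i)" using n \<beta>mono[of n "max n i"] by simp
    have "(\<Sum>j<i. \<eta> j * S (t - \<beta> j)) \<le> (\<Sum>j<max n i. \<eta> j * S (t - \<beta> j))"
      using \<eta> S(3) by (intro sum_mono2) auto
    moreover have "(\<Sum>j<i. \<eta> j * S (t - \<beta> j)) = lam 0 - lam i" by (rule sum1) (rule that)
    ultimately show ?thesis using hn[OF n'] by linarith
  qed
  show ?thesis
  proof (rule that[OF smq dq ch q0 hpos hle])
    show "h t = lam i" if "\<And>j. j < i \<Longrightarrow> \<beta> j + 1 \<le> t" "t < \<beta> i" for i t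
    proof -
      have "(\<Sum>j<i. \<eta> j * S (t - \<beta> j)) = lam 0 - lam i" by (rule sum1) (rule that(1))
      then show ?thesis using hn[OF that(2)] by simp
    qed
  qed
qed

abbreviation glued :: "'a::euclidean_space itself \<Rightarrow> (real \<Rightarrow> real) \<Rightarrow> real \<Rightarrow> real \<Rightarrow> (real \<Rightarrow> real) \<Rightarrow>
    (real \<Rightarrow> real) \<Rightarrow> (real \<Rightarrow> real) \<Rightarrow> bool" where
  "glued t w0 R0 D h w w' \<equiv> W1 t w \<and> (\<forall>r>0. (w has_real_derivative w' r) (at r)) \<and> continuous_on {0<..} w' \<and>
     (\<forall>r>0. 0 < w' r) \<and> (\<forall>r. 0 < r \<and> r < sqrt (R0\<^sup>2 + 1) \<longrightarrow> w' r \<le> D * r powr (1 - real DIM('a))) \<and>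
     (\<forall>r. sqrt (R0\<^sup>2 + 1) \<le> r \<longrightarrow> w' r = 2 * r * h (r\<^sup>2)) \<and> (\<forall>r. 0 < r \<and> r < R0 \<longrightarrow> w r = w0 r)"

text \<open>The constant \<open>w0 r1\<close> lifts the outer branch above \<open>w0\<close> on the
  transition, so that interpolation only adds a nonnegative term to the slope. \<open>D\<close>
  precedes \<open>q\<close> and \<open>h\<close>: from \<open>q 0 = 0\<close> and slopes between 0
  and 1 follows \<open>0 \<le> q t \<le> t\<close> for t \<ge> 0, which bounds every term
  uniformly.\<close>

lemma potential_gluing:
  fixes w0 :: "real \<Rightarrow> real" and R0 :: real
  assumes W1: "W1 TYPE('a::euclidean_space) w0" and W2: "W2 TYPE('a) w0 k" and k: "k \<ge> - real DIM('a) + 2"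
    and R0: "0 < R0"
  obtains D where "0 \<le> D"
    "\<And>q h. smooth_on q UNIV \<Longrightarrow> (\<And>t. (q has_real_derivative h t) (at t)) \<Longrightarrow> continuous_on UNIV h \<Longrightarrow>
       q 0 = 0 \<Longrightarrow> (\<And>t. 0 < h t) \<Longrightarrow> (\<And>t. h t \<le> 1) \<Longrightarrow>
       \<exists>w w'. glued TYPE('a) w0 R0 D h w w'"
proof -
  let ?n = "real DIM('a)"
  \<comment> \<open>End of the transition: while r^2 runs from R0^2 to R0^2 + 1, the argument of the
    smooth step runs from 0 to 1.\<close>
  define r1 where "r1 = sqrt (R0\<^sup>2 + 1)"
  have r1: "0 < r1" "R0 < r1" "1 \<le> r1" "r1\<^sup>2 = R0\<^sup>2 + 1"
  proof -
    show "r1\<^sup>2 = R0\<^sup>2 + 1" unfolding r1_def by (simp add: add_nonneg_nonneg)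
    have "sqrt (R0\<^sup>2) < r1" unfolding r1_def by (intro real_sqrt_less_mono) simp
    then show "R0 < r1" "0 < r1" using R0 by auto
    have "sqrt 1 \<le> r1" unfolding r1_def by (intro real_sqrt_le_mono) simp
    then show "1 \<le> r1" by simp
  qed
  have sm0: "smooth_on (radial_pot w0 :: 'a \<Rightarrow> real) (- {0})" using W1 by (simp add: W1_def)
  obtain w0' where w0: "\<And>r. 0 < r \<Longrightarrow> (w0 has_real_derivative w0' r) (at r)" and w0'_cont: "continuous_on {0<..} w0'"
    using radial_profile_C1[OF sm0] by blast
  have w0'_pos: "0 < w0' r" if "0 < r" for r
    using W1 that DERIV_imp_deriv[OF w0[OF that]] unfolding W1_def by metis
  have w0_mono: "w0 r \<le> w0 s" if "0 < r" "r \<le> s" for r s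
    by (rule DERIV_nonneg_imp_nondecreasing[OF that(2)]) (use w0 w0'_pos that in \<open>meson less_le_trans less_imp_le\<close>)
  obtain C where C: "0 < C" "\<And>r. 0 < r \<Longrightarrow> r < 1 \<Longrightarrow> deriv w0 r \<le> C * r powr (k - 1)"
    using W2 unfolding W2_def by auto
  \<comment> \<open>Here k \<ge> 2 - n enters: for r < 1 it puts r^(k - 1) below r^(1 - n).\<close>
  have in1: "w0' r \<le> C * r powr (1 - ?n)" if "0 < r" "r < 1" for r
  proof -
    have "w0' r \<le> C * r powr (k - 1)" using C(2)[OF that] DERIV_imp_deriv[OF w0[OF that(1)]] by simp
    also have "\<dots> \<le> C * r powr (1 - ?n)"
      using that C k by (intro mult_left_mono powr_mono') auto
    finally show ?thesis .
  qed
  obtain S S' S1 c where S: "smooth_on S UNIV" "continuous_on UNIV S'"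
    "\<And>t. (S has_real_derivative S' t) (at t)"
    "\<And>t. 0 \<le> S t" "\<And>t. S t \<le> 1" "\<And>t. 0 \<le> S' t" "\<And>t. t \<le> 0 \<Longrightarrow> S t = 0" "\<And>t. 1 \<le> t \<Longrightarrow> S t = (1::real)"
    "\<And>t. t \<le> 0 \<Longrightarrow> S' t = 0" "\<And>t. 1 \<le> t \<Longrightarrow> S' t = (0::real)"
    by (rule smooth_step_exists) blast
  have cS: "continuous_on UNIV S" using S(3) by (auto intro!: continuous_at_imp_continuous_on DERIV_isCont)
  have "continuous_on {1/2..r1} (\<lambda>r. w0' r * r powr (?n - 1))"
    by (intro continuous_intros continuous_on_subset[OF w0'_cont]) auto
  then have "bounded ((\<lambda>r. w0' r * r powr (?n - 1)) ` {1/2..r1})"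
    by (intro compact_imp_bounded compact_continuous_image) auto
  then obtain M where M: "\<And>r. 1/2 \<le> r \<Longrightarrow> r \<le> r1 \<Longrightarrow> \<bar>w0' r * r powr (?n - 1)\<bar> \<le> M"
    unfolding bounded_iff image_iff by force
  have M0: "0 \<le> M" using M[of r1] r1 by linarith
  have in2: "w0' r \<le> M * r powr (1 - ?n)" if "1 \<le> r" "r \<le> r1" for r
  proof -
    have "w0' r * r powr (?n - 1) \<le> M" using M[of r] that by simp
    then have "w0' r * r powr (?n - 1) * r powr (1 - ?n) \<le> M * r powr (1 - ?n)"
      by (rule mult_right_mono) simp
    moreover have "r powr (?n - 1) * r powr (1 - ?n) = 1" using that by (simp add: powr_add[symmetric])
    ultimately show ?thesis by (simp add: mult.assoc)
  qed
  have "bounded (S' ` {0..1})"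
    by (intro compact_imp_bounded compact_continuous_image continuous_on_subset[OF S(2)]) auto
  then obtain L where L: "\<And>t. 0 \<le> t \<Longrightarrow> t \<le> 1 \<Longrightarrow> \<bar>S' t\<bar> \<le> L"
    unfolding bounded_iff image_iff by force
  have L0: "0 \<le> L" using L[of 0] by linarith
  \<comment> \<open>Bound for the two terms of \<open>w'\<close> free of \<open>w0'\<close>:
    \<open>2 * r1\<close> for the slope of the outer branch, the rest for the derivative of the
    cutoff, where \<open>q\<close> is at most \<open>r1\<^sup>2\<close>.\<close>
  define K1 where "K1 = 2 * r1 + 2 * r1 * L * (w0 r1 + r1\<^sup>2 - w0 R0)"
  have gap: "0 \<le> w0 r1 + r1\<^sup>2 - w0 R0"
    using w0_mono[of R0 r1] R0 r1 zero_le_power2[of r1] by linarith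
  have K1: "0 \<le> K1" unfolding K1_def using L0 r1 gap
    by (intro add_nonneg_nonneg mult_nonneg_nonneg) auto
  \<comment> \<open>\<open>C\<close> serves r < 1, \<open>M\<close> the rest up to
    \<open>r1\<close>, and the factor \<open>r1 powr (n - 1)\<close> turns the constant
    \<open>K1\<close> into a multiple of \<open>r powr (1 - n)\<close>.\<close>
  define D where "D = C + M + K1 * r1 powr (?n - 1)"
  show ?thesis
  proof (rule that[of D])
    show "0 \<le> D" using C M0 K1 by (simp add: D_def)
    fix q h assume smq: "smooth_on q UNIV" and dq: "\<And>t. (q has_real_derivative h t) (at t)"
      and ch: "continuous_on UNIV h" and q0: "q 0 = 0" and hpos: "\<And>t. 0 < h t" and hle: "\<And>t::real. h t \<le> 1"
    have q: "0 \<le> q t" "q t \<le> t" if t: "0 \<le> t" for t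
    proof -
      have "\<exists>z. q t = t * h z"
      proof (cases "t = 0")
        case False
        then have "0 < t" using t by simp
        from MVT2[OF this, of q h] show ?thesis using dq q0 by auto
      qed (use q0 in simp)
      then obtain z where z: "q t = t * h z" ..
      show "0 \<le> q t" unfolding z using t hpos[of z] by (intro mult_nonneg_nonneg) auto
      show "q t \<le> t" using mult_left_mono[OF hle[of z] t] z by simp
    qed
    define s where "s r = S (r\<^sup>2 - R0\<^sup>2)" for r :: real
    define w where "w r = (1 - s r) * w0 r + s r * (w0 r1 + q (r\<^sup>2))" for r
    define w' where "w' r = (1 - s r) * w0' r + s r * (2 * r * h (r\<^sup>2))
        + 2 * r * S' (r\<^sup>2 - R0\<^sup>2) * (w0 r1 + q (r\<^sup>2) - w0 r)" for r
    have w: "(w has_real_derivative w' r) (at r)" if r: "0 < r" for r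
    proof -
      have ds: "(s has_real_derivative S' (r\<^sup>2 - R0\<^sup>2) * (2 * r)) (at r)"
        unfolding s_def by (rule DERIV_chain2[OF S(3)]) (auto intro!: derivative_eq_intros)
      have dqr: "((\<lambda>r. q (r\<^sup>2)) has_real_derivative h (r\<^sup>2) * (2 * r)) (at r)"
        by (rule DERIV_chain2[OF dq]) (auto intro!: derivative_eq_intros)
      show ?thesis unfolding w_def w'_def
        by (auto intro!: derivative_eq_intros ds dqr w0 r simp: algebra_simps)
    qed
    have w'_cont: "continuous_on {0<..} w'"
    proof -
      have cw0: "continuous_on {0<..} w0" using w0
        by (auto intro!: continuous_at_imp_continuous_on DERIV_isCont)
      have cq: "continuous_on UNIV q" using dq by (auto intro!: continuous_at_imp_continuous_on DERIV_isCont)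
      show ?thesis unfolding w'_def s_def
        by (intro continuous_intros w0'_cont cw0 continuous_on_compose2[OF cS] continuous_on_compose2[OF cq]
            continuous_on_compose2[OF ch] continuous_on_compose2[OF S(2)]) auto
    qed
    have s01: "0 \<le> s r" "s r \<le> 1" for r using S(4,5) by (auto simp: s_def)
    have outer: "w' r = 2 * r * h (r\<^sup>2)" if r: "r1 \<le> r" for r
    proof -
      have "r1\<^sup>2 \<le> r\<^sup>2" using r r1 by (intro power_mono) auto
      then have "1 \<le> r\<^sup>2 - R0\<^sup>2" using r1 by simp
      then show ?thesis by (simp add: w'_def s_def S(8) S(10))
    qed
    \<comment> \<open>The derivative of the cutoff multiplies the gap between the branches,
      nonnegative as \<open>w0 r \<le> w0 r1\<close> and \<open>0 \<le> q\<close>. The upper bound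
      uses \<open>w0 R0 \<le> w0 r\<close>; for smaller \<open>r\<close> the factor
      \<open>S'\<close> vanishes.\<close>
    have third: "0 \<le> 2 * r * S' (r\<^sup>2 - R0\<^sup>2) * (w0 r1 + q (r\<^sup>2) - w0 r)
       \<and> 2 * r * S' (r\<^sup>2 - R0\<^sup>2) * (w0 r1 + q (r\<^sup>2) - w0 r) \<le> 2 * r1 * L * (w0 r1 + r1\<^sup>2 - w0 R0)"
      if r: "0 < r" "r < r1" for r
    proof (cases "r < R0")
      case True
      then have "r\<^sup>2 - R0\<^sup>2 \<le> 0" using r by (simp add: power_mono)
      moreover have "0 \<le> 2 * r1 * L * (w0 r1 + r1\<^sup>2 - w0 R0)"
        using L0 r1 gap by (intro mult_nonneg_nonneg) auto
      ultimately show ?thesis by (simp add: S(9))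
    next
      case False
      have "R0\<^sup>2 \<le> r\<^sup>2" using False R0 by (intro power_mono) auto
      moreover have rr: "r\<^sup>2 \<le> r1\<^sup>2" using r by (intro power_mono) auto
      ultimately have "\<bar>S' (r\<^sup>2 - R0\<^sup>2)\<bar> \<le> L" using L[of "r\<^sup>2 - R0\<^sup>2"] r1 by linarith
      then have SL: "S' (r\<^sup>2 - R0\<^sup>2) \<le> L" by simp
      have wr: "w0 R0 \<le> w0 r" "w0 r \<le> w0 r1" using w0_mono False R0 r by auto
      have qr: "0 \<le> q (r\<^sup>2)" "q (r\<^sup>2) \<le> r1\<^sup>2" using q[of "r\<^sup>2"] rr by auto
      have "0 \<le> 2 * r * S' (r\<^sup>2 - R0\<^sup>2) * (w0 r1 + q (r\<^sup>2) - w0 r)"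
        using r S(6) wr qr by (intro mult_nonneg_nonneg) auto
      moreover have "2 * r * S' (r\<^sup>2 - R0\<^sup>2) * (w0 r1 + q (r\<^sup>2) - w0 r) \<le> 2 * r1 * L * (w0 r1 + r1\<^sup>2 - w0 R0)"
        using r S(6) wr qr SL L0 r1 by (intro mult_mono mult_nonneg_nonneg) auto
      ultimately show ?thesis by simp
    qed
    have w'_pos: "0 < w' r" if r: "0 < r" for r
    proof (cases "r < r1")
      case True
      have "0 < (1 - s r) * w0' r + s r * (2 * r * h (r\<^sup>2))"
      proof (cases "s r = 1")
        case True then show ?thesis using r hpos by simp
      next
        case False
        then have "0 < (1 - s r) * w0' r" using s01[of r] w0'_pos[OF r] by simp
        moreover have "0 \<le> s r * (2 * r * h (r\<^sup>2))" using s01[of r] r hpos[of "r\<^sup>2"] by simp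
        ultimately show ?thesis by linarith
      qed
      then show ?thesis using third[OF r True] unfolding w'_def by linarith
    next
      case False then show ?thesis using outer[of r] r hpos by simp
    qed
    have inner: "w' r \<le> D * r powr (1 - ?n)" if r: "0 < r" "r < r1" for r
    proof -
      have "(1 - s r) * w0' r \<le> 1 * w0' r" using s01[of r] w0'_pos[OF r(1)] by (intro mult_right_mono) auto
      moreover have "s r * (2 * r * h (r\<^sup>2)) \<le> 1 * (2 * r1 * 1)"
        using s01[of r] r hle[of "r\<^sup>2"] hpos[of "r\<^sup>2"] by (intro mult_mono) auto
      ultimately have 1: "w' r \<le> w0' r + K1" using third[OF r] unfolding w'_def K1_def by linarith
      have "w0' r \<le> (C + M) * r powr (1 - ?n)"
      proof (cases "r < 1")
        case True
        have "C * r powr (1 - ?n) \<le> (C + M) * r powr (1 - ?n)" using M0 by (intro mult_right_mono) auto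
        then show ?thesis using in1[OF r(1) True] by linarith
      next
        case False
        have "M * r powr (1 - ?n) \<le> (C + M) * r powr (1 - ?n)" using C by (intro mult_right_mono) auto
        then show ?thesis using in2[of r] False r by linarith
      qed
      moreover have "K1 \<le> K1 * r1 powr (?n - 1) * r powr (1 - ?n)"
      proof -
        have "1 = r1 powr (?n - 1) * r1 powr (1 - ?n)" using r1 by (simp add: powr_add[symmetric])
        also have "\<dots> \<le> r1 powr (?n - 1) * r powr (1 - ?n)"
          using r by (intro mult_left_mono powr_mono2') auto
        finally show ?thesis using K1 mult_left_mono[of 1 _ K1] by (simp add: mult.assoc)
      qed
      ultimately show ?thesis using 1 unfolding D_def by (simp add: algebra_simps)
    qed
    have inner_eq: "w r = w0 r" if "0 < r" "r < R0" for r
    proof -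
      have "r\<^sup>2 - R0\<^sup>2 \<le> 0" using that by (simp add: power_mono)
      then show ?thesis by (simp add: w_def s_def S(7))
    qed
    have "W1 TYPE('a) w"
      unfolding W1_def
    proof (intro conjI allI impI)
      show "0 < deriv w r" if "0 < r" for r using DERIV_imp_deriv[OF w[OF that]] w'_pos[OF that] by simp
      show "smooth_on (radial_pot w :: 'a \<Rightarrow> real) (- {0})"
        unfolding smooth_on_def
      proof
        fix j
        have op: "open (- {0 :: 'a})" by auto
        have Sj: "Ck_on j S UNIV" and qj: "Ck_on j q UNIV" and w0j: "Ck_on j (radial_pot w0 :: 'a \<Rightarrow> real) (- {0})"
          using S(1) smq sm0 unfolding smooth_on_def by auto
        have "Ck_on j (\<lambda>x::'a. S (1 * (x \<bullet> x) + (- R0\<^sup>2))) UNIV"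
          by (rule Ck_on_inner_self[OF Ck_on_affine[OF Sj]])
        then have Sx: "Ck_on j (\<lambda>x::'a. S (1 * (x \<bullet> x) + (- R0\<^sup>2))) (- {0})"
          by (rule Ck_on_subset) simp
        have qx: "Ck_on j (\<lambda>x::'a. q (x \<bullet> x)) (- {0})"
          by (rule Ck_on_subset[OF Ck_on_inner_self[OF qj]]) simp
        have "Ck_on j (\<lambda>x::'a. (1 + (- 1) * S (1 * (x \<bullet> x) + (- R0\<^sup>2))) * radial_pot w0 x
            + S (1 * (x \<bullet> x) + (- R0\<^sup>2)) * (w0 r1 + q (x \<bullet> x))) (- {0})"
          by (intro Ck_on_add Ck_on_mult Ck_on_const op Sx qx w0j)
        moreover have "radial_pot w = (\<lambda>x::'a. (1 + (- 1) * S (1 * (x \<bullet> x) + (- R0\<^sup>2))) * radial_pot w0 x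
            + S (1 * (x \<bullet> x) + (- R0\<^sup>2)) * (w0 r1 + q (x \<bullet> x)))"
          by (auto simp: radial_pot_def w_def s_def power2_norm_eq_inner)
        ultimately show "Ck_on j (radial_pot w :: 'a \<Rightarrow> real) (- {0})" by simp
      qed
    qed
    then show "\<exists>w w'. glued TYPE('a) w0 R0 D h w w'"
      unfolding r1_def[symmetric] using w w'_cont w'_pos inner outer inner_eq by blast
  qed
qed

section \<open>Infinitely many steady states\<close>

theorem theorem1p2:
  fixes w0 :: "real \<Rightarrow> real" and m k :: real
  assumes "1 < m" and "m < 2"
    and "W1 TYPE('a::euclidean_space) w0"
    and "W2 TYPE('a) w0 k"
    and "k > - real DIM('a) * (m - 1)"
    and "k \<ge> - real DIM('a) + 2"
  shows "\<forall>R0>0. \<exists>w. W1 TYPE('a) w \<and>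
           (\<exists>C. AE x in lebesgue. R0 \<le> norm x \<longrightarrow> norm (grad (radial_pot w :: 'a \<Rightarrow> real) x) \<le> C) \<and>
           (\<forall>r. 0 < r \<and> r < R0 \<longrightarrow> w r = w0 r) \<and>
           (\<exists>\<rho> :: nat \<Rightarrow> 'a \<Rightarrow> real.
              (\<forall>i. steady_state m w (\<rho> i) \<and> radially_decreasing (\<rho> i)) \<and>
              (\<forall>i j. i \<noteq> j \<longrightarrow> \<not> (AE x in lebesgue. \<rho> i x = \<rho> j x)))"
proof (intro allI impI)
  fix R0 :: real assume R0: "0 < R0"
  let ?n = "real DIM('a)"
  obtain D where D: "0 \<le> D" and glue:
    "\<And>q h. smooth_on q UNIV \<Longrightarrow> (\<And>t. (q has_real_derivative h t) (at t)) \<Longrightarrow> continuous_on UNIV h \<Longrightarrow>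
       q 0 = 0 \<Longrightarrow> (\<And>t. 0 < h t) \<Longrightarrow> (\<And>t. h t \<le> 1) \<Longrightarrow>
       \<exists>w w'. glued TYPE('a) w0 R0 D h w w'"
    by (rule potential_gluing[OF assms(3,4,6) R0]) blast
  define r1 where "r1 = sqrt (R0\<^sup>2 + 1)"
  have r1: "0 < r1" unfolding r1_def by (simp add: add_nonneg_pos)
  \<comment> \<open>Below \<open>a\<close>, \<open>w'\<close> is at most
    \<open>D * r powr (1 - n) + 2 * r\<close> since \<open>h \<le> 1\<close>, the subtracted
    \<open>2 * lam * r\<close> is at most \<open>2 * r\<close>, and
    \<open>r \<le> a powr n * r powr (1 - n)\<close>.\<close>
  define DD where "DD a = D + 4 * a powr ?n" for a :: real
  \<comment> \<open>A density of this height has mass at most 1/2 in the ball of radius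
    \<open>a\<close>, which will separate later states from earlier ones.\<close>
  define \<delta> where "\<delta> a = 1 / (2 * measure lborel (ball (0::'a) a))" for a :: real
  define good where "good a l lam R \<longleftrightarrow> 0 < lam \<and> lam < l \<and> a < R \<and> lam * R \<le> 1 \<and>
    (\<forall>w w'. steady_potential TYPE('a) a (DD a) lam R w w' \<longrightarrow>
      (\<exists>\<rho>::'a \<Rightarrow> real. steady_bump m w R (\<delta> a) \<rho>))" for a l lam R :: real
  have good_ex: "\<exists>lam R. good a l lam R" if al: "0 < a" "0 < l" for a l
  proof -
    have "0 \<le> DD a" using D by (simp add: DD_def)
    have "0 < \<delta> a" using that by (simp add: \<delta>_def content_ball_pos)
    show ?thesis
    proof -
      obtain lam R where L: "0 < lam" "lam < l" "a < R" "lam * R \<le> 1"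
        and st: "\<And>w w'. steady_potential TYPE('a) a (DD a) lam R w w' \<Longrightarrow> \<exists>\<rho>::'a \<Rightarrow> real. steady_bump m w R (\<delta> a) \<rho>"
        by (rule steady_state_at_scale[OF assms(1,2) al(1) \<open>0 \<le> DD a\<close> \<open>0 < \<delta> a\<close> al(2), where 'a = 'a]) blast
      show ?thesis unfolding good_def
        by (intro exI[of _ lam] exI[of _ R] conjI allI impI L st)
    qed
  qed
  \<comment> \<open>A choice function on pairs of a start \<open>a\<close> and an upper bound
    \<open>l\<close> for \<open>lam\<close>, ready for recursion.\<close>
  have "\<forall>al. \<exists>p. 0 < fst al \<longrightarrow> 0 < snd al \<longrightarrow> good (fst al) (snd al) (fst p) (snd p)"
  proof
    fix al :: "real \<times> real"
    show "\<exists>p. 0 < fst al \<longrightarrow> 0 < snd al \<longrightarrow> good (fst al) (snd al) (fst p) (snd p)"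
    proof (cases "0 < fst al \<and> 0 < snd al")
      case True
      then obtain lam R where "good (fst al) (snd al) lam R" using good_ex by blast
      then show ?thesis by (intro exI[of _ "(lam, R)"]) simp
    qed auto
  qed
  from choice[OF this] obtain F where
    "\<forall>al. 0 < fst al \<longrightarrow> 0 < snd al \<longrightarrow> good (fst al) (snd al) (fst (F al)) (snd (F al))" ..
  then have F: "good (fst al) (snd al) (fst (F al)) (snd (F al))" if "0 < fst al" "0 < snd al" for al
    using that by blast
  \<comment> \<open>The state is the start of a stretch and the upper bound for its
    \<open>lam\<close>. The next stretch starts one unit of r^2 after (2R + 1)^2, the room taken by
    a step of the staircase; passing on the current \<open>lam\<close> as bound makes the sequence
    decrease.\<close>
  define X where "X = rec_nat (r1, 1) (\<lambda>i x. (sqrt ((2 * snd (F x) + 1)\<^sup>2 + 1), fst (F x)))"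
  define a where "a i = fst (X i)" for i
  define lam where "lam i = fst (F (X i))" for i
  define R where "R i = snd (F (X i))" for i
  have X0: "X 0 = (r1, 1)" and XS: "X (Suc i) = (sqrt ((2 * R i + 1)\<^sup>2 + 1), lam i)" for i
    by (simp_all add: X_def R_def lam_def)
  have Xpos: "0 < fst (X i) \<and> 0 < snd (X i)" for i
  proof (induction i)
    case (Suc i)
    then have "good (fst (X i)) (snd (X i)) (lam i) (R i)" unfolding lam_def R_def by (intro F) auto
    then show ?case by (simp add: XS good_def add_nonneg_pos)
  qed (simp add: X0 r1)
  have gd: "good (a i) (snd (X i)) (lam i) (R i)" for i
    unfolding a_def lam_def R_def using Xpos by (intro F) auto
  have apos: "0 < a i" for i using Xpos by (simp add: a_def)
  have lam_pos: "0 < lam i" and aR: "a i < R i" and lamR: "lam i * R i \<le> 1" for i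
    using gd unfolding good_def by auto
  have lam_dec: "lam (Suc i) < lam i" for i using gd[of "Suc i"] by (simp add: good_def XS)
  have lam_lt1: "lam i < 1" for i
  proof (induction i)
    case 0 then show ?case using gd[of 0] by (simp add: good_def X0)
  next
    case (Suc i) then show ?case using lam_dec[of i] by simp
  qed
  define \<beta> where "\<beta> i = (2 * R i + 1)\<^sup>2" for i
  have a0: "a 0 = r1" by (simp add: a_def X0)
  have aS: "a (Suc i) = sqrt (\<beta> i + 1)" for i by (simp add: a_def XS \<beta>_def)
  have aS2: "(a (Suc i))\<^sup>2 = \<beta> i + 1" for i by (simp add: aS \<beta>_def)
  have Rpos: "0 < R i" for i using apos[of i] aR[of i] by simp
  have aS_ge: "2 * R i + 1 \<le> a (Suc i)" for i
    unfolding aS \<beta>_def using Rpos[of i] by (intro real_le_rsqrt) simp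
  have aS_le: "a (Suc i) \<le> 2 * R i + 2" for i
    unfolding aS \<beta>_def using Rpos[of i] by (intro real_le_lsqrt) (auto simp: power2_eq_square algebra_simps)
  have a_step: "a i + 1 \<le> a (Suc i)" for i using aS_ge[of i] aR[of i] Rpos[of i] by linarith
  have a_mono: "a i \<le> a j" if "i \<le> j" for i j
    using that by (rule lift_Suc_mono_le[rotated]) (use a_step in \<open>smt (verit)\<close>)
  have a_ge: "real i \<le> a i" for i
  proof (induction i)
    case (Suc i) then show ?case using a_step[of i] by simp
  qed (simp add: apos less_imp_le)
  have \<beta>0: "0 < \<beta> 0" using Rpos[of 0] by (simp add: \<beta>_def)
  have \<beta>S: "\<beta> i + 1 \<le> \<beta> (Suc i)" for i
  proof -
    have "(a (Suc i))\<^sup>2 \<le> (2 * R (Suc i) + 1)\<^sup>2"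
      using apos[of "Suc i"] aR[of "Suc i"] by (intro power_mono) auto
    then show ?thesis by (simp add: aS2 \<beta>_def)
  qed
  obtain q h where sm: "smooth_on q UNIV" and dq: "\<And>t. (q has_real_derivative h t) (at t)"
    and ch: "continuous_on UNIV h" and q0: "q 0 = 0" and hpos: "\<And>t. 0 < h t"
    and hle: "\<And>i t. (\<And>j. j < i \<Longrightarrow> \<beta> j + 1 \<le> t) \<Longrightarrow> h t \<le> lam i"
    and heq: "\<And>i t. (\<And>j. j < i \<Longrightarrow> \<beta> j + 1 \<le> t) \<Longrightarrow> t < \<beta> i \<Longrightarrow> h t = lam i"
    by (rule smooth_staircase_exists[of \<beta> lam, OF \<beta>0 \<beta>S lam_pos less_imp_le[OF lam_dec]]) blast
  have h1: "h t \<le> 1" for t using hle[of 0 t] lam_lt1[of 0] by simp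
  obtain w w' where W1w: "W1 TYPE('a) w" and w: "\<And>r. 0 < r \<Longrightarrow> (w has_real_derivative w' r) (at r)"
    and w'_cont: "continuous_on {0<..} w'" and w'_pos: "\<And>r. 0 < r \<Longrightarrow> 0 < w' r"
    and inner: "\<And>r. 0 < r \<Longrightarrow> r < r1 \<Longrightarrow> w' r \<le> D * r powr (1 - ?n)"
    and outer: "\<And>r. r1 \<le> r \<Longrightarrow> w' r = 2 * r * h (r\<^sup>2)"
    and w_eq: "\<And>r. 0 < r \<Longrightarrow> r < R0 \<Longrightarrow> w r = w0 r"
    using glue[OF sm dq ch q0 hpos h1] unfolding r1_def by blast
  \<comment> \<open>Beyond \<open>a i\<close> all transitions of smaller index are complete, the
    condition under which the staircase has come down to \<open>lam i\<close>.\<close>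
  have below: "\<beta> j + 1 \<le> r\<^sup>2" if "a i \<le> r" "j < i" for i j r
  proof -
    have "a (Suc j) \<le> r" using a_mono[of "Suc j" i] that by simp
    then have "(a (Suc j))\<^sup>2 \<le> r\<^sup>2" using apos[of "Suc j"] by (intro power_mono) auto
    then show ?thesis by (simp add: aS2)
  qed
  \<comment> \<open>From \<open>a i\<close> to \<open>a (Suc i)\<close> the slope is at most
    \<open>2 * r * lam i\<close> with \<open>r \<le> 2 * R i + 2\<close>;
    \<open>lam i * R i \<le> 1\<close> and \<open>lam i < 1\<close> turn this into 4 + 4.\<close>
  have w'_le8: "w' r \<le> 8" if r: "r1 \<le> r" for r
  proof -
    have ex: "\<exists>n. r < a n" using a_ge reals_Archimedean2[of r] less_le_trans by blast
    define N where "N = (LEAST n. r < a n)"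
    have N: "r < a N" unfolding N_def by (rule LeastI_ex[OF ex])
    then obtain i where i: "N = Suc i" using r a0 by (cases N) auto
    have "a i \<le> r" using not_less_Least[of i "\<lambda>n. r < a n"] i unfolding N_def by force
    then have "h (r\<^sup>2) \<le> lam i" using hle below by blast
    moreover have "r \<le> 2 * R i + 2" using N aS_le[of i] i by simp
    ultimately have "(2 * r) * h (r\<^sup>2) \<le> (2 * (2 * R i + 2)) * lam i"
      using hpos[of "r\<^sup>2"] r r1 Rpos[of i] by (intro mult_mono) auto
    also have "\<dots> = 4 * (lam i * R i) + 4 * lam i" by (simp add: algebra_simps)
    also have "\<dots> \<le> 8" using lamR[of i] lam_lt1[of i] by linarith
    finally show ?thesis using outer[OF r] by simp
  qed
  have sp: "steady_potential TYPE('a) (a i) (DD (a i)) (lam i) (R i) w w'" for i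
    unfolding steady_potential_def
  proof (intro conjI allI impI)
    have r1a: "r1 \<le> a i" using a_mono[of 0 i] a0 by simp
    show "w' r = 2 * lam i * r" if "a i \<le> r \<and> r < 2 * R i + 1" for r
    proof -
      have "r\<^sup>2 < \<beta> i" unfolding \<beta>_def using that apos[of i] by (intro power_strict_mono) auto
      then have "h (r\<^sup>2) = lam i" using heq below that by blast
      then show ?thesis using outer[of r] that r1a by simp
    qed
    show "\<exists>K. \<forall>r\<ge>a i. w' r \<le> K" using w'_le8 r1a by (intro exI[of _ 8]) auto
    show "\<bar>w' r - 2 * lam i * r\<bar> \<le> DD (a i) * r powr (1 - ?n)" if r: "0 < r \<and> r < a i" for r
    proof -
      have "w' r \<le> D * r powr (1 - ?n) + 2 * r"
      proof (cases "r < r1")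
        case True then show ?thesis using inner[of r] r by simp
      next
        case False
        have "r * h (r\<^sup>2) \<le> r * 1" using h1 r by (intro mult_left_mono) auto
        moreover have "0 \<le> D * r powr (1 - ?n)" using D by simp
        ultimately show ?thesis using outer[of r] False by simp
      qed
      moreover have "0 \<le> w' r" using w'_pos[of r] r by simp
      moreover have "lam i * r \<le> 1 * r" using lam_lt1[of i] r by (intro mult_right_mono) auto
      moreover have "0 \<le> lam i * r" using lam_pos[of i] r by simp
      moreover have "r \<le> a i powr ?n * r powr (1 - ?n)"
      proof -
        have "r \<le> a i powr ?n * a i powr (1 - ?n)" using r by (simp add: powr_add[symmetric])
        also have "\<dots> \<le> a i powr ?n * r powr (1 - ?n)"
          using r by (intro mult_left_mono powr_mono2') auto
        finally show ?thesis .
      qed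
      ultimately have "\<bar>w' r - 2 * lam i * r\<bar> \<le> D * r powr (1 - ?n) + 4 * (a i powr ?n * r powr (1 - ?n))"
        using r by linarith
      then show ?thesis by (simp add: DD_def algebra_simps)
    qed
  qed (use w w'_cont w'_pos in \<open>auto intro: less_imp_le\<close>)
  have "\<forall>i. \<exists>\<rho>::'a \<Rightarrow> real. steady_bump m w (R i) (\<delta> (a i)) \<rho>"
    using gd sp unfolding good_def by blast
  then obtain \<rho> :: "nat \<Rightarrow> 'a \<Rightarrow> real" where \<rho>: "\<And>i. steady_state m w (\<rho> i)" "\<And>i. radially_decreasing (\<rho> i)"
    "\<And>i x. 0 \<le> \<rho> i x" "\<And>i x. \<rho> i x \<le> \<delta> (a i)" "\<And>i x. R i \<le> norm x \<Longrightarrow> \<rho> i x = 0"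
    "\<And>i. continuous_on UNIV (\<rho> i)" "\<And>i. (LBINT x. \<rho> i x) = 1"
    by metis
  \<comment> \<open>State \<open>i\<close> lives in the ball of radius \<open>R i\<close>, inside
    that of radius \<open>a j\<close>. Equality would put the whole mass of state \<open>j\<close>
    there, while its height admits only 1/2.\<close>
  have distinct: "\<not> (AE x in lebesgue. \<rho> i x = \<rho> j x)" if ij: "i < j" for i j
  proof
    assume ae: "AE x in lebesgue. \<rho> i x = \<rho> j x"
    let ?b = "ball (0::'a) (a j)"
    have m [measurable]: "\<rho> i \<in> borel_measurable borel" for i using \<rho>(6) by (rule borel_measurable_continuous_onI)
    have im: "(\<lambda>x. indicator ?b x * \<rho> i x) \<in> borel_measurable lborel" for i
      using m[of i] by (intro borel_measurable_times borel_measurable_indicator) auto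
    have "R i \<le> a j" using aS_ge[of i] Rpos[of i] a_mono[of "Suc i" j] ij by simp
    then have "(\<lambda>x. indicator ?b x * \<rho> i x) = \<rho> i" using \<rho>(5)[of i] by (auto simp: fun_eq_iff indicator_def)
    then have "1 = (LBINT x. indicator ?b x * \<rho> i x)" using \<rho>(7)[of i] by simp
    also have "\<dots> = (\<integral>x. indicator ?b x * \<rho> i x \<partial>lebesgue)" by (rule integral_completion[OF im, symmetric])
    also have "\<dots> = (\<integral>x. indicator ?b x * \<rho> j x \<partial>lebesgue)"
    proof (rule integral_cong_AE)
      show "AE x in lebesgue. indicator ?b x * \<rho> i x = indicator ?b x * \<rho> j x"
        using ae by eventually_elim simp
    qed (use measurable_completion[OF im] in auto)
    also have "\<dots> = (LBINT x. indicator ?b x * \<rho> j x)" by (rule integral_completion[OF im])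
    also have "\<dots> \<le> (LBINT x. \<delta> (a j) * indicator ?b x)"
    proof (rule integral_mono)
      show ib: "integrable lborel (\<lambda>x. \<delta> (a j) * indicator ?b x)"
        using emeasure_bounded_finite[of ?b] by (intro integrable_mult_right integrable_real_indicator) auto
      show le: "indicator ?b x * \<rho> j x \<le> \<delta> (a j) * indicator ?b x" for x
        using \<rho>(4)[of j x] by (auto simp: indicator_def)
      show "integrable lborel (\<lambda>x. indicator ?b x * \<rho> j x)"
        by (rule Bochner_Integration.integrable_bound[OF ib im])
           (use \<rho>(3,4)[of j] in \<open>auto simp: indicator_def intro!: AE_I2 order_trans[OF _ abs_ge_self]\<close>)
    qed
    also have "\<dots> = 1 / 2" using apos[of j] content_ball_pos[of "a j" "0::'a"] by (simp add: \<delta>_def)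
    finally show False by simp
  qed
  \<comment> \<open>Between \<open>R0\<close> and \<open>r1\<close> the singular bound is largest at
    \<open>R0\<close>; from \<open>r1\<close> on the slope is at most 8.\<close>
  have bound: "norm (grad (radial_pot w :: 'a \<Rightarrow> real) x) \<le> max 8 (D * R0 powr (1 - ?n))" if x: "R0 \<le> norm x" for x
  proof -
    have x0: "0 < norm x" "x \<noteq> 0" using x R0 by auto
    have "norm (grad (radial_pot w :: 'a \<Rightarrow> real) x) = w' (norm x)"
      using grad_radial_pot[OF w[OF x0(1)] x0(2)] w'_pos[OF x0(1)] x0 by simp
    also have "\<dots> \<le> max 8 (D * R0 powr (1 - ?n))"
    proof (cases "norm x < r1")
      case True
      have "w' (norm x) \<le> D * norm x powr (1 - ?n)" using inner[OF x0(1) True] .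
      also have "\<dots> \<le> D * R0 powr (1 - ?n)" using D x R0 by (intro mult_left_mono powr_mono2') auto
      finally show ?thesis by simp
    qed (use w'_le8[of "norm x"] in simp)
    finally show ?thesis .
  qed
  have ne: "\<not> (AE x in lebesgue. \<rho> i x = \<rho> j x)" if "i \<noteq> j" for i j
    using distinct[of i j] distinct[of j i] that by (cases i j rule: linorder_cases) (auto simp: eq_commute)
  show "\<exists>w. W1 TYPE('a) w \<and>
           (\<exists>C. AE x in lebesgue. R0 \<le> norm x \<longrightarrow> norm (grad (radial_pot w :: 'a \<Rightarrow> real) x) \<le> C) \<and>
           (\<forall>r. 0 < r \<and> r < R0 \<longrightarrow> w r = w0 r) \<and>
           (\<exists>\<rho> :: nat \<Rightarrow> 'a \<Rightarrow> real.
              (\<forall>i. steady_state m w (\<rho> i) \<and> radially_decreasing (\<rho> i)) \<and>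
              (\<forall>i j. i \<noteq> j \<longrightarrow> \<not> (AE x in lebesgue. \<rho> i x = \<rho> j x)))"
  proof (intro exI[of _ w] conjI)
    show "\<exists>C. AE x in lebesgue. R0 \<le> norm x \<longrightarrow> norm (grad (radial_pot w :: 'a \<Rightarrow> real) x) \<le> C"
      using bound by (intro exI[of _ "max 8 (D * R0 powr (1 - ?n))"] AE_I2) simp
    show "\<exists>\<rho> :: nat \<Rightarrow> 'a \<Rightarrow> real. (\<forall>i. steady_state m w (\<rho> i) \<and> radially_decreasing (\<rho> i)) \<and>
              (\<forall>i j. i \<noteq> j \<longrightarrow> \<not> (AE x in lebesgue. \<rho> i x = \<rho> j x))"
      using \<rho>(1,2) ne by (intro exI[of _ \<rho>]) blast
  qed (use W1w w_eq in auto)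
qed

end
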